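(* Let $d,k\ge 1$, let $\Omega\subseteq\mathbb{R}^d$ be a compact convex set, let $\mu_1,\dots,\mu_k$ be probability measures on $\Omega$, and let $p$ be a probability measure on $\Omega^k$. Let $L:\mathbb{R}^{kd}\to\mathbb{R}$ be a continuously differentiable function satisfying $$\lim_{\beta\uparrow+\infty}\frac1\beta\int_{\mathbb{R}^{kd}}L(\beta x)\,dp(x)=0,$$ and suppose that $L$ is convex and $p$-translation-invariant, i.e. $L(x-z)=L(x)$ for all $x\in\Omega^k$ and $p$-almost all $z\in\Omega^k$. Then $$\inf_{(\pi,m)\in\mathcal{C}(p,\mu_1,\dots,\mu_k)}B(\pi,m)=\sup_{(\lambda,\{\lambda_l\}_{l=1}^k)\in\mathrm{D}(\mu_1,\dots,\mu_k)}\left\{\sum_{l=1}^k\int_\Omega\lambda_l(x_l)\,d\mu_l(x_l)-\int_{\Omega^k}\lambda(0,x)\,dp(x)\right\},$$ where $\mathrm{D}(\mu_1,\dots,\mu_k)$ is the set of all $(\lambda,\{\lambda_l\}_{l=1}^k)$ such that - $\lambda\in C^1([0,1]\times\Omega^k;\mathbb{R})$; - $\lambda_l:\Omega\to\mathbb{R}$ is $\mu_l$-integrable for each $l\in\{1,\dots,k\}$; - $\partial_t\lambda(t,x)+L^*(\nabla\lambda(t,x))\le 0$ for all $(t,x)\in[0,1]\times\Omega^k$; - $\sum_{l=1}^k\lambda_l(x_l)\le\lambda(1,x)$ for $(\otimes_{l=1}^k\mu_l)$-almost all $x=(x_1,\dots,x_k)\in\Omega^k$.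
   Context: Identify $(\mathbb{R}^d)^k\cong\mathbb{R}^{kd}$ and write $x=(x_1,\dots,x_k)$ with $x_l\in\mathbb{R}^d$; $[k]=\{1,\dots,k\}$. $L^*(y)=\sup_{x\in\mathbb{R}^{kd}}\{\langle x,y\rangle-L(x)\}$ is the Legendre–Fenchel transform of $L$, and $\nabla\lambda$ denotes the gradient in the space variable $x$. $\mathcal{P}(\Omega^k)$ is the set of probability measures on $\Omega^k$ with the weak convergence topology, $C([0,1];\mathcal{P}(\Omega^k))$ is the set of continuous maps $[0,1]\to\mathcal{P}(\Omega^k)$, and $\mathcal{M}([0,1]\times\Omega^k;\mathbb{R}^{kd})$ is the set of $\mathbb{R}^{kd}$-valued measures on $[0,1]\times\Omega^k$. Such vector measures are understood to be of the form $dm(t,x)\,dt$, with $m(t,\cdot)$ an $\mathbb{R}^{kd}$-valued measure on $\Omega^k$. The set $\mathcal{C}(p,\mu_1,\dots,\mu_k)$ consists of all pairs $(\pi,m)\in C([0,1];\mathcal{P}(\Omega^k))\times\mathcal{M}([0,1]\times\Omega^k;\mathbb{R}^{kd})$ such that: - $m\ll\pi$, meaning that $m(t,\cdot)$ is absolutely continuous with respect to $\pi(t,\cdot)$ for all $t\in[0,1]$; - $\int_0^1\int_{\Omega^k}\left|\frac{dm(t,x)}{d\pi(t,x)}\right|^{r}d\pi(t,x)\,dt<+\infty$ for some exponent $r>1$; - $\partial_t\pi+\nabla\cdot m=0$ in the weak sense: for every continuously differentiable $\eta\in C^1([0,1]\times\Omega^k;\mathbb{R})$, $$\int_0^1\!\int_{\Omega^k}\partial_t\eta\,d\pi(t,x)\,dt+\int_0^1\!\int_{\Omega^k}\langle\nabla\eta(t,x),dm(t,x)\rangle\,dt=\int_{\Omega^k}\eta(1,x)\,d\pi(1,x)-\int_{\Omega^k}\eta(0,x)\,d\pi(0,x);$$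 - $\pi(0,\cdot)=p$ and, for all $l\in[k]$, the $l$-th marginal $\pi_l(1,\cdot)$ of $\pi(1,\cdot)$ equals $\mu_l$. For $(\pi,m)\in\mathcal{C}(p,\mu_1,\dots,\mu_k)$ the dynamical cost is $$B(\pi,m)=\int_0^1\int_{\Omega^k}L\!\left(\frac{dm(t,x)}{d\pi(t,x)}\right)d\pi(t,x)\,dt .$$ *)

theory Defs
  imports "HOL-Probability.Probability"
begin

section \<open>Spaces of measures\<close>

text \<open>A point of $(\mathbb{R}^d)^k$ is an element of \<open>real ^ 'd ^ 'k\<close>, whose inner product is the one
  of $\mathbb{R}^{kd}$.\<close>

definition vec_power :: "'a set \<Rightarrow> ('a ^ 'k) set" where
  "vec_power \<Omega> = {x. \<forall>l. x $ l \<in> \<Omega>}"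

abbreviation borel_on :: "'a::topological_space set \<Rightarrow> 'a measure" where
  "borel_on X \<equiv> restrict_space borel X"

text \<open>Borel probability measures on \<open>X\<close>; these have \<open>space \<mu> = X\<close>.\<close>

definition prob_measures :: "'a::topological_space set \<Rightarrow> 'a measure set" where
  "prob_measures X = space (prob_algebra (borel_on X))"

definition weak_topology_on :: "'a::topological_space set \<Rightarrow> 'a measure topology" where
  "weak_topology_on X = topology_generated_by
     {{\<mu> \<in> prob_measures X. (\<integral>x. f x \<partial>\<mu>) \<in> U} | (f :: 'a \<Rightarrow> real) U.
        continuous_on X f \<and> bounded (f ` X) \<and> open U}"

section \<open>Vector-valued measures\<close>

text \<open>In this section \<open>M\<close> only supplies the \<open>\<sigma>\<close>-algebra, except where it is a reference measure for
  absolute continuity and densities.\<close>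

definition vector_measure :: "'a measure \<Rightarrow> ('a set \<Rightarrow> 'b::real_normed_vector) \<Rightarrow> bool" where
  "vector_measure M \<nu> \<longleftrightarrow>
     (\<forall>A :: nat \<Rightarrow> 'a set. range A \<subseteq> sets M \<longrightarrow> disjoint_family A \<longrightarrow>
        (\<lambda>i. \<nu> (A i)) sums \<nu> (\<Union>i. A i))"

text \<open>The positive part of the Jordan decomposition of a real-valued measure. Since \<open>\<nu> {} = 0\<close>, it
  does no harm that \<^const>\<open>ennreal\<close> sends negative numbers to \<open>0\<close>.\<close>

definition jordan_pos :: "'a measure \<Rightarrow> ('a set \<Rightarrow> real) \<Rightarrow> 'a measure" where
  "jordan_pos M \<nu> =
     measure_of (space M) (sets M) (\<lambda>A. SUP B\<in>{B \<in> sets M. B \<subseteq> A}. ennreal (\<nu> B))"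

definition signed_integral :: "'a measure \<Rightarrow> ('a set \<Rightarrow> real) \<Rightarrow> ('a \<Rightarrow> real) \<Rightarrow> real" where
  "signed_integral M \<nu> f =
     (\<integral>x. f x \<partial>jordan_pos M \<nu>) - (\<integral>x. f x \<partial>jordan_pos M (\<lambda>A. - \<nu> A))"

text \<open>$\int \langle g, d\nu\rangle$, computed in coordinates.\<close>

definition vector_integral ::
    "'a measure \<Rightarrow> ('a set \<Rightarrow> 'b::euclidean_space) \<Rightarrow> ('a \<Rightarrow> 'b) \<Rightarrow> real" where
  "vector_integral M \<nu> g =
     (\<Sum>b\<in>Basis. signed_integral M (\<lambda>A. \<nu> A \<bullet> b) (\<lambda>x. g x \<bullet> b))"

definition abs_continuous :: "('a set \<Rightarrow> 'b::real_normed_vector) \<Rightarrow> 'a measure \<Rightarrow> bool" where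
  "abs_continuous \<nu> M \<longleftrightarrow> (\<forall>A\<in>null_sets M. \<nu> A = 0)"

text \<open>The Radon--Nikodym density $d\nu/dM$, determined up to \<open>M\<close>-null sets. The library's
  \<^const>\<open>RN_deriv\<close> only covers nonnegative measures.\<close>

definition vector_density ::
    "('a set \<Rightarrow> 'b::euclidean_space) \<Rightarrow> 'a measure \<Rightarrow> 'a \<Rightarrow> 'b" where
  "vector_density \<nu> M =
     (SOME f. integrable M f \<and> (\<forall>A\<in>sets M. \<nu> A = set_lebesgue_integral M A f))"

section \<open>Differentiability and convex conjugation\<close>

text \<open>Being \<open>C\<^sup>1\<close> on a set \<open>S\<close> that need not be open means being \<open>C\<^sup>1\<close> on some open neighbourhood of
  \<open>S\<close>. Hence all derivatives at points of \<open>S\<close> are ordinary two-sided derivatives.\<close>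

definition C1_on :: "'a::real_inner set \<Rightarrow> ('a \<Rightarrow> real) \<Rightarrow> bool" where
  "C1_on S f \<longleftrightarrow>
     (\<exists>U D. open U \<and> S \<subseteq> U \<and> continuous_on U D \<and> (\<forall>x\<in>U. GDERIV f x :> D x))"

definition gradient :: "('a::real_inner \<Rightarrow> real) \<Rightarrow> 'a \<Rightarrow> 'a" where
  "gradient f x = (THE D. GDERIV f x :> D)"

definition time_deriv :: "(real \<times> 'a \<Rightarrow> real) \<Rightarrow> real \<Rightarrow> 'a \<Rightarrow> real" where
  "time_deriv \<eta> t x = deriv (\<lambda>s. \<eta> (s, x)) t"

definition space_grad :: "(real \<times> 'a::real_inner \<Rightarrow> real) \<Rightarrow> real \<Rightarrow> 'a \<Rightarrow> 'a" where
  "space_grad \<eta> t x = gradient (\<lambda>y. \<eta> (t, y)) x"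

definition legendre :: "('a::real_inner \<Rightarrow> real) \<Rightarrow> 'a \<Rightarrow> ereal" where
  "legendre L y = (SUP x. ereal (x \<bullet> y - L x))"

section \<open>The primal problem\<close>

definition prob_curves :: "'a::topological_space set \<Rightarrow> (real \<Rightarrow> 'a measure) set" where
  "prob_curves X = {\<pi>. continuous_map (top_of_set {0..1}) (weak_topology_on X) \<pi>}"

text \<open>Vector measures on $[0,1]\times X$ of the form $dm(t,x)\,dt$, represented by the family
  \<open>m t\<close>. The integrability condition gives a meaning to the mass
  $\int_I m(t,A)\,dt$ of $I\times A$.\<close>

definition momentum_curves ::
    "'a::topological_space set \<Rightarrow> (real \<Rightarrow> 'a set \<Rightarrow> 'b::euclidean_space) set" where
  "momentum_curves X =
     {m. (\<forall>t\<in>{0..1}. vector_measure (borel_on X) (m t)) \<and>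
         (\<forall>A\<in>sets (borel_on X). set_integrable lborel {0..1} (\<lambda>t. m t A))}"

definition continuity_equation ::
    "'a::euclidean_space set \<Rightarrow> (real \<Rightarrow> 'a measure) \<Rightarrow> (real \<Rightarrow> 'a set \<Rightarrow> 'a) \<Rightarrow> bool" where
  "continuity_equation X \<pi> m \<longleftrightarrow>
     (\<forall>\<eta>. C1_on ({0..1} \<times> X) \<eta> \<longrightarrow>
        (LINT t:{0..1}|lborel. (\<integral>x. time_deriv \<eta> t x \<partial>\<pi> t))
        + (LINT t:{0..1}|lborel. vector_integral (borel_on X) (m t) (space_grad \<eta> t))
        = (\<integral>x. \<eta> (1, x) \<partial>\<pi> 1) - (\<integral>x. \<eta> (0, x) \<partial>\<pi> 0))"

definition admissible ::
    "(real ^ 'd) set \<Rightarrow> (real ^ 'd ^ 'k) measure \<Rightarrow> ('k \<Rightarrow> (real ^ 'd) measure) \<Rightarrow>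
     ((real \<Rightarrow> (real ^ 'd ^ 'k) measure) \<times> (real \<Rightarrow> (real ^ 'd ^ 'k) set \<Rightarrow> real ^ 'd ^ 'k)) set"
  where
  "admissible \<Omega> p \<mu> =
     {(\<pi>, m). \<pi> \<in> prob_curves (vec_power \<Omega>) \<and> m \<in> momentum_curves (vec_power \<Omega>) \<and>
        (\<forall>t\<in>{0..1}. abs_continuous (m t) (\<pi> t)) \<and>
        (\<exists>r>1. (\<integral>\<^sup>+t\<in>{0..1}. (\<integral>\<^sup>+x. ennreal (norm (vector_density (m t) (\<pi> t) x) powr r) \<partial>\<pi> t)
                  \<partial>lborel) < \<infinity>) \<and>
        continuity_equation (vec_power \<Omega>) \<pi> m \<and>
        \<pi> 0 = p \<and>
        (\<forall>l. distr (\<pi> 1) (borel_on \<Omega>) (\<lambda>x. x $ l) = \<mu> l)}"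

text \<open>The cost may be \<open>\<infinity>\<close>, so the integral is the extended one, positive part minus
  negative part.\<close>

definition dynamical_cost ::
    "('a::euclidean_space \<Rightarrow> real) \<Rightarrow> (real \<Rightarrow> 'a measure) \<Rightarrow> (real \<Rightarrow> 'a set \<Rightarrow> 'a) \<Rightarrow> ereal" where
  "dynamical_cost L \<pi> m =
     enn2ereal (\<integral>\<^sup>+t\<in>{0..1}. (\<integral>\<^sup>+x. ennreal (L (vector_density (m t) (\<pi> t) x)) \<partial>\<pi> t) \<partial>lborel)
     - enn2ereal (\<integral>\<^sup>+t\<in>{0..1}. (\<integral>\<^sup>+x. ennreal (- L (vector_density (m t) (\<pi> t) x)) \<partial>\<pi> t) \<partial>lborel)"

section \<open>The dual problem\<close>

definition dual_feasible ::
    "(real ^ 'd) set \<Rightarrow> (real ^ 'd ^ 'k \<Rightarrow> real) \<Rightarrow> ('k \<Rightarrow> (real ^ 'd) measure) \<Rightarrow>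
     ((real \<times> (real ^ 'd ^ 'k) \<Rightarrow> real) \<times> ('k \<Rightarrow> real ^ 'd \<Rightarrow> real)) set" where
  "dual_feasible \<Omega> L \<mu> =
     {(\<phi>, \<psi>). C1_on ({0..1} \<times> vec_power \<Omega>) \<phi> \<and>
        (\<forall>l. integrable (\<mu> l) (\<psi> l)) \<and>
        (\<forall>t\<in>{0..1}. \<forall>x\<in>vec_power \<Omega>.
           ereal (time_deriv \<phi> t x) + legendre L (space_grad \<phi> t x) \<le> 0) \<and>
        (AE x in Pi\<^sub>M UNIV \<mu>. (\<Sum>l\<in>UNIV. \<psi> l (x l)) \<le> \<phi> (1, vec_lambda x))}"

definition translation_invariant ::
    "'a::real_vector set \<Rightarrow> 'a measure \<Rightarrow> ('a \<Rightarrow> real) \<Rightarrow> bool" where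
  "translation_invariant X p L \<longleftrightarrow> (\<forall>x\<in>X. AE z in p. L (x - z) = L x)"

end

theory Submission
  imports Defs
begin

text \<open>
  Both sides equal the static multi-marginal transport cost, the infimum of \<open>\<integral> L d\<gamma>\<close> over the couplings
  \<open>\<gamma>\<close> of the \<open>\<mu> l\<close>.

  Weak duality tests the continuity equation with a dual potential. Conversely, Kantorovich duality
  for the cost \<open>L\<close> gives a nearly optimal coupling. Moving mass from an independent sample \<open>z\<close> of \<open>p\<close> to
  a sample \<open>x\<close> of the coupling along straight lines costs, by Jensen, at most the mean of \<open>L (x - z)\<close>,
  which is the mean of \<open>L x\<close> by translation invariance. On the dual side, static potentials are
  complemented by the self-similar Hamilton--Jacobi solution \<open>(t + \<epsilon>) * L (x / (t + \<epsilon>))\<close>; the growth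
  assumption says that its initial value has vanishing mean as \<open>\<epsilon> \<rightarrow> 0\<close>.
\<close>

section \<open>Finite linear programs and lower integrals\<close>

text \<open>The dynamical problem collapses to a static one because \<open>L\<close> is convex and
  depends neither on time nor on position: a particle going from \<open>z\<close> to
  \<open>x\<close> in unit time can do no better than constant speed, at cost
  \<open>L (x - z)\<close>. Translation invariance then removes \<open>z\<close>, so starting points
  can be drawn independently of endpoints. The same heuristic produces the dual potential:
  \<open>t * L (x / t)\<close> is the least cost of reaching \<open>x\<close> from the origin in
  time \<open>t\<close>. It is singular at \<open>t = 0\<close>, where a potential must still be
  continuously differentiable. Starting the clock at \<open>\<epsilon>\<close> repairs this, and the
  price, the mean of \<open>\<epsilon> * L (x / \<epsilon>)\<close> under \<open>p\<close>, is the
  growth expression at \<open>\<beta> = 1 / \<epsilon>\<close>. Two obstacles shape the rest.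
  Densities are chosen separately for each time, so no joint measurability in time and space is at
  hand. And \<open>L\<close> of the velocity need not be integrable along an admissible curve, so
  inequalities between costs are kept in additive form until the end.\<close>

lemma compact_simplex_functions:
  assumes "finite I"
  shows "compact {w::'i \<Rightarrow> real. (\<forall>i. w i \<in> (if i \<in> I then {0..1} else {0})) \<and> sum w I = 1}"
proof -
  \<comment> \<open>Tychonoff: pinning the weights to \<open>0\<close> outside \<open>I\<close>
    makes every factor compact, although the index type may be infinite.\<close>
  have "compactin (product_topology (\<lambda>i. euclidean) UNIV)
          (PiE UNIV (\<lambda>i. if i \<in> I then {0..1::real} else {0}))"
    by (subst compactin_PiE) auto
  then have *: "compact (PiE UNIV (\<lambda>i. if i \<in> I then {0..1::real} else {0}))"
    by (simp add: euclidean_product_topology)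
  have "closed {w::'i \<Rightarrow> real. sum w I = 1}"
    by (intro closed_Collect_eq continuous_on_sum continuous_on_product_coordinates continuous_intros)
  from compact_Int_closed[OF * this] show ?thesis
    by (rule back_subst[where P=compact]) (auto simp: PiE_def Pi_def)
qed

text \<open>A minimiser of the penalised cost yields, through its first-order conditions, a dual feasible
  point whose value is at least its cost.\<close>

lemma penalised_lp_minimiser:
  fixes A :: "'i \<Rightarrow> 'j \<Rightarrow> real" and N :: real
  assumes I: "finite I" and J: "finite J" and N: "N > 0"
    and w0: "\<And>i. i \<in> I \<Longrightarrow> 0 \<le> w0 i" "sum w0 I = 1"
      "\<And>j. j \<in> J \<Longrightarrow> (\<Sum>i\<in>I. w0 i * A i j) = a j"
    and dual: "\<And>u k. (\<And>i. i \<in> I \<Longrightarrow> (\<Sum>j\<in>J. u j * A i j) + k \<le> c i) \<Longrightarrow>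
      (\<Sum>j\<in>J. u j * a j) + k \<le> V"
  shows "\<exists>w. (\<forall>i. w i \<in> (if i \<in> I then {0..1} else {0})) \<and> sum w I = 1 \<and>
    (\<Sum>i\<in>I. w i * c i) \<le> V \<and>
    N * (\<Sum>j\<in>J. ((\<Sum>i\<in>I. w i * A i j) - a j)\<^sup>2) \<le> 2 * (\<Sum>i\<in>I. \<bar>c i\<bar>)"
proof -
  let ?K = "{w::'i \<Rightarrow> real. (\<forall>i. w i \<in> (if i \<in> I then {0..1} else {0})) \<and> sum w I = 1}"
  define C where "C w = (\<Sum>i\<in>I. w i * c i)" for w
  define r where "r w j = (\<Sum>i\<in>I. w i * A i j) - a j" for w j
  define F where "F w = C w + N * (\<Sum>j\<in>J. (r w j)\<^sup>2)" for w
  \<comment> \<open>The feasible point, cut down to \<open>I\<close> so that it lies in the compact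
    set; it is the competitor with zero residual.\<close>
  define w1 where "w1 i = (if i \<in> I then w0 i else 0)" for i
  have le1: "w0 i \<le> 1" if "i \<in> I" for i
    using member_le_sum[of i I w0] w0 that I by auto
  have w1: "w1 \<in> ?K" using w0(1,2) le1 by (auto simp: w1_def)
  have r1: "r w1 j = 0" if "j \<in> J" for j
    using w0(3)[OF that] by (simp add: r_def w1_def)
  have "continuous_on UNIV F" unfolding F_def C_def r_def
    by (intro continuous_intros continuous_on_product_coordinates)
  then have "continuous_on ?K F" using continuous_on_subset by blast
  with compact_simplex_functions[OF I] w1
  obtain w where w: "w \<in> ?K" and min: "\<And>d. d \<in> ?K \<Longrightarrow> F w \<le> F d"
    using continuous_attains_inf[of ?K F] by blast
  define q where "q = (\<Sum>j\<in>J. (r w j)\<^sup>2)"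
  have q0: "q \<ge> 0" unfolding q_def by (intro sum_nonneg) auto
  \<comment> \<open>With residual \<open>r w\<close>, the derivative of \<open>F\<close> at
    \<open>w\<close> towards the vertex \<open>i\<close> is \<open>c i - C w + 2 * N *
    (\<Sum>j\<in>J. r w j * (A i j - a j - r w j))\<close>, and it is nonnegative at a minimiser.
    Read as a dual constraint, this gives the multipliers \<open>u j = - 2 * N * r w j\<close>; the
    remaining terms, free of \<open>i\<close>, form the constant \<open>k\<close>.\<close>
  have first_order: "(\<Sum>j\<in>J. (- 2 * N * r w j) * A i j)
      + (C w + 2 * N * (\<Sum>j\<in>J. r w j * (a j + r w j))) \<le> c i" if i: "i \<in> I" for i
  proof -
    define e where "e j = A i j - a j - r w j" for j
    define S1 where "S1 = (\<Sum>j\<in>J. r w j * e j)"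
    define S2 where "S2 = (\<Sum>j\<in>J. (e j)\<^sup>2)"
    \<comment> \<open>A fraction \<open>s\<close> of the mass is shifted to the vertex
      \<open>i\<close>. \<open>F\<close> is quadratic in \<open>s\<close>, and one factor
      \<open>s\<close> is divided out before \<open>s\<close> tends to \<open>0\<close>.\<close>
    have *: "0 \<le> (c i - C w + 2 * N * S1) + s * (N * S2)" if s: "0 < s" "s \<le> 1" for s
    proof -
      define d where "d i' = (1 - s) * w i' + s * (if i' = i then 1 else 0)" for i'
      have sd: "(\<Sum>i'\<in>I. d i' * f i') = (1 - s) * (\<Sum>i'\<in>I. w i' * f i') + s * f i" for f :: "'i \<Rightarrow> real"
      proof -
        have "(\<Sum>i'\<in>I. d i' * f i')
            = (\<Sum>i'\<in>I. (1 - s) * (w i' * f i') + s * (if i' = i then f i' else 0))"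
          by (intro sum.cong) (auto simp: d_def algebra_simps)
        also have "\<dots> = (1 - s) * (\<Sum>i'\<in>I. w i' * f i') + s * f i"
          using i I by (simp add: sum.distrib sum_distrib_left[symmetric])
        finally show ?thesis .
      qed
      have s1: "sum d I = 1" using sd[of "\<lambda>_. 1"] w by simp
      have "d i' \<in> (if i' \<in> I then {0..1} else {0})" for i'
      proof (cases "i' \<in> I")
        case True
        then have g: "0 \<le> w i'" "w i' \<le> 1" using w by (auto split: if_splits)
        have "(1 - s) * w i' \<le> (1 - s) * 1" using s g by (intro mult_left_mono) auto
        then show ?thesis using True g s by (auto simp: d_def)
      next
        case False then show ?thesis using w i by (auto simp: d_def dest: spec[of _ i'])
      qed
      with s1 have "F w \<le> F d" by (intro min) simp
      moreover have "C d = C w + s * (c i - C w)"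
        unfolding C_def sd by (simp add: algebra_simps)
      moreover have "r d j = r w j + s * e j" for j
        unfolding e_def by (simp add: r_def sd algebra_simps)
      then have "(\<Sum>j\<in>J. (r d j)\<^sup>2) = q + 2 * s * S1 + s\<^sup>2 * S2"
        unfolding q_def S1_def S2_def
        by (simp add: power2_sum power_mult_distrib sum.distrib sum_distrib_left mult_ac)
      ultimately have "0 \<le> s * (c i - C w) + N * (2 * s * S1 + s\<^sup>2 * S2)"
        by (simp add: F_def q_def algebra_simps)
      also have "\<dots> = s * ((c i - C w + 2 * N * S1) + s * (N * S2))"
        by (simp add: algebra_simps power2_eq_square)
      finally show ?thesis using s by (simp add: zero_le_mult_iff)
    qed
    have "((\<lambda>s. (c i - C w + 2 * N * S1) + s * (N * S2)) \<longlongrightarrow> (c i - C w + 2 * N * S1) + 0 * (N * S2)) (at_right 0)"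
      by (intro tendsto_intros)
    moreover have "eventually (\<lambda>s. 0 \<le> (c i - C w + 2 * N * S1) + s * (N * S2)) (at_right 0)"
      by (rule eventually_mono[OF eventually_at_right_real[of 0 1]]) (use * in auto)
    ultimately have "0 \<le> c i - C w + 2 * N * S1"
      using tendsto_lowerbound[of _ _ "at_right (0::real)" 0] by fastforce
    moreover have "(\<Sum>j\<in>J. (- 2 * N * r w j) * A i j) + 2 * N * (\<Sum>j\<in>J. r w j * (a j + r w j)) = - 2 * N * S1"
      by (simp add: S1_def e_def sum_distrib_left sum_negf[symmetric] sum.distrib[symmetric] algebra_simps
          sum_subtractf)
    ultimately show ?thesis by linarith
  qed
  \<comment> \<open>The dual value of these multipliers is \<open>C w + 2 * N * q\<close>, which is
    at least \<open>C w\<close>.\<close>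
  have "(\<Sum>j\<in>J. (- 2 * N * r w j) * a j) + (C w + 2 * N * (\<Sum>j\<in>J. r w j * (a j + r w j))) \<le> V"
    by (rule dual) (rule first_order)
  moreover have "(\<Sum>j\<in>J. (- 2 * N * r w j) * a j) + 2 * N * (\<Sum>j\<in>J. r w j * (a j + r w j)) = 2 * N * q"
    by (simp add: q_def sum_distrib_left sum_negf[symmetric] sum.distrib[symmetric] algebra_simps
          sum_subtractf power2_eq_square)
  moreover have "0 \<le> 2 * N * q" using N q0 by simp
  ultimately have CV: "C w \<le> V" by linarith
  have bd: "\<bar>C d\<bar> \<le> (\<Sum>i\<in>I. \<bar>c i\<bar>)" if "d \<in> ?K" for d
  proof -
    have "\<bar>C d\<bar> \<le> (\<Sum>i\<in>I. \<bar>d i * c i\<bar>)" unfolding C_def by (rule sum_abs)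
    also have "\<dots> \<le> (\<Sum>i\<in>I. \<bar>c i\<bar>)"
    proof (rule sum_mono)
      fix i assume "i \<in> I"
      then have "0 \<le> d i" "d i \<le> 1" using that by (auto split: if_splits)
      then show "\<bar>d i * c i\<bar> \<le> \<bar>c i\<bar>" by (simp add: abs_mult mult_left_le_one_le)
    qed
    finally show ?thesis .
  qed
  \<comment> \<open>Comparison with a feasible point: the penalty is at most the oscillation of the
    cost over the simplex, a bound independent of \<open>N\<close>.\<close>
  have "F w \<le> F w1" by (rule min[OF w1])
  then have "N * q \<le> C w1 - C w" by (simp add: F_def q_def r1)
  with bd[OF w] bd[OF w1] have "N * q \<le> 2 * (\<Sum>i\<in>I. \<bar>c i\<bar>)" by linarith
  with w CV show ?thesis by (intro exI[of _ w]) (simp add: C_def q_def r_def)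
qed

text \<open>The penalty is sent to infinity. The sets \<open>G n\<close> are closed and decreasing,
  and each meets the compact simplex, so they have a common point there. Its squared residual is at
  most \<open>M / (n + 1)\<close> for all \<open>n\<close>, hence zero. Strong duality thus comes
  from compactness rather than from a separation argument.\<close>

lemma finite_lp_duality:
  fixes A :: "'i \<Rightarrow> 'j \<Rightarrow> real"
  assumes I: "finite I" and J: "finite J"
    and w0: "\<And>i. i \<in> I \<Longrightarrow> 0 \<le> w0 i" "sum w0 I = 1"
      "\<And>j. j \<in> J \<Longrightarrow> (\<Sum>i\<in>I. w0 i * A i j) = a j"
    and dual: "\<And>u k. (\<And>i. i \<in> I \<Longrightarrow> (\<Sum>j\<in>J. u j * A i j) + k \<le> c i) \<Longrightarrow>
      (\<Sum>j\<in>J. u j * a j) + k \<le> V"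
  shows "\<exists>w. (\<forall>i\<in>I. 0 \<le> w i) \<and> sum w I = 1 \<and>
    (\<forall>j\<in>J. (\<Sum>i\<in>I. w i * A i j) = a j) \<and> (\<Sum>i\<in>I. w i * c i) \<le> V"
proof -
  define K where "K = {w::'i \<Rightarrow> real. (\<forall>i. w i \<in> (if i \<in> I then {0..1} else {0})) \<and> sum w I = 1}"
  define M where "M = 2 * (\<Sum>i\<in>I. \<bar>c i\<bar>)"
  define q where "q w = (\<Sum>j\<in>J. ((\<Sum>i\<in>I. w i * A i j) - a j)\<^sup>2)" for w :: "'i \<Rightarrow> real"
  define G where "G n = {w. (\<Sum>i\<in>I. w i * c i) \<le> V \<and> real (Suc n) * q w \<le> M}" for n
  have q0: "q w \<ge> 0" for w unfolding q_def by (intro sum_nonneg) auto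
  have cl: "closed (G n)" for n unfolding G_def q_def
    by (intro closed_Collect_conj closed_Collect_le continuous_intros continuous_on_product_coordinates)
  have fip: "K \<inter> (\<Inter>n\<in>S. G n) \<noteq> {}" if S: "finite S" for S
  proof -
    define n where "n = Max (insert 0 S)"
    obtain w where g: "w \<in> K" "(\<Sum>i\<in>I. w i * c i) \<le> V" "real (Suc n) * q w \<le> M"
      using penalised_lp_minimiser[where N="real (Suc n)" and A=A and a=a and c=c and V=V,
          OF I J _ w0 dual] unfolding q_def M_def K_def by auto
    have "w \<in> G m" if "m \<in> S" for m
    proof -
      have "m \<le> n" using that S by (simp add: n_def)
      then have "real (Suc m) * q w \<le> real (Suc n) * q w" using q0 by (intro mult_right_mono) auto
      with g show ?thesis by (simp add: G_def)
    qed
    with g show ?thesis by blast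
  qed
  have "K \<inter> (\<Inter>n. G n) \<noteq> {}"
    by (rule compact_imp_fip_image) (use compact_simplex_functions[OF I] cl fip in \<open>simp_all add: K_def\<close>)
  then obtain w where g: "w \<in> K" "\<And>n. w \<in> G n" by blast
  have "q w \<le> 0"
  proof (rule ccontr)
    assume "\<not> q w \<le> 0"
    then obtain n where "real n * q w > M" using reals_Archimedean3[of "q w"] by (meson not_le)
    moreover have "real n * q w \<le> real (Suc n) * q w" using q0 by (intro mult_right_mono) auto
    ultimately show False using g(2)[of n] by (simp add: G_def)
  qed
  then have "q w = 0" using q0[of w] by simp
  then have *: "(\<Sum>i\<in>I. w i * A i j) = a j" if "j \<in> J" for j
    unfolding q_def using J that by (subst (asm) sum_nonneg_eq_0_iff) auto
  then show ?thesis
    using g by (intro exI[of _ w]) (auto simp: K_def G_def split: if_splits)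
qed

text \<open>The measurability in \<open>t\<close> of the inner integrals in \<^const>\<open>dynamical_cost\<close> is not at hand; with
  this lemma their time integrals are compared as lower integrals.\<close>

lemma nn_integral_add_measurable:
  fixes f h :: "'a \<Rightarrow> ennreal"
  assumes [measurable]: "h \<in> borel_measurable M" and fin: "\<And>x. h x < \<top>"
  shows "(\<integral>\<^sup>+x. f x + h x \<partial>M) = (\<integral>\<^sup>+x. f x \<partial>M) + (\<integral>\<^sup>+x. h x \<partial>M)"
proof (rule antisym)
  show "(\<integral>\<^sup>+x. f x + h x \<partial>M) \<le> (\<integral>\<^sup>+x. f x \<partial>M) + (\<integral>\<^sup>+x. h x \<partial>M)"
    unfolding nn_integral_def[of M "\<lambda>x. f x + h x"]
  proof (rule SUP_least, safe)
    fix s assume s: "simple_function M s" and le: "s \<le> (\<lambda>x. f x + h x)"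
    then have [measurable]: "s \<in> borel_measurable M" by (simp add: borel_measurable_simple_function)
    have "integral\<^sup>S M s = (\<integral>\<^sup>+x. s x \<partial>M)" using s by (simp add: nn_integral_eq_simple_integral)
    \<comment> \<open>The truncated difference \<open>s - h\<close> is measurable and,
      \<open>h\<close> being finite, lies below \<open>f\<close>; it stands in for \<open>f\<close>,
      which is not known to be measurable.\<close>
    also have "\<dots> \<le> (\<integral>\<^sup>+x. (s x - h x) + h x \<partial>M)"
    proof (intro nn_integral_mono)
      fix x show "s x \<le> (s x - h x) + h x"
        by (metis diff_add_cancel_ennreal add_increasing le_cases zero_le)
    qed
    also have "\<dots> = (\<integral>\<^sup>+x. s x - h x \<partial>M) + (\<integral>\<^sup>+x. h x \<partial>M)" by (intro nn_integral_add) auto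
    also have "\<dots> \<le> (\<integral>\<^sup>+x. f x \<partial>M) + (\<integral>\<^sup>+x. h x \<partial>M)"
    proof (intro add_right_mono nn_integral_mono)
      fix x
      have "s x \<le> h x + f x" using le by (auto simp: le_fun_def add.commute)
      then show "s x - h x \<le> f x" using fin[of x] by (auto simp: ennreal_minus_le_iff)
    qed
    finally show "integral\<^sup>S M s \<le> (\<integral>\<^sup>+x. f x \<partial>M) + (\<integral>\<^sup>+x. h x \<partial>M)" .
  qed
next
  show "(\<integral>\<^sup>+x. f x \<partial>M) + (\<integral>\<^sup>+x. h x \<partial>M) \<le> (\<integral>\<^sup>+x. f x + h x \<partial>M)"
  proof -
    have "(\<integral>\<^sup>+x. f x \<partial>M) + (\<integral>\<^sup>+x. h x \<partial>M)
      = (SUP s\<in>{s. simple_function M s \<and> s \<le> f}. integral\<^sup>S M s + (\<integral>\<^sup>+x. h x \<partial>M))"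
      unfolding nn_integral_def[of M f]
    proof (rule ennreal_SUP_add_left[symmetric])
      have "(\<lambda>_. 0) \<in> {s. simple_function M s \<and> s \<le> f}" by (simp add: le_fun_def)
      then show "{s. simple_function M s \<and> s \<le> f} \<noteq> {}" by blast
    qed
    also have "\<dots> \<le> (\<integral>\<^sup>+x. f x + h x \<partial>M)"
    proof (rule SUP_least, safe)
      fix s assume s: "simple_function M s" and le: "s \<le> f"
      then have [measurable]: "s \<in> borel_measurable M" by (simp add: borel_measurable_simple_function)
      have "integral\<^sup>S M s + (\<integral>\<^sup>+x. h x \<partial>M) = (\<integral>\<^sup>+x. s x + h x \<partial>M)"
        using s by (simp add: nn_integral_eq_simple_integral nn_integral_add)
      also have "\<dots> \<le> (\<integral>\<^sup>+x. f x + h x \<partial>M)"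
        using le by (intro nn_integral_mono add_right_mono) (auto simp: le_fun_def)
      finally show "integral\<^sup>S M s + (\<integral>\<^sup>+x. h x \<partial>M) \<le> (\<integral>\<^sup>+x. f x + h x \<partial>M)" .
    qed
    finally show ?thesis .
  qed
qed

text \<open>Each point receives the least index of a nearby centre from a finite cover. An index
  function, rather than a list of cells, makes disjointness and measurability of the cells
  automatic: they are its fibres.\<close>

lemma compact_small_partition:
  fixes X :: "'a::{metric_space,second_countable_topology} set"
  assumes "compact X" "d > 0"
  obtains idx :: "'a \<Rightarrow> nat" and N c where
    "idx \<in> borel_on X \<rightarrow>\<^sub>M count_space UNIV"
    "\<And>x. x \<in> X \<Longrightarrow> idx x < N"
    "\<And>n. n < N \<Longrightarrow> c n \<in> X"
    "\<And>x. x \<in> X \<Longrightarrow> dist x (c (idx x)) < d"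
proof -
  obtain K where K: "finite K" "K \<subseteq> X" "X \<subseteq> (\<Union>x\<in>K. ball x d)"
    using compactE_image[OF assms(1), of X "\<lambda>x. ball x d"] assms(2) by (metis centre_in_ball open_ball UN_I subsetI)
  obtain c :: "nat \<Rightarrow> 'a" and N where c: "K = c ` {i. i < N}"
    using finite_imp_nat_seg_image_inj_on[OF K(1)] by blast
  define idx where "idx x = (LEAST i. dist x (c i) < d)" for x
  have ex: "\<exists>i<N. dist x (c i) < d" if "x \<in> X" for x
    using K(3) that by (force simp: c dist_commute)
  show thesis
  proof
    have "idx \<in> borel \<rightarrow>\<^sub>M count_space UNIV" unfolding idx_def by measurable
    then show "idx \<in> borel_on X \<rightarrow>\<^sub>M count_space UNIV" by (rule measurable_restrict_space1)
    fix x assume x: "x \<in> X"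
    from ex[OF x] obtain i where i: "i < N" "dist x (c i) < d" by blast
    then show "dist x (c (idx x)) < d" unfolding idx_def by (intro LeastI)
    show "idx x < N" using i Least_le[of "\<lambda>i. dist x (c i) < d" i] unfolding idx_def by linarith
  qed (use K(2) c in auto)
qed

section \<open>Densities of vector-valued measures\<close>

lemmas lebesgue_integral_cong = Bochner_Integration.integral_cong[OF refl]

lemma vector_measure_sums:
  "vector_measure M \<nu> \<Longrightarrow> range A \<subseteq> sets M \<Longrightarrow> disjoint_family A \<Longrightarrow> (\<lambda>i. \<nu> (A i)) sums \<nu> (\<Union>i. A i)"
  by (simp add: vector_measure_def)

lemma vector_measure_empty:
  assumes "vector_measure M \<nu>"
  shows "\<nu> {} = 0"
proof -
  have "(\<lambda>i::nat. \<nu> {}) sums \<nu> (\<Union>i::nat. {})"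
    by (rule vector_measure_sums[OF assms]) (auto simp: disjoint_family_on_def)
  then have "(\<lambda>i::nat. \<nu> {}) \<longlonglongrightarrow> 0" by (intro summable_LIMSEQ_zero) (simp add: sums_iff)
  then show ?thesis by (simp add: LIMSEQ_const_iff)
qed

lemma vector_measure_Un:
  assumes \<nu>: "vector_measure M \<nu>" and "A \<in> sets M" "B \<in> sets M" "A \<inter> B = {}"
  shows "\<nu> (A \<union> B) = \<nu> A + \<nu> B"
proof -
  have "(\<lambda>i. \<nu> (binaryset A B i)) sums \<nu> (\<Union>i. binaryset A B i)"
    using assms by (intro vector_measure_sums[OF \<nu>])
      (auto simp: range_binaryset_eq disjoint_family_on_def binaryset_def)
  moreover have "(\<lambda>i. \<nu> (binaryset A B i)) sums (\<nu> A + \<nu> B)"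
    by (rule binaryset_sums) (rule vector_measure_empty[OF \<nu>])
  ultimately show ?thesis by (metis UN_binaryset_eq sums_unique2)
qed

lemma vector_measure_Diff:
  assumes \<nu>: "vector_measure M \<nu>" and "A \<in> sets M" "B \<in> sets M" "B \<subseteq> A"
  shows "\<nu> (A - B) = \<nu> A - \<nu> B"
proof -
  have "\<nu> ((A - B) \<union> B) = \<nu> (A - B) + \<nu> B"
    using assms by (intro vector_measure_Un[OF \<nu>]) auto
  moreover have "(A - B) \<union> B = A" using assms by auto
  ultimately show ?thesis by simp
qed

lemma vector_measure_uminus: "vector_measure M \<nu> \<Longrightarrow> vector_measure M (\<lambda>A. - \<nu> A)"
  by (auto simp: vector_measure_def intro!: sums_minus)

lemma vector_measure_inner:
  fixes \<nu> :: "'a set \<Rightarrow> 'b::euclidean_space"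
  shows "vector_measure M \<nu> \<Longrightarrow> vector_measure M (\<lambda>A. \<nu> A \<bullet> b)"
  unfolding vector_measure_def using bounded_linear.sums[OF bounded_linear_inner_left] by blast

section \<open>Hahn decomposition of a real-valued measure\<close>

definition positive_set :: "'a measure \<Rightarrow> ('a set \<Rightarrow> real) \<Rightarrow> 'a set \<Rightarrow> bool" where
  "positive_set M \<nu> P \<longleftrightarrow> P \<in> sets M \<and> (\<forall>B\<in>sets M. B \<subseteq> P \<longrightarrow> 0 \<le> \<nu> B)"

lemma positive_setD: "positive_set M \<nu> P \<Longrightarrow> B \<in> sets M \<Longrightarrow> B \<subseteq> P \<Longrightarrow> 0 \<le> \<nu> B"
  by (auto simp: positive_set_def)

text \<open>The greedy choice in Hahn's construction. That \<open>\<nu>\<close> is bounded below on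
  the subsets of \<open>S\<close> is not known in advance: either some subset has mass at most
  \<open>-1\<close>, or the infimum is finite and some subset realises at least half of it.\<close>

lemma half_minimal_subset:
  fixes \<nu> :: "'a set \<Rightarrow> real"
  assumes e: "\<nu> {} = 0"
  shows "\<exists>B\<in>sets M. B \<subseteq> S \<and> \<nu> B \<le> 0 \<and> (\<nu> B \<le> -1 \<or> (\<forall>C\<in>sets M. C \<subseteq> S \<longrightarrow> 2 * \<nu> B \<le> \<nu> C))"
proof (cases "\<exists>C\<in>sets M. C \<subseteq> S \<and> \<nu> C \<le> -1")
  case True
  then obtain C where "C \<in> sets M" "C \<subseteq> S" "\<nu> C \<le> -1" by blast
  then show ?thesis by (intro bexI[of _ C]) auto
next
  case False
  define s where "s = Inf (\<nu> ` {C \<in> sets M. C \<subseteq> S})"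
  have bdd: "bdd_below (\<nu> ` {C \<in> sets M. C \<subseteq> S})"
    using False by (intro bdd_belowI[of _ "-1"]) force
  have s_le: "s \<le> \<nu> C" if "C \<in> sets M" "C \<subseteq> S" for C
    unfolding s_def using that by (intro cInf_lower bdd) auto
  show ?thesis
  proof (cases "s < 0")
    case True
    then have "s < s / 2" by simp
    then obtain C where "C \<in> sets M" "C \<subseteq> S" "\<nu> C < s / 2"
      using cInf_lessD[of "\<nu> ` {C \<in> sets M. C \<subseteq> S}" "s/2"] unfolding s_def by auto
    moreover have "2 * \<nu> C \<le> \<nu> D" if "D \<in> sets M" "D \<subseteq> S" for D
      using s_le[OF that] \<open>\<nu> C < s / 2\<close> by simp
    ultimately show ?thesis using True by (intro bexI[of _ C]) auto
  next
    case False
    have "0 \<le> \<nu> D" if "D \<in> sets M" "D \<subseteq> S" for D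
      using s_le[OF that] False by simp
    with e show ?thesis by (intro bexI[of _ "{}"]) auto
  qed
qed

text \<open>Negative pieces are cut off one after another. They are disjoint, so their masses form a
  convergent series and tend to \<open>0\<close>; as each late cut takes at least half of what is
  possible, nothing negative can remain. Only nonpositive mass has been removed, whence
  \<open>\<nu> A \<le> \<nu> P\<close>.\<close>

lemma positive_subset_exists:
  assumes \<nu>: "vector_measure M \<nu>" and A: "A \<in> sets M"
  obtains P where "positive_set M \<nu> P" "P \<subseteq> A" "\<nu> A \<le> \<nu> P"
proof -
  have "\<forall>S. \<exists>B. B \<in> sets M \<and> B \<subseteq> S \<and> \<nu> B \<le> 0 \<and>
      (\<nu> B \<le> -1 \<or> (\<forall>C\<in>sets M. C \<subseteq> S \<longrightarrow> 2 * \<nu> B \<le> \<nu> C))"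
  proof
    fix S show "\<exists>B. B \<in> sets M \<and> B \<subseteq> S \<and> \<nu> B \<le> 0 \<and>
      (\<nu> B \<le> -1 \<or> (\<forall>C\<in>sets M. C \<subseteq> S \<longrightarrow> 2 * \<nu> B \<le> \<nu> C))"
      using half_minimal_subset[where \<nu>=\<nu> and M=M and S=S, OF vector_measure_empty[OF \<nu>]]
      unfolding Bex_def .
  qed
  then obtain f where f: "\<And>S. f S \<in> sets M" "\<And>S. f S \<subseteq> S" "\<And>S. \<nu> (f S) \<le> 0"
    "\<And>S. \<nu> (f S) \<le> -1 \<or> (\<forall>C\<in>sets M. C \<subseteq> S \<longrightarrow> 2 * \<nu> (f S) \<le> \<nu> C)"
    by metis
  define S where "S n = ((\<lambda>S. S - f S) ^^ n) A" for n
  have S_Suc: "S (Suc n) = S n - f (S n)" for n by (simp add: S_def)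
  have S_mono: "S (n + k) \<subseteq> S n" for n k
    by (induction k) (auto simp: S_Suc)
  have S0: "S 0 = A" by (simp add: S_def)
  define B where "B n = f (S n)" for n
  have B: "B n \<in> sets M" "B n \<subseteq> S n" "\<nu> (B n) \<le> 0" for n using f by (auto simp: B_def)
  have disj: "B m \<inter> B n = {}" if "m < n" for m n
  proof -
    have "S n \<subseteq> S (Suc m)" using S_mono[of "Suc m" "n - Suc m"] that by simp
    then show ?thesis using B(2)[of n] by (auto simp: S_Suc B_def)
  qed
  have dB: "disjoint_family B"
    unfolding disjoint_family_on_def using disj by (metis Int_commute linorder_neqE_nat)
  have sums: "(\<lambda>n. \<nu> (B n)) sums \<nu> (\<Union>n. B n)"
    using B by (intro vector_measure_sums[OF \<nu> _ dB]) auto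
  then have lim: "(\<lambda>n. \<nu> (B n)) \<longlonglongrightarrow> 0" by (intro summable_LIMSEQ_zero) (simp add: sums_iff)
  define P where "P = A - (\<Union>n. B n)"
  have BA: "B n \<subseteq> A" for n using B(2)[of n] S_mono[of 0 n] by (auto simp: S0)
  have P: "P \<in> sets M" unfolding P_def using A B by auto
  have PS: "P \<subseteq> S n" for n
    by (induction n) (auto simp: S0 P_def S_Suc B_def)
  have "0 \<le> \<nu> C" if C: "C \<in> sets M" "C \<subseteq> P" for C
  proof -
    \<comment> \<open>For large \<open>n\<close> the alternative \<open>\<nu> (B n) \<le> -1\<close>
      is excluded, which leaves the near-minimality of \<open>B n\<close> against every subset
      \<open>C\<close> of the remainder.\<close>
    have "eventually (\<lambda>n. \<nu> (B n) > -1) sequentially" by (rule order_tendstoD(1)[OF lim]) simp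
    then have "eventually (\<lambda>n. 2 * \<nu> (B n) \<le> \<nu> C) sequentially"
    proof eventually_elim
      case (elim n)
      with f(4)[of "S n"] C PS[of n] show ?case unfolding B_def by force
    qed
    moreover have "(\<lambda>n. 2 * \<nu> (B n)) \<longlonglongrightarrow> 2 * 0" by (intro tendsto_intros lim)
    ultimately show ?thesis
      using tendsto_upperbound[of "\<lambda>n. 2 * \<nu> (B n)" "2 * 0" sequentially "\<nu> C"] by simp
  qed
  then have "positive_set M \<nu> P" using P by (auto simp: positive_set_def)
  moreover have "\<nu> (\<Union>n. B n) \<le> 0" using sums B(3) sums_le[OF _ sums sums_zero] by blast
  moreover have "\<nu> P = \<nu> A - \<nu> (\<Union>n. B n)" unfolding P_def
    by (intro vector_measure_Diff[OF \<nu>] A sets.countable_UN) (use B BA in blast)+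
  moreover have "P \<subseteq> A" by (auto simp: P_def)
  ultimately show thesis using that[of P] by simp
qed

lemma positive_set_UN:
  fixes P :: "nat \<Rightarrow> 'a set"
  assumes \<nu>: "vector_measure M \<nu>" and P: "\<And>n. positive_set M \<nu> (P n)"
  shows "positive_set M \<nu> (\<Union>n. P n)"
  unfolding positive_set_def
proof (intro conjI ballI impI)
  show "(\<Union>n. P n) \<in> sets M" using P by (auto simp: positive_set_def)
  fix B assume B: "B \<in> sets M" "B \<subseteq> (\<Union>n. P n)"
  have D: "range (disjointed P) \<subseteq> sets M"
    using P by (intro sets.range_disjointed_sets) (auto simp: positive_set_def)
  have "disjoint_family (\<lambda>n. B \<inter> disjointed P n)"
    using disjoint_family_disjointed[of P] unfolding disjoint_family_on_def by blast
  then have "(\<lambda>n. \<nu> (B \<inter> disjointed P n)) sums \<nu> (\<Union>n. B \<inter> disjointed P n)"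
    using D B by (intro vector_measure_sums[OF \<nu>]) auto
  moreover have "(\<Union>n. B \<inter> disjointed P n) = B"
    using B UN_disjointed_eq[of P] by blast
  moreover have "0 \<le> \<nu> (B \<inter> disjointed P n)" for n
    using D B disjointed_subset[of P n] by (intro positive_setD[OF P[of n]]) auto
  ultimately show "0 \<le> \<nu> B" using sums_le[OF _ sums_zero, of "\<lambda>n. \<nu> (B \<inter> disjointed P n)"] by simp
qed

text \<open>The union \<open>P\<close> of a maximising sequence of positive sets attains the
  supremum of \<open>\<nu>\<close> over positive sets, taken in \<open>ereal\<close> because its
  finiteness only follows from this. If \<open>A\<close> outside \<open>P\<close> had positive mass,
  it would contain a positive set of at least that mass, and adjoining it to \<open>P\<close> would
  exceed the maximum.\<close>

lemma signed_Hahn_decomposition: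
  assumes \<nu>: "vector_measure M \<nu>"
  obtains P where "positive_set M \<nu> P" "positive_set M (\<lambda>A. - \<nu> A) (space M - P)"
proof -
  let ?S = "(\<lambda>P. ereal (\<nu> P)) ` {P. positive_set M \<nu> P}"
  have "positive_set M \<nu> {}" by (simp add: positive_set_def vector_measure_empty[OF \<nu>])
  then have "?S \<noteq> {}" by blast
  from Sup_countable_SUP[OF this] obtain g :: "nat \<Rightarrow> ereal" where
    g: "range g \<subseteq> ?S" "Sup ?S = (SUP n. g n)" by auto
  then have "\<forall>n. \<exists>P. positive_set M \<nu> P \<and> g n = ereal (\<nu> P)" by blast
  then obtain Q where Q: "\<And>n. positive_set M \<nu> (Q n)" "\<And>n. g n = ereal (\<nu> (Q n))" by metis
  define P where "P = (\<Union>n. Q n)"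
  have P: "positive_set M \<nu> P" unfolding P_def by (rule positive_set_UN[OF \<nu> Q(1)])
  have "\<nu> (Q n) \<le> \<nu> P" for n
  proof -
    have "0 \<le> \<nu> (P - Q n)"
      using P Q(1)[of n] by (intro positive_setD[OF P]) (auto simp: positive_set_def)
    also have "\<dots> = \<nu> P - \<nu> (Q n)"
      using P Q(1)[of n] by (intro vector_measure_Diff[OF \<nu>]) (auto simp: positive_set_def P_def)
    finally show ?thesis by simp
  qed
  then have "Sup ?S \<le> ereal (\<nu> P)" unfolding g by (intro SUP_least) (simp add: Q)
  then have max: "\<nu> R \<le> \<nu> P" if "positive_set M \<nu> R" for R
    using that by (metis (no_types, lifting) Sup_le_iff ereal_less_eq(3) image_eqI mem_Collect_eq)
  have "\<nu> A \<le> 0" if A: "A \<in> sets M" "A \<subseteq> space M - P" for A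
  proof -
    obtain R where R: "positive_set M \<nu> R" "R \<subseteq> A" "\<nu> A \<le> \<nu> R"
      using positive_subset_exists[OF \<nu> A(1)] .
    have "positive_set M \<nu> (\<Union>n::nat. if n = 0 then P else R)"
      by (rule positive_set_UN[OF \<nu>]) (use P R in auto)
    moreover have "(\<Union>n::nat. if n = 0 then P else R) = P \<union> R"
      by (force split: if_splits)
    ultimately have "\<nu> (P \<union> R) \<le> \<nu> P" using max by simp
    moreover have "\<nu> (P \<union> R) = \<nu> P + \<nu> R"
      using P R A by (intro vector_measure_Un[OF \<nu>]) (auto simp: positive_set_def)
    ultimately show ?thesis using R(3) by simp
  qed
  with P show thesis by (intro that[of P]) (auto simp: positive_set_def)
qed

section \<open>Radon-Nikodym densities of signed and vector measures\<close>

lemma (in finite_measure) positive_set_density: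
  assumes \<nu>: "vector_measure M \<nu>" and ac: "abs_continuous \<nu> M" and P: "positive_set M \<nu> P"
  obtains f :: "'a \<Rightarrow> real" where "integrable M f"
    "\<And>A. A \<in> sets M \<Longrightarrow> \<nu> (A \<inter> P) = set_lebesgue_integral M A f"
proof -
  \<comment> \<open>Cut down to \<open>P\<close>, the set function is a finite nonnegative measure,
    so the classical Radon-Nikodym theorem applies to it.\<close>
  define N where "N = measure_of (space M) (sets M) (\<lambda>A. ennreal (\<nu> (A \<inter> P)))"
  have P_sets[simp]: "P \<in> sets M" using P by (simp add: positive_set_def)
  have pos: "0 \<le> \<nu> (A \<inter> P)" if "A \<in> sets M" for A
    by (rule positive_setD[OF P]) (use that in auto)
  have sets_N[simp]: "sets N = sets M" and space_N[simp]: "space N = space M"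
    by (simp_all add: N_def)
  have emN: "emeasure N A = ennreal (\<nu> (A \<inter> P))" if "A \<in> sets M" for A
  proof (rule emeasure_measure_of[OF N_def])
    show "sets M \<subseteq> Pow (space M)" by (rule sets.space_closed)
    show "positive (sets N) (\<lambda>A. ennreal (\<nu> (A \<inter> P)))"
      by (simp add: positive_def vector_measure_empty[OF \<nu>])
    show "countably_additive (sets N) (\<lambda>A. ennreal (\<nu> (A \<inter> P)))"
    proof (rule countably_additiveI)
      fix A :: "nat \<Rightarrow> 'a set" assume A: "range A \<subseteq> sets N" "disjoint_family A"
      have "(\<lambda>i. \<nu> (A i \<inter> P)) sums \<nu> (\<Union>i. A i \<inter> P)"
        using A by (intro vector_measure_sums[OF \<nu>]) (auto simp: disjoint_family_on_def)
      then have "(\<lambda>i. \<nu> (A i \<inter> P)) sums \<nu> (\<Union> (range A) \<inter> P)" by simp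
      then show "(\<Sum>i. ennreal (\<nu> (A i \<inter> P))) = ennreal (\<nu> (\<Union> (range A) \<inter> P))"
        using A by (intro suminf_ennreal_eq pos) auto
    qed
    show "A \<in> sets N" using that by simp
  qed
  have "finite_measure N" by (rule finite_measureI) (simp add: emN)
  moreover have "absolutely_continuous M N"
    unfolding absolutely_continuous_def
  proof
    fix A assume A: "A \<in> null_sets M"
    then have "A \<inter> P \<in> null_sets M" by (auto intro: null_set_Int2 null_set_Int1)
    then have "\<nu> (A \<inter> P) = 0" using ac by (auto simp: abs_continuous_def)
    with A show "A \<in> null_sets N" by (auto simp: null_sets_def emN)
  qed
  ultimately obtain g where g[measurable]: "g \<in> borel_measurable M" and gN: "density M g = N"
    using Radon_Nikodym_finite_measure[of N] by auto
  have em: "(\<integral>\<^sup>+x. g x * indicator A x \<partial>M) = ennreal (\<nu> (A \<inter> P))" if "A \<in> sets M" for A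
    using emN[OF that] that by (simp add: gN[symmetric] emeasure_density)
  have "(\<integral>\<^sup>+x. g x \<partial>M) = (\<integral>\<^sup>+x. g x * indicator (space M) x \<partial>M)"
    by (intro nn_integral_cong) auto
  also have "\<dots> = ennreal (\<nu> (space M \<inter> P))" by (rule em) simp
  finally have fin: "(\<integral>\<^sup>+x. g x \<partial>M) < \<infinity>" by simp
  then have AE: "AE x in M. g x = ennreal (enn2real (g x))"
    using nn_integral_noteq_infinite[of g M] by (auto simp: less_top[symmetric])
  show thesis
  proof
    have "(\<integral>\<^sup>+x. ennreal (enn2real (g x)) \<partial>M) = (\<integral>\<^sup>+x. g x \<partial>M)"
      using AE by (intro nn_integral_cong_AE) auto
    then show "integrable M (\<lambda>x. enn2real (g x))" using fin by (intro integrableI_nonneg) auto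
    fix A assume A[measurable]: "A \<in> sets M"
    have "set_lebesgue_integral M A (\<lambda>x. enn2real (g x))
        = enn2real (\<integral>\<^sup>+x. ennreal (indicator A x *\<^sub>R enn2real (g x)) \<partial>M)"
      unfolding set_lebesgue_integral_def by (intro integral_eq_nn_integral) auto
    also have "(\<integral>\<^sup>+x. ennreal (indicator A x *\<^sub>R enn2real (g x)) \<partial>M) = (\<integral>\<^sup>+x. g x * indicator A x \<partial>M)"
      using AE by (intro nn_integral_cong_AE) (auto split: split_indicator)
    finally show "\<nu> (A \<inter> P) = set_lebesgue_integral M A (\<lambda>x. enn2real (g x))"
      using pos[OF A] by (simp add: em)
  qed
qed

lemma (in finite_measure) signed_density_exists:
  fixes \<nu> :: "'a set \<Rightarrow> real"
  assumes \<nu>: "vector_measure M \<nu>" and ac: "abs_continuous \<nu> M"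
  obtains f :: "'a \<Rightarrow> real" where "integrable M f"
    "\<And>A. A \<in> sets M \<Longrightarrow> \<nu> A = set_lebesgue_integral M A f"
proof -
  obtain P where P: "positive_set M \<nu> P" "positive_set M (\<lambda>A. - \<nu> A) (space M - P)"
    using signed_Hahn_decomposition[OF \<nu>] .
  have ac': "abs_continuous (\<lambda>A. - \<nu> A) M" using ac by (simp add: abs_continuous_def)
  obtain f where f: "integrable M f" "\<And>A. A \<in> sets M \<Longrightarrow> \<nu> (A \<inter> P) = set_lebesgue_integral M A f"
    using positive_set_density[OF \<nu> ac P(1)] by blast
  obtain g where g: "integrable M g"
    "\<And>A. A \<in> sets M \<Longrightarrow> - \<nu> (A \<inter> (space M - P)) = set_lebesgue_integral M A g"
    using positive_set_density[OF vector_measure_uminus[OF \<nu>] ac' P(2)] by blast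
  show thesis
  proof
    show "integrable M (\<lambda>x. f x - g x)" using f g by simp
    fix A assume A: "A \<in> sets M"
    have "\<nu> A = \<nu> ((A \<inter> P) \<union> (A \<inter> (space M - P)))"
      using sets.sets_into_space[OF A] by (intro arg_cong[where f=\<nu>]) auto
    also have "\<dots> = \<nu> (A \<inter> P) + \<nu> (A \<inter> (space M - P))"
      using A P by (intro vector_measure_Un[OF \<nu>]) (auto simp: positive_set_def)
    also have "\<dots> = set_lebesgue_integral M A f - set_lebesgue_integral M A g"
      using f(2)[OF A] g(2)[OF A] by simp
    also have "\<dots> = set_lebesgue_integral M A (\<lambda>x. f x - g x)"
      using integrable_mult_indicator[OF A f(1)] integrable_mult_indicator[OF A g(1)]
      by (intro set_integral_diff(2)[symmetric]) (simp_all add: set_integrable_def)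
    finally show "\<nu> A = set_lebesgue_integral M A (\<lambda>x. f x - g x)" .
  qed
qed

text \<open>This shows that the choice in \<open>vector_density\<close> is not void: densities of
  the coordinate measures, each a difference of the densities on the two Hahn sets, are assembled
  along the basis.\<close>

lemma (in finite_measure) vector_density_integrable:
  fixes \<nu> :: "'a set \<Rightarrow> 'b::euclidean_space"
  assumes \<nu>: "vector_measure M \<nu>" and ac: "abs_continuous \<nu> M"
  shows "integrable M (vector_density \<nu> M)"
    "\<And>A. A \<in> sets M \<Longrightarrow> \<nu> A = set_lebesgue_integral M A (vector_density \<nu> M)"
proof -
  have "\<exists>f. integrable M f \<and> (\<forall>A\<in>sets M. \<nu> A \<bullet> b = set_lebesgue_integral M A f)" for b
  proof -
    have "abs_continuous (\<lambda>A. \<nu> A \<bullet> b) M" using ac by (simp add: abs_continuous_def)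
    from signed_density_exists[OF vector_measure_inner[OF \<nu>] this] show ?thesis by metis
  qed
  then obtain f where f: "\<And>b. integrable M (f b)"
    "\<And>b A. A \<in> sets M \<Longrightarrow> \<nu> A \<bullet> b = set_lebesgue_integral M A (f b)" by metis
  define v where "v x = (\<Sum>b\<in>Basis. f b x *\<^sub>R b)" for x
  have "integrable M v" unfolding v_def by (intro Bochner_Integration.integrable_sum integrable_scaleR_left f)
  moreover have "\<nu> A = set_lebesgue_integral M A v" if A: "A \<in> sets M" for A
  proof (rule euclidean_eqI)
    fix b :: 'b assume b: "b \<in> Basis"
    have iA: "integrable M (\<lambda>x. indicat_real A x *\<^sub>R v x)"
      by (rule integrable_mult_indicator) fact+
    have "set_lebesgue_integral M A v \<bullet> b = (\<integral>x. (indicat_real A x *\<^sub>R v x) \<bullet> b \<partial>M)"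
      unfolding set_lebesgue_integral_def by (rule integral_inner_left[symmetric]) (rule iA)
    also have "\<dots> = set_lebesgue_integral M A (f b)"
      unfolding set_lebesgue_integral_def v_def using b
      by (intro Bochner_Integration.integral_cong) (auto simp: inner_sum_left inner_Basis if_distrib sum.If_cases)
    finally show "\<nu> A \<bullet> b = set_lebesgue_integral M A v \<bullet> b" using f(2)[OF A] by simp
  qed
  ultimately have "\<exists>f. integrable M f \<and> (\<forall>A\<in>sets M. \<nu> A = set_lebesgue_integral M A f)" by blast
  then have "integrable M (vector_density \<nu> M) \<and>
     (\<forall>A\<in>sets M. \<nu> A = set_lebesgue_integral M A (vector_density \<nu> M))"
    unfolding vector_density_def by (rule someI_ex)
  then show "integrable M (vector_density \<nu> M)"
    "\<And>A. A \<in> sets M \<Longrightarrow> \<nu> A = set_lebesgue_integral M A (vector_density \<nu> M)" by auto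
qed

text \<open>The supremum over \<open>B \<subseteq> A\<close> is attained where \<open>f\<close> is
  nonnegative, and \<open>ennreal\<close> cuts \<open>f\<close> down to its positive part. So the
  abstract Jordan part becomes a density against which one can integrate.\<close>

lemma jordan_pos_eq_density:
  fixes f :: "'a \<Rightarrow> real"
  assumes f: "integrable M f" and \<nu>: "\<And>A. A \<in> sets M \<Longrightarrow> \<nu> A = set_lebesgue_integral M A f"
    and sets: "sets N = sets M"
  shows "jordan_pos N \<nu> = density M (\<lambda>x. ennreal (f x))"
proof -
  have [measurable]: "f \<in> borel_measurable M" using f by auto
  have space: "space N = space M" using sets by (rule sets_eq_imp_space_eq)
  have nn: "ennreal (set_lebesgue_integral M B f) \<le> (\<integral>\<^sup>+x. ennreal (f x) * indicator B x \<partial>M)"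
    if "B \<in> sets M" for B
  proof -
    have i: "integrable M (\<lambda>x. indicat_real B x *\<^sub>R f x)"
      by (rule integrable_mult_indicator) fact+
    then have "ennreal (\<integral>x. indicat_real B x *\<^sub>R f x \<partial>M) \<le> ennreal (\<integral>x. max 0 (indicat_real B x *\<^sub>R f x) \<partial>M)"
      by (intro ennreal_leI integral_mono integrable_max) auto
    also have "\<dots> = (\<integral>\<^sup>+x. ennreal (max 0 (indicat_real B x *\<^sub>R f x)) \<partial>M)"
      using i by (intro nn_integral_eq_integral[symmetric] integrable_max) auto
    also have "\<dots> = (\<integral>\<^sup>+x. ennreal (f x) * indicator B x \<partial>M)"
      by (intro nn_integral_cong) (auto split: split_indicator simp: max_def ennreal_neg)
    finally show ?thesis by (simp add: set_lebesgue_integral_def)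
  qed
  have "(SUP B\<in>{B \<in> sets M. B \<subseteq> A}. ennreal (\<nu> B)) = (\<integral>\<^sup>+x. ennreal (f x) * indicator A x \<partial>M)"
    if A: "A \<in> sets M" for A
  proof (rule antisym)
    show "(SUP B\<in>{B \<in> sets M. B \<subseteq> A}. ennreal (\<nu> B)) \<le> (\<integral>\<^sup>+x. ennreal (f x) * indicator A x \<partial>M)"
    proof (intro SUP_least, clarify)
      fix B assume B: "B \<in> sets M" "B \<subseteq> A"
      have "ennreal (\<nu> B) \<le> (\<integral>\<^sup>+x. ennreal (f x) * indicator B x \<partial>M)" using nn[OF B(1)] \<nu>[OF B(1)] by simp
      also have "\<dots> \<le> (\<integral>\<^sup>+x. ennreal (f x) * indicator A x \<partial>M)"
        using B(2) by (intro nn_integral_mono) (auto split: split_indicator)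
      finally show "ennreal (\<nu> B) \<le> (\<integral>\<^sup>+x. ennreal (f x) * indicator A x \<partial>M)" .
    qed
    note A[measurable]
    define B where "B = {x \<in> space M. x \<in> A \<and> 0 \<le> f x}"
    have B[measurable]: "B \<in> sets M" using A unfolding B_def by measurable
    have "(\<integral>\<^sup>+x. ennreal (f x) * indicator A x \<partial>M) = (\<integral>\<^sup>+x. ennreal (indicat_real B x *\<^sub>R f x) \<partial>M)"
      by (intro nn_integral_cong) (auto split: split_indicator simp: B_def ennreal_neg)
    also have "\<dots> = ennreal (\<nu> B)" unfolding \<nu>[OF B] set_lebesgue_integral_def
      using f by (intro nn_integral_eq_integral integrable_mult_indicator) (auto split: split_indicator simp: B_def)
    finally show "(\<integral>\<^sup>+x. ennreal (f x) * indicator A x \<partial>M) \<le> (SUP B\<in>{B \<in> sets M. B \<subseteq> A}. ennreal (\<nu> B))"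
      by (auto intro!: SUP_upper simp: B_def)
  qed
  then show ?thesis
    unfolding jordan_pos_def density_def sets space
    by (intro measure_of_eq sets.space_closed) (simp add: sets.sigma_sets_eq)
qed

lemma abs_inner_le: "norm a \<le> C \<Longrightarrow> \<bar>a \<bullet> b\<bar> \<le> C * norm b" for a b :: "'a::real_inner"
  by (rule order_trans[OF Cauchy_Schwarz_ineq2 mult_right_mono]) simp_all

lemma integrable_inner_bounded:
  fixes g v :: "'a \<Rightarrow> 'b::euclidean_space"
  assumes v: "integrable M v" and g: "g \<in> borel_measurable M" and bd: "AE x in M. norm (g x) \<le> C"
  shows "integrable M (\<lambda>x. g x \<bullet> v x)"
proof (rule Bochner_Integration.integrable_bound)
  show "integrable M (\<lambda>x. C * norm (v x))" using v by simp
  show "AE x in M. norm (g x \<bullet> v x) \<le> norm (C * norm (v x))"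
    using bd by (rule AE_mp) (auto intro!: AE_I2 order_trans[OF abs_inner_le abs_ge_self])
qed (use v g in auto)

text \<open>Boundedness of \<open>g\<close> keeps it integrable against both Jordan parts, so that
  their difference recombines into a single integral against \<open>f\<close>.\<close>

lemma signed_integral_eq:
  fixes f g :: "'a \<Rightarrow> real"
  assumes f: "integrable M f" and \<nu>: "\<And>A. A \<in> sets M \<Longrightarrow> \<nu> A = set_lebesgue_integral M A f"
    and sets: "sets N = sets M"
    and g[measurable]: "g \<in> borel_measurable M" and bd: "\<And>x. x \<in> space M \<Longrightarrow> \<bar>g x\<bar> \<le> C"
  shows "signed_integral N \<nu> g = (\<integral>x. g x * f x \<partial>M)"
proof -
  have [measurable]: "f \<in> borel_measurable M" using f by auto
  have int: "integrable M (\<lambda>x. max 0 (h x) * g x)" if "integrable M h" for h :: "'a \<Rightarrow> real"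
    using integrable_inner_bounded[of M "\<lambda>x. max 0 (h x)" g C] that bd
    by (simp add: mult.commute AE_I2)
  have dens: "(\<integral>x. g x \<partial>density M (\<lambda>x. ennreal (h x))) = (\<integral>x. max 0 (h x) * g x \<partial>M)"
    if [measurable]: "h \<in> borel_measurable M" for h :: "'a \<Rightarrow> real"
  proof -
    have *: "density M (\<lambda>x. ennreal (h x)) = density M (\<lambda>x. ennreal (max 0 (h x)))"
      by (rule arg_cong[where f="density M"]) (auto simp: max_def ennreal_neg fun_eq_iff)
    show ?thesis unfolding * by (subst integral_density) auto
  qed
  have 1: "jordan_pos N \<nu> = density M (\<lambda>x. ennreal (f x))"
    by (rule jordan_pos_eq_density) fact+
  have 2: "jordan_pos N (\<lambda>A. - \<nu> A) = density M (\<lambda>x. ennreal (- f x))"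
    by (rule jordan_pos_eq_density) (use f sets \<nu> in \<open>auto simp: set_lebesgue_integral_def\<close>)
  have "signed_integral N \<nu> g = (\<integral>x. max 0 (f x) * g x \<partial>M) - (\<integral>x. max 0 (- f x) * g x \<partial>M)"
    by (simp add: signed_integral_def 1 2 dens)
  also have "\<dots> = (\<integral>x. max 0 (f x) * g x - max 0 (- f x) * g x \<partial>M)"
    using f by (intro Bochner_Integration.integral_diff[symmetric] int) auto
  also have "\<dots> = (\<integral>x. g x * f x \<partial>M)"
    by (intro Bochner_Integration.integral_cong) (auto simp: max_def algebra_simps)
  finally show ?thesis .
qed

lemma vector_integral_eq:
  fixes v g :: "'a \<Rightarrow> 'b::euclidean_space"
  assumes v: "integrable M v" and \<nu>: "\<And>A. A \<in> sets M \<Longrightarrow> \<nu> A = set_lebesgue_integral M A v"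
    and sets: "sets N = sets M"
    and g[measurable]: "g \<in> borel_measurable M" and bd: "\<And>x. x \<in> space M \<Longrightarrow> norm (g x) \<le> C"
  shows "vector_integral N \<nu> g = (\<integral>x. g x \<bullet> v x \<partial>M)"
proof -
  have gb: "\<bar>g x \<bullet> b\<bar> \<le> \<bar>C\<bar>" if "x \<in> space M" "b \<in> Basis" for x b
    using Basis_le_norm[OF that(2), of "g x"] bd[OF that(1)] by linarith
  have "vector_integral N \<nu> g = (\<Sum>b\<in>Basis. \<integral>x. (g x \<bullet> b) * (v x \<bullet> b) \<partial>M)"
    unfolding vector_integral_def
  proof (intro sum.cong signed_integral_eq)
    fix b :: 'b and A assume "A \<in> sets M"
    then show "\<nu> A \<bullet> b = set_lebesgue_integral M A (\<lambda>x. v x \<bullet> b)"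
      using integrable_mult_indicator[OF _ v, of A] \<nu>[of A] by (simp add: set_lebesgue_integral_def
         integral_inner_left[symmetric] del: integral_inner_left)
  qed (use v sets gb in auto)
  also have "\<dots> = (\<integral>x. (\<Sum>b\<in>Basis. (g x \<bullet> b) * (v x \<bullet> b)) \<partial>M)"
    using integrable_inner_bounded[of M "\<lambda>x. v x \<bullet> _" "\<lambda>x. g x \<bullet> _" "\<bar>C\<bar>"] v gb
    by (intro Bochner_Integration.integral_sum[symmetric]) (simp add: AE_I2)
  also have "\<dots> = (\<integral>x. g x \<bullet> v x \<partial>M)" by (simp add: euclidean_inner[symmetric])
  finally show ?thesis .
qed

section \<open>Curves of measures\<close>

lemma prob_measuresD:
  assumes "\<mu> \<in> prob_measures X"
  shows "prob_space \<mu>" "sets \<mu> = sets (borel_on X)" "space \<mu> = X"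
  using assms sets_eq_imp_space_eq[of \<mu> "borel_on X"]
  by (auto simp: prob_measures_def space_prob_algebra space_restrict_space)

lemma prob_measuresI:
  "prob_space \<mu> \<Longrightarrow> sets \<mu> = sets (borel_on X) \<Longrightarrow> \<mu> \<in> prob_measures X"
  by (auto simp: prob_measures_def space_prob_algebra)

lemma borel_measurable_continuous_prob:
  fixes f :: "'a::topological_space \<Rightarrow> 'b::topological_space"
  assumes "\<mu> \<in> prob_measures X" "continuous_on X f"
  shows "f \<in> borel_measurable \<mu>"
  using borel_measurable_continuous_on_restrict[OF assms(2)]
    measurable_cong_sets[OF prob_measuresD(2)[OF assms(1)] refl] by blast

lemma integrable_continuous_prob:
  fixes f :: "'a::topological_space \<Rightarrow> 'b::{banach,second_countable_topology}"
  assumes \<mu>: "\<mu> \<in> prob_measures X" and X: "compact X" and f: "continuous_on X f"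
  shows "integrable \<mu> f"
proof -
  interpret prob_space \<mu> by (rule prob_measuresD[OF \<mu>])
  obtain C where "\<And>x. x \<in> X \<Longrightarrow> norm (f x) \<le> C"
    using compact_imp_bounded[OF compact_continuous_image[OF f X]] by (auto simp: bounded_iff)
  then show ?thesis
    by (intro integrable_const_bound[of _ C] borel_measurable_continuous_prob[OF \<mu> f] AE_I2)
      (simp add: prob_measuresD(3)[OF \<mu>])
qed

section \<open>Pointwise derivatives of continuously differentiable functions\<close>

lemma gradient_eq:
  assumes "GDERIV f x :> D"
  shows "gradient f x = D"
  unfolding gradient_def
proof (rule the_equality)
  show "GDERIV f x :> D" by fact
  fix D' assume "GDERIV f x :> D'"
  with assms have "(\<lambda>h. h \<bullet> D') = (\<lambda>h. h \<bullet> D)"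
    unfolding gderiv_def by (rule has_derivative_unique[rotated])
  then have "(D' - D) \<bullet> (D' - D) = 0" by (simp add: fun_eq_iff inner_diff_right)
  then show "D' = D" by simp
qed

lemma GDERIV_space_time:
  fixes \<eta> :: "real \<times> 'a::real_inner \<Rightarrow> real"
  assumes "GDERIV \<eta> (t, x) :> D"
  shows "time_deriv \<eta> t x = fst D" "space_grad \<eta> t x = snd D"
proof -
  have der: "(\<eta> has_derivative (\<lambda>h. fst h * fst D + snd h \<bullet> snd D)) (at (t, x))"
    using assms by (simp add: gderiv_def inner_prod_def)
  have "((\<lambda>s. \<eta> (s, x)) has_derivative (\<lambda>s. s * fst D)) (at t)"
    by (rule has_derivative_eq_rhs[OF has_derivative_compose[where f="\<lambda>s. (s, x)", OF _ der]])
      (auto intro!: derivative_eq_intros)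
  then show "time_deriv \<eta> t x = fst D"
    unfolding time_deriv_def by (intro DERIV_imp_deriv) (simp add: has_field_derivative_def mult_commute_abs)
  have "((\<lambda>y. \<eta> (t, y)) has_derivative (\<lambda>h. h \<bullet> snd D)) (at x)"
    by (rule has_derivative_eq_rhs[OF has_derivative_compose[where f="\<lambda>y. (t, y)", OF _ der]])
      (auto intro!: derivative_eq_intros)
  then show "space_grad \<eta> t x = snd D"
    unfolding space_grad_def by (intro gradient_eq) (simp add: gderiv_def)
qed

lemma C1_on_space_time:
  fixes \<eta> :: "real \<times> 'a::real_inner \<Rightarrow> real"
  assumes "C1_on ({0..1} \<times> X) \<eta>"
  shows "continuous_on ({0..1} \<times> X) (\<lambda>y. time_deriv \<eta> (fst y) (snd y))"
    and "continuous_on ({0..1} \<times> X) (\<lambda>y. space_grad \<eta> (fst y) (snd y))"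
    and "t \<in> {0..1} \<Longrightarrow> x \<in> X \<Longrightarrow>
       (\<eta> has_derivative (\<lambda>h. fst h * time_deriv \<eta> t x + snd h \<bullet> space_grad \<eta> t x)) (at (t, x))"
proof -
  obtain U D where U: "open U" "{0..1} \<times> X \<subseteq> U" "continuous_on U D"
    "\<And>y. y \<in> U \<Longrightarrow> GDERIV \<eta> y :> D y" using assms by (auto simp: C1_on_def)
  have GD: "GDERIV \<eta> (t, x) :> D (t, x)" if "t \<in> {0..1}" "x \<in> X" for t x
    using U(4)[of "(t, x)"] subsetD[OF U(2), of "(t, x)"] that by simp
  have dt: "time_deriv \<eta> t x = fst (D (t, x))" and dx: "space_grad \<eta> t x = snd (D (t, x))"
    if "t \<in> {0..1}" "x \<in> X" for t x
    using GDERIV_space_time[OF GD[OF that]] by auto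
  have cD: "continuous_on ({0..1} \<times> X) D" using U(2,3) continuous_on_subset by blast
  show "continuous_on ({0..1} \<times> X) (\<lambda>y. time_deriv \<eta> (fst y) (snd y))"
    by (rule continuous_on_eq[OF continuous_on_fst[OF cD]]) (auto simp: dt)
  show "continuous_on ({0..1} \<times> X) (\<lambda>y. space_grad \<eta> (fst y) (snd y))"
    by (rule continuous_on_eq[OF continuous_on_snd[OF cD]]) (auto simp: dx)
  assume tx: "t \<in> {0..1}" "x \<in> X"
  show "(\<eta> has_derivative (\<lambda>h. fst h * time_deriv \<eta> t x + snd h \<bullet> space_grad \<eta> t x)) (at (t, x))"
    using GD[OF tx] by (simp add: dt[OF tx] dx[OF tx] gderiv_def inner_prod_def)
qed

section \<open>Weakly continuous curves\<close>

lemma topspace_weak_topology_on: "topspace (weak_topology_on X) \<subseteq> prob_measures X"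
  unfolding weak_topology_on_def topology_generated_by_topspace by auto

lemma prob_curvesD:
  assumes "\<pi> \<in> prob_curves X"
  shows "t \<in> {0..1} \<Longrightarrow> \<pi> t \<in> prob_measures X"
    and "continuous_on X f \<Longrightarrow> bounded (f ` X) \<Longrightarrow> continuous_on {0..1} (\<lambda>t. \<integral>x. (f x :: real) \<partial>\<pi> t)"
proof -
  have c: "continuous_map (top_of_set {0..1}) (weak_topology_on X) \<pi>"
    using assms by (simp add: prob_curves_def)
  have P: "\<pi> t \<in> prob_measures X" if "t \<in> {0..1}" for t
    using continuous_map_funspace[OF c] that topspace_weak_topology_on by fastforce
  then show "t \<in> {0..1} \<Longrightarrow> \<pi> t \<in> prob_measures X" .
  assume f: "continuous_on X f" "bounded (f ` X)"
  show "continuous_on {0..1} (\<lambda>t. \<integral>x. f x \<partial>\<pi> t)"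
    unfolding continuous_openin_preimage_eq
  proof (intro allI impI)
    fix U :: "real set" assume "open U"
    with f have "openin (weak_topology_on X) {\<mu> \<in> prob_measures X. (\<integral>x. f x \<partial>\<mu>) \<in> U}"
      unfolding weak_topology_on_def by (intro topology_generated_by_Basis) blast
    from openin_continuous_map_preimage[OF c this]
    have "openin (top_of_set {0..1}) {t \<in> {0..1}. \<pi> t \<in> prob_measures X \<and> (\<integral>x. f x \<partial>\<pi> t) \<in> U}" by simp
    also have "{t \<in> {0..1}. \<pi> t \<in> prob_measures X \<and> (\<integral>x. f x \<partial>\<pi> t) \<in> U}
        = {0..1} \<inter> (\<lambda>t. \<integral>x. f x \<partial>\<pi> t) -` U" using P by auto
    finally show "openin (top_of_set {0..1}) ({0..1} \<inter> (\<lambda>t. \<integral>x. f x \<partial>\<pi> t) -` U)" .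
  qed
qed

text \<open>Both the integrand and the measure move with time. Uniform continuity on the compact
  product controls the first change uniformly in the measure, and weak continuity with the integrand
  frozen at \<open>t\<close> controls the second.\<close>

lemma continuous_on_integral_prob_curve:
  fixes f :: "real \<times> 'a::metric_space \<Rightarrow> real"
  assumes \<pi>: "\<pi> \<in> prob_curves X" and X: "compact X" and f: "continuous_on ({0..1} \<times> X) f"
  shows "continuous_on {0..1} (\<lambda>t. \<integral>x. f (t, x) \<partial>\<pi> t)"
  unfolding continuous_on_iff
proof (intro ballI allI impI)
  fix t and e :: real assume t: "t \<in> {0..1::real}" and e: "0 < e"
  have cf: "continuous_on X (\<lambda>x. f (s, x))" if "s \<in> {0..1}" for s
    by (rule continuous_on_compose2[OF f]) (use that in \<open>auto intro!: continuous_intros\<close>)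
  have "uniformly_continuous_on ({0..1} \<times> X) f"
    by (intro compact_uniformly_continuous f compact_Times X compact_Icc)
  then obtain d1 where d1: "d1 > 0" "\<And>y z. y \<in> {0..1} \<times> X \<Longrightarrow> z \<in> {0..1} \<times> X \<Longrightarrow> dist y z < d1 \<Longrightarrow> dist (f y) (f z) < e/2"
    unfolding uniformly_continuous_on_def using e by (metis half_gt_zero)
  have "continuous_on {0..1} (\<lambda>s. \<integral>x. f (t, x) \<partial>\<pi> s)"
    by (rule prob_curvesD(2)[OF \<pi> cf[OF t]])
      (intro compact_imp_bounded compact_continuous_image cf[OF t] X)
  then obtain d2 where d2: "d2 > 0" "\<And>s. s \<in> {0..1} \<Longrightarrow> dist s t < d2 \<Longrightarrow>
      dist (\<integral>x. f (t, x) \<partial>\<pi> s) (\<integral>x. f (t, x) \<partial>\<pi> t) < e/2"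
    unfolding continuous_on_iff using t e by (metis half_gt_zero)
  show "\<exists>d>0. \<forall>s\<in>{0..1}. dist s t < d \<longrightarrow> dist (\<integral>x. f (s, x) \<partial>\<pi> s) (\<integral>x. f (t, x) \<partial>\<pi> t) < e"
  proof (intro exI[of _ "min d1 d2"] conjI ballI impI)
    show "min d1 d2 > 0" using d1 d2 by simp
    fix s assume s: "s \<in> {0..1}" "dist s t < min d1 d2"
    interpret prob_space "\<pi> s" using prob_measuresD(1)[OF prob_curvesD(1)[OF \<pi> s(1)]] .
    have i: "integrable (\<pi> s) (\<lambda>x. f (u, x))" if "u \<in> {0..1}" for u
      by (rule integrable_continuous_prob[OF prob_curvesD(1)[OF \<pi> s(1)] X cf[OF that]])
    have "\<bar>(\<integral>x. f (s, x) \<partial>\<pi> s) - (\<integral>x. f (t, x) \<partial>\<pi> s)\<bar> = \<bar>\<integral>x. f (s, x) - f (t, x) \<partial>\<pi> s\<bar>"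
      using i s t by simp
    also have "\<dots> \<le> (\<integral>x. e/2 \<partial>\<pi> s)"
    proof (rule order_trans[OF integral_abs_bound integral_mono])
      fix x assume "x \<in> space (\<pi> s)"
      then have "x \<in> X" using prob_measuresD(3)[OF prob_curvesD(1)[OF \<pi> s(1)]] by simp
      then show "\<bar>f (s, x) - f (t, x)\<bar> \<le> e/2"
        using d1(2)[of "(s, x)" "(t, x)"] s t by (simp add: dist_Pair_Pair dist_real_def)
    qed (use i s t in auto)
    finally have "\<bar>(\<integral>x. f (s, x) \<partial>\<pi> s) - (\<integral>x. f (t, x) \<partial>\<pi> s)\<bar> \<le> e/2" by (simp add: prob_space)
    with d2(2)[OF s(1)] s(2) show "dist (\<integral>x. f (s, x) \<partial>\<pi> s) (\<integral>x. f (t, x) \<partial>\<pi> t) < e"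
      unfolding dist_real_def by linarith
  qed
qed

section \<open>Integration over the unit time interval\<close>

abbreviation unit_lborel :: "real measure" where
  "unit_lborel \<equiv> restrict_space lborel {0..1}"

lemma prob_space_unit_lborel: "prob_space unit_lborel"
  by (rule prob_spaceI) (simp add: space_restrict_space emeasure_restrict_space)

lemma space_unit_lborel: "space unit_lborel = {0..1}"
  by (simp add: space_restrict_space)

lemma integral_unit_lborel:
  fixes f :: "real \<Rightarrow> 'b::{banach,second_countable_topology}"
  shows "(LINT t:{0..1}|lborel. f t) = (\<integral>t. f t \<partial>unit_lborel)"
  unfolding set_lebesgue_integral_def by (rule integral_restrict_space[symmetric]) simp

lemma nn_integral_unit_lborel: "(\<integral>\<^sup>+t\<in>{0..1}. f t \<partial>lborel) = (\<integral>\<^sup>+t. f t \<partial>unit_lborel)"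
  by (simp add: nn_integral_restrict_space)

lemma borel_measurable_unit_lborel:
  fixes f :: "real \<Rightarrow> 'b::topological_space"
  assumes "continuous_on {0..1} f"
  shows "f \<in> borel_measurable unit_lborel"
  using borel_measurable_continuous_on_restrict[OF assms]
    measurable_cong_sets[OF sets_restrict_space_cong[OF sets_lborel] refl] by blast

lemma integrable_unit_lborel:
  fixes f :: "real \<Rightarrow> real"
  assumes "continuous_on {0..1} f"
  shows "integrable unit_lborel f"
proof -
  interpret prob_space unit_lborel by (rule prob_space_unit_lborel)
  obtain C where "\<And>x. x \<in> {0..1} \<Longrightarrow> norm (f x) \<le> C"
    using compact_imp_bounded[OF compact_continuous_image[OF assms compact_Icc]]
    unfolding bounded_iff by (metis imageI)
  then show ?thesis
    by (intro integrable_const_bound[of _ C] borel_measurable_unit_lborel[OF assms] AE_I2)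
      (simp add: space_unit_lborel)
qed

text \<open>The density \<open>v t\<close> is chosen for each \<open>t\<close> separately, so the
  map in \<open>t\<close> has no evident measurability; what is given is measurability of
  \<open>m t A\<close> in \<open>t\<close> for a fixed set \<open>A\<close>. Freezing
  \<open>g\<close> in space on the cells of a partition turns the integral into a finite sum of such
  terms, and refining the mesh recovers it as a pointwise limit.\<close>

lemma borel_measurable_momentum_integral:
  fixes X :: "'a::euclidean_space set" and v :: "real \<Rightarrow> 'a \<Rightarrow> 'b::euclidean_space"
  assumes X: "compact X" and m: "m \<in> momentum_curves X"
    and sets: "\<And>t. t \<in> {0..1} \<Longrightarrow> sets (\<pi> t) = sets (borel_on X)"
    and v: "\<And>t. t \<in> {0..1} \<Longrightarrow> integrable (\<pi> t) (v t)"
    and mv: "\<And>t A. t \<in> {0..1} \<Longrightarrow> A \<in> sets (\<pi> t) \<Longrightarrow> m t A = set_lebesgue_integral (\<pi> t) A (v t)"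
    and g: "continuous_on ({0..1} \<times> X) g"
  shows "(\<lambda>t. \<integral>x. g (t, x) \<bullet> v t x \<partial>\<pi> t) \<in> borel_measurable unit_lborel"
proof -
  have "\<forall>n. \<exists>(idx :: 'a \<Rightarrow> nat) N c. idx \<in> borel_on X \<rightarrow>\<^sub>M count_space UNIV \<and> (\<forall>x\<in>X. idx x < N) \<and>
     (\<forall>k<N. c k \<in> X) \<and> (\<forall>x\<in>X. dist x (c (idx x)) < inverse (real (Suc n)))"
  proof
    fix n
    have "0 < inverse (real (Suc n))" by simp
    from compact_small_partition[OF X this] obtain idx :: "'a \<Rightarrow> nat" and N c where
      "idx \<in> borel_on X \<rightarrow>\<^sub>M count_space UNIV" "\<And>x. x \<in> X \<Longrightarrow> idx x < N" "\<And>n. n < N \<Longrightarrow> c n \<in> X"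
      "\<And>x. x \<in> X \<Longrightarrow> dist x (c (idx x)) < inverse (real (Suc n))" by blast
    then show "\<exists>(idx :: 'a \<Rightarrow> nat) N c. idx \<in> borel_on X \<rightarrow>\<^sub>M count_space UNIV \<and> (\<forall>x\<in>X. idx x < N) \<and>
     (\<forall>k<N. c k \<in> X) \<and> (\<forall>x\<in>X. dist x (c (idx x)) < inverse (real (Suc n)))"
      by (intro exI[of _ idx] exI[of _ N] exI[of _ c]) auto
  qed
  then obtain idx :: "nat \<Rightarrow> 'a \<Rightarrow> nat" and N :: "nat \<Rightarrow> nat" and c :: "nat \<Rightarrow> nat \<Rightarrow> 'a" where
    idx: "\<And>n. idx n \<in> borel_on X \<rightarrow>\<^sub>M count_space UNIV" "\<And>n x. x \<in> X \<Longrightarrow> idx n x < N n"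
    and c: "\<And>n k. k < N n \<Longrightarrow> c n k \<in> X"
    and d: "\<And>n x. x \<in> X \<Longrightarrow> dist x (c n (idx n x)) < inverse (real (Suc n))"
    by metis
  define A where "A n j = idx n -` {j} \<inter> X" for n j
  have A: "A n j \<in> sets (borel_on X)" for n j
    using measurable_sets[OF idx(1)[of n], of "{j}"] by (simp add: A_def space_restrict_space)
  define h where "h n t = (\<Sum>j<N n. g (t, c n j) \<bullet> m t (A n j))" for n t
  have "h n \<in> borel_measurable unit_lborel" for n
    unfolding h_def
  proof (intro borel_measurable_sum borel_measurable_inner)
    fix j assume "j \<in> {..<N n}"
    then have "c n j \<in> X" using c by simp
    then show "(\<lambda>t. g (t, c n j)) \<in> borel_measurable unit_lborel"
      by (intro borel_measurable_unit_lborel continuous_on_compose2[OF g]) (auto intro!: continuous_intros)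
    have "set_integrable lborel {0..1} (\<lambda>t. m t (A n j))"
      using m A by (simp add: momentum_curves_def)
    then show "(\<lambda>t. m t (A n j)) \<in> borel_measurable unit_lborel"
      unfolding set_integrable_def
      by (subst borel_measurable_restrict_space_iff) auto
  qed
  moreover have "(\<lambda>n. h n t) \<longlonglongrightarrow> (\<integral>x. g (t, x) \<bullet> v t x \<partial>\<pi> t)" if "t \<in> space unit_lborel" for t
  proof -
    have t: "t \<in> {0..1}" using that by (simp add: space_unit_lborel)
    have space: "space (\<pi> t) = X"
      using sets_eq_imp_space_eq[OF sets[OF t]] by (simp add: space_restrict_space)
    have cg: "continuous_on X (\<lambda>x. g (t, x))"
      by (rule continuous_on_compose2[OF g]) (use t in \<open>auto intro!: continuous_intros\<close>)
    have [measurable]: "v t \<in> borel_measurable (\<pi> t)" using v[OF t] by auto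
    have gm[measurable]: "(\<lambda>x. g (t, x)) \<in> borel_measurable (\<pi> t)"
      using borel_measurable_continuous_on_restrict[OF cg] measurable_cong_sets[OF sets[OF t] refl] by blast
    have im[measurable]: "idx n \<in> \<pi> t \<rightarrow>\<^sub>M count_space UNIV" for n
      using idx(1) measurable_cong_sets[OF sets[OF t] refl] by blast
    obtain C where C: "\<And>x. x \<in> X \<Longrightarrow> norm (g (t, x)) \<le> C"
      using compact_imp_bounded[OF compact_continuous_image[OF cg X]] by (auto simp: bounded_iff)
    \<comment> \<open>On the cell \<open>A n j\<close> the test function is frozen at the centre
      \<open>c n j\<close>, so \<open>h n t\<close> is the integral of that step function against
      \<open>v t\<close>.\<close>
    have "h n t = (\<integral>x. g (t, c n (idx n x)) \<bullet> v t x \<partial>\<pi> t)" for n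
    proof -
      have iA: "integrable (\<pi> t) (\<lambda>x. indicat_real (A n j) x *\<^sub>R v t x)" for j
        using A sets[OF t] v[OF t] by (intro integrable_mult_indicator) auto
      have "h n t = (\<Sum>j<N n. \<integral>x. g (t, c n j) \<bullet> (indicat_real (A n j) x *\<^sub>R v t x) \<partial>\<pi> t)"
        unfolding h_def
      proof (intro sum.cong refl)
        fix j
        have "m t (A n j) = (\<integral>x. indicat_real (A n j) x *\<^sub>R v t x \<partial>\<pi> t)"
          using mv[OF t] A sets[OF t] by (simp add: set_lebesgue_integral_def)
        then show "g (t, c n j) \<bullet> m t (A n j) = (\<integral>x. g (t, c n j) \<bullet> (indicat_real (A n j) x *\<^sub>R v t x) \<partial>\<pi> t)"
          using integral_inner_right[OF iA] by simp
      qed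
      also have "\<dots> = (\<integral>x. (\<Sum>j<N n. g (t, c n j) \<bullet> (indicat_real (A n j) x *\<^sub>R v t x)) \<partial>\<pi> t)"
        by (intro Bochner_Integration.integral_sum[symmetric] integrable_inner_right iA)
      also have "\<dots> = (\<integral>x. g (t, c n (idx n x)) \<bullet> v t x \<partial>\<pi> t)"
      proof (intro lebesgue_integral_cong)
        fix x assume "x \<in> space (\<pi> t)"
        then have x: "x \<in> X" by (simp add: space)
        have "(\<Sum>j<N n. g (t, c n j) \<bullet> (indicat_real (A n j) x *\<^sub>R v t x))
            = (\<Sum>j<N n. if j = idx n x then g (t, c n j) \<bullet> v t x else 0)"
          by (intro sum.cong refl) (use x in \<open>auto simp: A_def\<close>)
        also have "\<dots> = g (t, c n (idx n x)) \<bullet> v t x" using idx(2)[OF x] by simp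
        finally show "(\<Sum>j<N n. g (t, c n j) \<bullet> (indicat_real (A n j) x *\<^sub>R v t x))
            = g (t, c n (idx n x)) \<bullet> v t x" .
      qed
      finally show ?thesis .
    qed
    moreover have "(\<lambda>n. \<integral>x. g (t, c n (idx n x)) \<bullet> v t x \<partial>\<pi> t) \<longlonglongrightarrow> (\<integral>x. g (t, x) \<bullet> v t x \<partial>\<pi> t)"
    proof (rule integral_dominated_convergence)
      show "integrable (\<pi> t) (\<lambda>x. C * norm (v t x))" using v[OF t] by auto
      show "(\<lambda>x. g (t, c n (idx n x)) \<bullet> v t x) \<in> borel_measurable (\<pi> t)" for n
        using measurable_compose[OF im[of n], of "\<lambda>k. g (t, c n k)"]
        by (intro borel_measurable_inner) (auto simp: o_def)
      show "(\<lambda>x. g (t, x) \<bullet> v t x) \<in> borel_measurable (\<pi> t)" by measurable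
      show "AE x in \<pi> t. norm (g (t, c n (idx n x)) \<bullet> v t x) \<le> C * norm (v t x)" for n
      proof (rule AE_I2)
        fix x assume "x \<in> space (\<pi> t)"
        then have "c n (idx n x) \<in> X" using c idx(2) by (simp add: space)
        then show "norm (g (t, c n (idx n x)) \<bullet> v t x) \<le> C * norm (v t x)"
          using C by (simp add: abs_inner_le)
      qed
      show "AE x in \<pi> t. (\<lambda>n. g (t, c n (idx n x)) \<bullet> v t x) \<longlonglongrightarrow> g (t, x) \<bullet> v t x"
      proof (rule AE_I2)
        fix x assume "x \<in> space (\<pi> t)"
        then have x: "x \<in> X" by (simp add: space)
        have "(\<lambda>n. dist (c n (idx n x)) x) \<longlonglongrightarrow> 0"
        proof (rule tendsto_sandwich[OF _ _ tendsto_const LIMSEQ_inverse_real_of_nat])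
          show "\<forall>\<^sub>F n in sequentially. dist (c n (idx n x)) x \<le> inverse (real (Suc n))"
            using d[OF x] by (intro always_eventually allI) (metis dist_commute less_imp_le)
        qed simp
        then have "(\<lambda>n. c n (idx n x)) \<longlonglongrightarrow> x" by (rule tendsto_dist_iff[THEN iffD2])
        then have "(\<lambda>n. g (t, c n (idx n x))) \<longlonglongrightarrow> g (t, x)"
          using c idx(2)[OF x] x
          by (intro continuous_on_tendsto_compose[OF cg]) (auto intro!: always_eventually)
        then show "(\<lambda>n. g (t, c n (idx n x)) \<bullet> v t x) \<longlonglongrightarrow> g (t, x) \<bullet> v t x"
          by (intro tendsto_intros)
      qed
    qed
    ultimately show ?thesis by simp
  qed
  ultimately show ?thesis by (rule borel_measurable_LIMSEQ_real[rotated])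
qed

section \<open>Weak duality\<close>

text \<open>The inequality of expectations, with every term moved to the side where it appears as a
  nonnegative quantity. In this form it also holds when \<open>l\<close> has infinite positive part,
  and it can be integrated over time without subtracting infinities.\<close>

lemma expectation_le_nn_integral_diff:
  fixes w l :: "'a \<Rightarrow> real"
  assumes w: "integrable M w" and l[measurable]: "l \<in> borel_measurable M"
    and le: "\<And>x. x \<in> space M \<Longrightarrow> w x \<le> l x"
  shows "(\<integral>\<^sup>+x. ennreal (- l x) \<partial>M) + ennreal (\<integral>x. w x \<partial>M)
      \<le> (\<integral>\<^sup>+x. ennreal (l x) \<partial>M) + ennreal (- (\<integral>x. w x \<partial>M))"
proof (cases "(\<integral>\<^sup>+x. ennreal (l x) \<partial>M) = \<infinity>")
  case True
  then show ?thesis by simp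
next
  case False
  have "(\<integral>\<^sup>+x. ennreal (- l x) \<partial>M) \<le> (\<integral>\<^sup>+x. ennreal (- w x) \<partial>M)"
    using le by (intro nn_integral_mono ennreal_leI) auto
  also have "\<dots> < \<infinity>" using w by (auto simp: real_integrable_def less_top)
  finally have neg: "(\<integral>\<^sup>+x. ennreal (- l x) \<partial>M) < \<infinity>" .
  then have il: "integrable M l" using False by (auto simp: real_integrable_def)
  have "(\<integral>x. w x \<partial>M) \<le> (\<integral>x. l x \<partial>M)" by (intro integral_mono w il le)
  also have "\<dots> = enn2real (\<integral>\<^sup>+x. ennreal (l x) \<partial>M) - enn2real (\<integral>\<^sup>+x. ennreal (- l x) \<partial>M)"
    by (rule real_lebesgue_integral_def[OF il])
  finally have le': "(\<integral>x. w x \<partial>M) \<le> enn2real (\<integral>\<^sup>+x. ennreal (l x) \<partial>M) - enn2real (\<integral>\<^sup>+x. ennreal (- l x) \<partial>M)" .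
  define P N where "P = enn2real (\<integral>\<^sup>+x. ennreal (l x) \<partial>M)" and "N = enn2real (\<integral>\<^sup>+x. ennreal (- l x) \<partial>M)"
  have P: "(\<integral>\<^sup>+x. ennreal (l x) \<partial>M) = ennreal P" "0 \<le> P" and N: "(\<integral>\<^sup>+x. ennreal (- l x) \<partial>M) = ennreal N" "0 \<le> N"
    unfolding P_def N_def using False neg by (auto simp: less_top[symmetric])
  show ?thesis unfolding P(1) N(1)
    using le'[folded P_def N_def] P(2) N(2)
    by (cases "(\<integral>x. w x \<partial>M) \<ge> 0") (auto simp: ennreal_neg ennreal_plus[symmetric] simp del: ennreal_plus)
qed

lemma ereal_le_enn2ereal_diff:
  assumes "n + ennreal a \<le> p + ennreal b" "0 \<le> a" "0 \<le> b"
  shows "ereal (a - b) \<le> enn2ereal p - enn2ereal n"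
proof (cases p)
  case (real q)
  then have "n + ennreal a \<le> ennreal (q + b)" using assms by simp
  then have "n \<noteq> \<top>" by (auto simp: top_unique)
  then obtain r where r: "n = ennreal r" "0 \<le> r" by (cases n) auto
  from assms real r have "r + a \<le> q + b" by (simp add: ennreal_plus[symmetric] del: ennreal_plus)
  with real r show ?thesis by (simp add: enn2ereal_ennreal)
next
  \<comment> \<open>In \<open>ereal\<close> an infinite minuend gives \<open>\<infinity>\<close>
    even if the subtrahend is infinite, so nothing is left to prove.\<close>
  case top
  then show ?thesis by simp
qed

lemma norm_le_one_plus_powr: "1 < r \<Longrightarrow> 0 \<le> y \<Longrightarrow> y \<le> 1 + y powr r" for y r :: real
proof (cases "y \<le> 1")
  case False
  assume "1 < r"
  then have "y powr 1 \<le> y powr r" using False by (intro powr_mono) auto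
  with False show ?thesis by simp
qed (simp add: add_increasing2)

text \<open>Fenchel-Young turns the Hamilton-Jacobi inequality into
  \<open>w t x \<le> L (v t x)\<close>, where \<open>w\<close> is the derivative of
  \<open>\<phi>\<close> along the velocity field. The time integral of the mean of \<open>w\<close>
  is the left-hand side of the continuity equation, hence the difference of the boundary terms of
  \<open>\<phi>\<close>.\<close>

lemma dynamical_weak_duality:
  fixes X :: "'a::euclidean_space set"
  assumes X: "compact X" and \<pi>: "\<pi> \<in> prob_curves X" and m: "m \<in> momentum_curves X"
    and ac: "\<And>t. t \<in> {0..1} \<Longrightarrow> abs_continuous (m t) (\<pi> t)"
    and r: "1 < r"
      "(\<integral>\<^sup>+t\<in>{0..1}. (\<integral>\<^sup>+x. ennreal (norm (vector_density (m t) (\<pi> t) x) powr r) \<partial>\<pi> t) \<partial>lborel) < \<infinity>"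
    and ce: "continuity_equation X \<pi> m"
    and L: "continuous_on UNIV L"
    and \<phi>: "C1_on ({0..1} \<times> X) \<phi>"
    and hj: "\<And>t x. t \<in> {0..1} \<Longrightarrow> x \<in> X \<Longrightarrow> ereal (time_deriv \<phi> t x) + legendre L (space_grad \<phi> t x) \<le> 0"
  shows "ereal ((\<integral>x. \<phi> (1, x) \<partial>\<pi> 1) - (\<integral>x. \<phi> (0, x) \<partial>\<pi> 0)) \<le> dynamical_cost L \<pi> m"
proof -
  define Dt where "Dt y = time_deriv \<phi> (fst y) (snd y)" for y
  define Dx where "Dx y = space_grad \<phi> (fst y) (snd y)" for y
  have D: "continuous_on ({0..1} \<times> X) Dt" "continuous_on ({0..1} \<times> X) Dx"
    unfolding Dt_def Dx_def by (rule C1_on_space_time[OF \<phi>])+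
  have dt: "time_deriv \<phi> t x = Dt (t, x)" and dx: "space_grad \<phi> t x = Dx (t, x)" for t x
    by (simp_all add: Dt_def Dx_def)
  define v where "v t = vector_density (m t) (\<pi> t)" for t
  have P: "\<pi> t \<in> prob_measures X" if "t \<in> {0..1}" for t by (rule prob_curvesD(1)[OF \<pi> that])
  have sets: "sets (\<pi> t) = sets (borel_on X)" and space: "space (\<pi> t) = X" if "t \<in> {0..1}" for t
    using prob_measuresD[OF P[OF that]] by auto
  have v: "integrable (\<pi> t) (v t)"
    and mv: "A \<in> sets (\<pi> t) \<Longrightarrow> m t A = set_lebesgue_integral (\<pi> t) A (v t)"
    if t: "t \<in> {0..1}" for t A
  proof -
    interpret prob_space "\<pi> t" by (rule prob_measuresD(1)[OF P[OF t]])
    have "vector_measure (borel_on X) (m t)" using m t by (simp add: momentum_curves_def)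
    then have "vector_measure (\<pi> t) (m t)" by (simp add: vector_measure_def sets[OF t])
    from vector_density_integrable[OF this ac[OF t]]
    show "integrable (\<pi> t) (v t)"
      and "A \<in> sets (\<pi> t) \<Longrightarrow> m t A = set_lebesgue_integral (\<pi> t) A (v t)" by (auto simp: v_def)
  qed
  have cDt: "continuous_on X (\<lambda>x. Dt (t, x))" and cDx: "continuous_on X (\<lambda>x. Dx (t, x))" if "t \<in> {0..1}" for t
    using D(1,2) that by (auto intro!: continuous_on_compose2[where s=X and t="{0..1} \<times> X"] continuous_intros)
  obtain C where C: "0 < C" "\<And>t x. t \<in> {0..1} \<Longrightarrow> x \<in> X \<Longrightarrow> \<bar>Dt (t, x)\<bar> \<le> C"
    "\<And>t x. t \<in> {0..1} \<Longrightarrow> x \<in> X \<Longrightarrow> norm (Dx (t, x)) \<le> C"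
  proof -
    have K: "compact ({0..1::real} \<times> X)" by (intro compact_Times X compact_Icc)
    obtain C1 where "\<And>y. y \<in> {0..1} \<times> X \<Longrightarrow> norm (Dt y) \<le> C1"
      using continuous_on_compact_bound[OF K D(1)] by blast
    moreover obtain C2 where "\<And>y. y \<in> {0..1} \<times> X \<Longrightarrow> norm (Dx y) \<le> C2"
      using continuous_on_compact_bound[OF K D(2)] by blast
    ultimately show ?thesis by (intro that[of "max 1 (max C1 C2)"]) (auto simp: le_max_iff_disj)
  qed
  define w where "w t x = Dt (t, x) + Dx (t, x) \<bullet> v t x" for t x
  define h where "h t = (\<integral>x. w t x \<partial>\<pi> t)" for t
  have iDt: "integrable (\<pi> t) (\<lambda>x. Dt (t, x))" if "t \<in> {0..1}" for t
    by (rule integrable_continuous_prob[OF P[OF that] X cDt[OF that]])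
  have iDx: "integrable (\<pi> t) (\<lambda>x. Dx (t, x) \<bullet> v t x)" if t: "t \<in> {0..1}" for t
    by (rule integrable_inner_bounded[OF v[OF t] borel_measurable_continuous_prob[OF P[OF t] cDx[OF t]], of C])
      (use C(3)[OF t] in \<open>auto intro!: AE_I2 simp: space[OF t]\<close>)
  have iw: "integrable (\<pi> t) (w t)" if "t \<in> {0..1}" for t
    unfolding w_def using iDt[OF that] iDx[OF that] by simp
  have h_eq: "h t = (\<integral>x. Dt (t, x) \<partial>\<pi> t) + (\<integral>x. Dx (t, x) \<bullet> v t x \<partial>\<pi> t)" if "t \<in> {0..1}" for t
    unfolding h_def w_def using iDt[OF that] iDx[OF that] by simp
  have cont: "continuous_on {0..1} (\<lambda>t. \<integral>x. Dt (t, x) \<partial>\<pi> t)"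
    by (rule continuous_on_integral_prob_curve[OF \<pi> X D(1)])
  have mDx: "(\<lambda>t. \<integral>x. Dx (t, x) \<bullet> v t x \<partial>\<pi> t) \<in> borel_measurable unit_lborel"
    by (rule borel_measurable_momentum_integral[OF X m sets v mv D(2)])
  have mh[measurable]: "h \<in> borel_measurable unit_lborel"
    using borel_measurable_add[OF borel_measurable_unit_lborel[OF cont] mDx]
    by (subst measurable_cong[OF h_eq]) (auto simp: space_unit_lborel)
  define R where "R t = (\<integral>\<^sup>+x. ennreal (norm (v t x) powr r) \<partial>\<pi> t)" for t
  \<comment> \<open>\<open>\<bar>w t x\<bar> \<le> C * (1 + norm (v t x))\<close> together with
    \<open>norm (v t x) \<le> 1 + norm (v t x) powr r\<close> produces the summand \<open>2\<close>.
    The bound transfers the moment condition to \<open>h\<close>.\<close>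
  have hR: "ennreal (\<bar>h t\<bar> / C) \<le> R t + 2" if t: "t \<in> {0..1}" for t
  proof -
    interpret prob_space "\<pi> t" by (rule prob_measuresD(1)[OF P[OF t]])
    have [measurable]: "v t \<in> borel_measurable (\<pi> t)" using v[OF t] by auto
    have "\<bar>h t\<bar> / C \<le> (\<integral>x. \<bar>w t x\<bar> \<partial>\<pi> t) / C"
      unfolding h_def using C(1) by (intro divide_right_mono integral_abs_bound) auto
    then have "ennreal (\<bar>h t\<bar> / C) \<le> ennreal (\<integral>x. \<bar>w t x\<bar> / C \<partial>\<pi> t)" by (intro ennreal_leI) simp
    also have "\<dots> = (\<integral>\<^sup>+x. ennreal (\<bar>w t x\<bar> / C) \<partial>\<pi> t)"
      using iw[OF t] C(1) by (intro nn_integral_eq_integral[symmetric]) auto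
    also have "\<dots> \<le> (\<integral>\<^sup>+x. ennreal (norm (v t x) powr r) + 2 \<partial>\<pi> t)"
    proof (rule nn_integral_mono)
      fix x assume "x \<in> space (\<pi> t)"
      then have x: "x \<in> X" by (simp add: space[OF t])
      have "\<bar>w t x\<bar> \<le> C + C * norm (v t x)"
        unfolding w_def using C(2)[OF t x] abs_inner_le[OF C(3)[OF t x], of "v t x"] by linarith
      then have "\<bar>w t x\<bar> / C \<le> 1 + norm (v t x)" using C(1) by (simp add: field_simps)
      also have "\<dots> \<le> norm (v t x) powr r + 2"
        using norm_le_one_plus_powr[OF r(1), of "norm (v t x)"] by simp
      finally have "ennreal (\<bar>w t x\<bar> / C) \<le> ennreal (norm (v t x) powr r + 2)" by (rule ennreal_leI)
      then show "ennreal (\<bar>w t x\<bar> / C) \<le> ennreal (norm (v t x) powr r) + 2" by simp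
    qed
    also have "\<dots> = R t + 2" unfolding R_def
      by (subst nn_integral_add) (auto simp: emeasure_space_1)
    finally show ?thesis .
  qed
  have ih: "integrable unit_lborel h"
  proof -
    interpret U: prob_space unit_lborel by (rule prob_space_unit_lborel)
    have "(\<integral>\<^sup>+t. ennreal (\<bar>h t\<bar> / C) \<partial>unit_lborel) \<le> (\<integral>\<^sup>+t. R t + 2 \<partial>unit_lborel)"
      by (intro nn_integral_mono hR) (simp add: space_unit_lborel)
    \<comment> \<open>\<open>R\<close> is not known to be measurable in time; the constant
      \<open>2\<close> is the measurable summand that is split off the lower integral.\<close>
    also have "\<dots> = (\<integral>\<^sup>+t. R t \<partial>unit_lborel) + 2"
      by (subst nn_integral_add_measurable) (simp_all add: U.emeasure_space_1[unfolded space_unit_lborel] space_unit_lborel)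
    also have "\<dots> < \<infinity>"
      using r(2) by (simp add: nn_integral_unit_lborel R_def v_def less_top[symmetric])
    finally have "integrable unit_lborel (\<lambda>t. \<bar>h t\<bar> / C)"
      using C(1) by (intro integrableI_nonneg) auto
    then have "integrable unit_lborel (\<lambda>t. C * (\<bar>h t\<bar> / C))" by (rule integrable_mult_right)
    then show ?thesis by (rule Bochner_Integration.integrable_bound) (use C(1) mh in auto)
  qed
  have hj': "w t x \<le> L (v t x)" if "t \<in> {0..1}" "x \<in> X" for t x
  proof -
    have "ereal (v t x \<bullet> Dx (t, x) - L (v t x)) \<le> legendre L (Dx (t, x))"
      unfolding legendre_def by (rule SUP_upper) simp
    from order_trans[OF add_left_mono[OF this] hj[OF that, unfolded dt dx]]
    have "ereal (Dt (t, x)) + ereal (v t x \<bullet> Dx (t, x) - L (v t x)) \<le> 0" .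
    then show ?thesis by (simp add: w_def inner_commute)
  qed
  define p n where "p = (\<integral>\<^sup>+t. (\<integral>\<^sup>+x. ennreal (L (v t x)) \<partial>\<pi> t) \<partial>unit_lborel)"
    and "n = (\<integral>\<^sup>+t. (\<integral>\<^sup>+x. ennreal (- L (v t x)) \<partial>\<pi> t) \<partial>unit_lborel)"
  have fin: "(\<integral>\<^sup>+t. ennreal (h t) \<partial>unit_lborel) < \<infinity>" "(\<integral>\<^sup>+t. ennreal (- h t) \<partial>unit_lborel) < \<infinity>"
    using ih by (auto simp: real_integrable_def less_top)
  \<comment> \<open>The positive and negative parts of \<open>h\<close> are added so that every
    pointwise comparison is between nonnegative terms; they are the measurable, finite summands to
    be split off again.\<close>
  have "n + (\<integral>\<^sup>+t. ennreal (h t) \<partial>unit_lborel)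
      = (\<integral>\<^sup>+t. (\<integral>\<^sup>+x. ennreal (- L (v t x)) \<partial>\<pi> t) + ennreal (h t) \<partial>unit_lborel)"
    unfolding n_def by (rule nn_integral_add_measurable[symmetric]) auto
  also have "\<dots> \<le> (\<integral>\<^sup>+t. (\<integral>\<^sup>+x. ennreal (L (v t x)) \<partial>\<pi> t) + ennreal (- h t) \<partial>unit_lborel)"
  proof (rule nn_integral_mono)
    fix t assume "t \<in> space unit_lborel"
    then have t: "t \<in> {0..1}" by (simp add: space_unit_lborel)
    have "(\<lambda>x. L (v t x)) \<in> borel_measurable (\<pi> t)"
      using measurable_compose[OF borel_measurable_integrable[OF v[OF t]] borel_measurable_continuous_onI[OF L]] .
    then show "(\<integral>\<^sup>+x. ennreal (- L (v t x)) \<partial>\<pi> t) + ennreal (h t)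
      \<le> (\<integral>\<^sup>+x. ennreal (L (v t x)) \<partial>\<pi> t) + ennreal (- h t)"
      unfolding h_def by (intro expectation_le_nn_integral_diff iw t) (auto simp: space[OF t] hj'[OF t])
  qed
  also have "\<dots> = p + (\<integral>\<^sup>+t. ennreal (- h t) \<partial>unit_lborel)"
    unfolding p_def by (rule nn_integral_add_measurable) auto
  finally have "n + ennreal (enn2real (\<integral>\<^sup>+t. ennreal (h t) \<partial>unit_lborel))
     \<le> p + ennreal (enn2real (\<integral>\<^sup>+t. ennreal (- h t) \<partial>unit_lborel))"
    using fin by (simp add: less_top[symmetric])
  then have "ereal (\<integral>t. h t \<partial>unit_lborel) \<le> enn2ereal p - enn2ereal n"
    unfolding real_lebesgue_integral_def[OF ih] by (rule ereal_le_enn2ereal_diff) auto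
  also have "enn2ereal p - enn2ereal n = dynamical_cost L \<pi> m"
    by (simp add: dynamical_cost_def p_def n_def v_def nn_integral_unit_lborel)
  finally have main: "ereal (\<integral>t. h t \<partial>unit_lborel) \<le> dynamical_cost L \<pi> m" .
  have i1: "integrable unit_lborel (\<lambda>t. \<integral>x. Dt (t, x) \<partial>\<pi> t)"
    by (rule integrable_unit_lborel[OF cont])
  \<comment> \<open>Integrability of the momentum term is obtained from that of \<open>h\<close>
    minus the continuous first term; it is needed to add the two time integrals of the continuity
    equation.\<close>
  have "integrable unit_lborel (\<lambda>t. h t - (\<integral>x. Dt (t, x) \<partial>\<pi> t))" using ih i1 by simp
  then have i2: "integrable unit_lborel (\<lambda>t. \<integral>x. Dx (t, x) \<bullet> v t x \<partial>\<pi> t)"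
    by (rule Bochner_Integration.integrable_cong[THEN iffD1, rotated -1]) (auto simp: space_unit_lborel h_eq)
  have "(\<integral>x. \<phi> (1, x) \<partial>\<pi> 1) - (\<integral>x. \<phi> (0, x) \<partial>\<pi> 0)
    = (\<integral>t. (\<integral>x. time_deriv \<phi> t x \<partial>\<pi> t) \<partial>unit_lborel)
      + (\<integral>t. vector_integral (borel_on X) (m t) (space_grad \<phi> t) \<partial>unit_lborel)"
    using ce \<phi> by (simp add: continuity_equation_def integral_unit_lborel)
  also have "(\<integral>t. (\<integral>x. time_deriv \<phi> t x \<partial>\<pi> t) \<partial>unit_lborel) = (\<integral>t. (\<integral>x. Dt (t, x) \<partial>\<pi> t) \<partial>unit_lborel)"
    by (intro lebesgue_integral_cong) (auto simp: space_unit_lborel space dt)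
  also have "(\<integral>t. vector_integral (borel_on X) (m t) (space_grad \<phi> t) \<partial>unit_lborel)
      = (\<integral>t. (\<integral>x. Dx (t, x) \<bullet> v t x \<partial>\<pi> t) \<partial>unit_lborel)"
  proof (intro lebesgue_integral_cong)
    fix t assume "t \<in> space unit_lborel"
    then have t: "t \<in> {0..1}" by (simp add: space_unit_lborel)
    have "space_grad \<phi> t \<in> borel_measurable (\<pi> t)"
      using borel_measurable_continuous_prob[OF P[OF t] cDx[OF t]]
      by (subst measurable_cong[where g="\<lambda>x. Dx (t, x)"]) (auto simp: space[OF t] dx)
    then have "vector_integral (borel_on X) (m t) (space_grad \<phi> t) = (\<integral>x. space_grad \<phi> t x \<bullet> v t x \<partial>\<pi> t)"
      using C(3)[OF t] t
      by (intro vector_integral_eq[where C=C] v mv) (auto simp: space sets dx)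
    also have "\<dots> = (\<integral>x. Dx (t, x) \<bullet> v t x \<partial>\<pi> t)"
      by (intro lebesgue_integral_cong) (auto simp: space[OF t] dx)
    finally show "vector_integral (borel_on X) (m t) (space_grad \<phi> t) = (\<integral>x. Dx (t, x) \<bullet> v t x \<partial>\<pi> t)" .
  qed
  also have "(\<integral>t. (\<integral>x. Dt (t, x) \<partial>\<pi> t) \<partial>unit_lborel) + (\<integral>t. (\<integral>x. Dx (t, x) \<bullet> v t x \<partial>\<pi> t) \<partial>unit_lborel)
      = (\<integral>t. h t \<partial>unit_lborel)"
    unfolding Bochner_Integration.integral_add[OF i1 i2, symmetric]
    by (intro lebesgue_integral_cong) (auto simp: space_unit_lborel h_eq)
  finally show ?thesis using main by simp
qed

section \<open>Almost-everywhere constraints and couplings\<close>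

lemma measurable_vec_nth_borel_on:
  "(\<lambda>x. x $ l) \<in> borel_on (vec_power \<Omega>) \<rightarrow>\<^sub>M borel_on (\<Omega> :: ('a::real_normed_vector) set)"
proof (rule measurable_restrict_space3)
  show "(\<lambda>x::'a ^ 'b. x $ l) \<in> borel \<rightarrow>\<^sub>M borel"
    by (intro borel_measurable_continuous_onI continuous_intros)
qed (auto simp: vec_power_def)

text \<open>A countable basis and rational thresholds reduce the choice of \<open>U\<close> and
  \<open>q\<close> to countably many null sets. The outcome replaces a continuity property of
  \<open>\<psi>\<close>: around almost every point, values close to \<open>\<psi> y\<close> or
  larger occur with positive mass in every neighbourhood.\<close>

lemma AE_essential_values:
  fixes \<mu> :: "'a::second_countable_topology measure" and \<psi> :: "'a \<Rightarrow> real"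
  assumes \<mu>: "sets \<mu> = sets (borel_on \<Omega>)" and \<psi>[measurable]: "\<psi> \<in> borel_measurable \<mu>"
  shows "AE y in \<mu>. \<forall>q U. open U \<longrightarrow> y \<in> U \<longrightarrow> q < \<psi> y \<longrightarrow>
     {z \<in> space \<mu>. z \<in> U \<and> q < \<psi> z} \<in> sets \<mu> \<and> 0 < emeasure \<mu> {z \<in> space \<mu>. z \<in> U \<and> q < \<psi> z}"
proof -
  have space: "space \<mu> = \<Omega>" using sets_eq_imp_space_eq[OF \<mu>] by (simp add: space_restrict_space)
  have U_sets: "U \<inter> \<Omega> \<in> sets \<mu>" if "open U" for U
    unfolding \<mu> sets_restrict_space using that by (intro image_eqI[of _ _ U]) auto
  have S: "{z \<in> space \<mu>. z \<in> U \<and> q < \<psi> z} \<in> sets \<mu>" if "open U" for U q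
  proof -
    have "{z \<in> space \<mu>. z \<in> U \<and> q < \<psi> z} = (U \<inter> \<Omega>) \<inter> {z \<in> space \<mu>. q < \<psi> z}" by (auto simp: space)
    then show ?thesis using U_sets[OF that] by simp
  qed
  obtain B :: "'a set set" where B: "countable B" "topological_basis B"
    using ex_countable_basis by blast
  have oB: "open U" if "U \<in> B" for U using B(2) that by (rule topological_basis_open)
  have "AE y in \<mu>. \<forall>U\<in>B. \<forall>q\<in>\<rat>. y \<in> U \<longrightarrow> q < \<psi> y \<longrightarrow> 0 < emeasure \<mu> {z \<in> space \<mu>. z \<in> U \<and> q < \<psi> z}"
  proof (subst AE_ball_countable[OF B(1)], rule ballI, subst AE_ball_countable[OF countable_rat], rule ballI)
    fix U q assume U: "U \<in> B"
    show "AE y in \<mu>. y \<in> U \<longrightarrow> q < \<psi> y \<longrightarrow> 0 < emeasure \<mu> {z \<in> space \<mu>. z \<in> U \<and> q < \<psi> z}"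
    proof (cases "emeasure \<mu> {z \<in> space \<mu>. z \<in> U \<and> q < \<psi> z} = 0")
      case True
      with S[OF oB[OF U]] have "{z \<in> space \<mu>. z \<in> U \<and> q < \<psi> z} \<in> null_sets \<mu>" by auto
      from AE_not_in[OF this] show ?thesis by (rule AE_mp) (auto intro!: AE_I2)
    next
      case False
      then show ?thesis by (simp add: zero_less_iff_neq_zero)
    qed
  qed
  then show ?thesis
  proof (rule AE_mp, intro AE_I2 impI allI)
    fix y q U assume y: "\<forall>U\<in>B. \<forall>q\<in>\<rat>. y \<in> U \<longrightarrow> q < \<psi> y \<longrightarrow> 0 < emeasure \<mu> {z \<in> space \<mu>. z \<in> U \<and> q < \<psi> z}"
      and U: "open U" "y \<in> U" and q: "q < \<psi> y"
    obtain V where V: "V \<in> B" "y \<in> V" "V \<subseteq> U" using topological_basisE[OF B(2) U] .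
    obtain s where s: "s \<in> \<rat>" "q < s" "s < \<psi> y" using Rats_dense_in_real[OF q] by blast
    have "0 < emeasure \<mu> {z \<in> space \<mu>. z \<in> V \<and> s < \<psi> z}" using y V s by blast
    also have "\<dots> \<le> emeasure \<mu> {z \<in> space \<mu>. z \<in> U \<and> q < \<psi> z}"
      using V s by (intro emeasure_mono S[OF U(1)]) auto
    finally show "{z \<in> space \<mu>. z \<in> U \<and> q < \<psi> z} \<in> sets \<mu> \<and> 0 < emeasure \<mu> {z \<in> space \<mu>. z \<in> U \<and> q < \<psi> z}"
      using S[OF U(1)] by simp
  qed
qed

text \<open>The constraint passes from the product measure to a possibly singular coupling: near a point
  with generic coordinates, the points where no \<open>\<psi> l\<close> is much smaller contain a box of positive
  product measure, and \<open>c\<close> is continuous.\<close>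

lemma coupling_integral_le:
  fixes \<Omega> :: "(real ^ 'd) set" and \<mu> :: "'k::finite \<Rightarrow> (real ^ 'd) measure"
    and \<psi> :: "'k \<Rightarrow> real ^ 'd \<Rightarrow> real" and c :: "real ^ 'd ^ 'k \<Rightarrow> real"
  assumes \<Omega>: "compact \<Omega>" and \<mu>: "\<And>l. \<mu> l \<in> prob_measures \<Omega>"
    and \<gamma>: "\<gamma> \<in> prob_measures (vec_power \<Omega>)"
    and marg: "\<And>l. distr \<gamma> (borel_on \<Omega>) (\<lambda>x. x $ l) = \<mu> l"
    and \<psi>: "\<And>l. integrable (\<mu> l) (\<psi> l)"
    and c: "continuous_on (vec_power \<Omega>) c" "integrable \<gamma> c"
    and AE: "AE x in Pi\<^sub>M UNIV \<mu>. (\<Sum>l\<in>UNIV. \<psi> l (x l)) \<le> c (vec_lambda x)"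
  shows "(\<Sum>l\<in>UNIV. \<integral>x. \<psi> l x \<partial>\<mu> l) \<le> (\<integral>x. c x \<partial>\<gamma>)"
proof -
  have sp: "space (\<mu> l) = \<Omega>" and st: "sets (\<mu> l) = sets (borel_on \<Omega>)" for l
    using prob_measuresD[OF \<mu>] by auto
  have [measurable]: "\<psi> l \<in> borel_measurable (\<mu> l)" for l using \<psi> by auto
  interpret P: product_prob_space \<mu> UNIV
    using prob_measuresD(1)[OF \<mu>]
    by (intro product_prob_spaceI)
  define good where "good l y \<longleftrightarrow> (\<forall>q U. open U \<longrightarrow> y \<in> U \<longrightarrow> q < \<psi> l y \<longrightarrow>
     {z \<in> space (\<mu> l). z \<in> U \<and> q < \<psi> l z} \<in> sets (\<mu> l) \<and>
     0 < emeasure (\<mu> l) {z \<in> space (\<mu> l). z \<in> U \<and> q < \<psi> l z})" for l y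
  have AEg: "AE y in \<mu> l. good l y" for l
    unfolding good_def using AE_essential_values[of "\<mu> l" \<Omega> "\<psi> l"] st by simp
  have le: "(\<Sum>l\<in>UNIV. \<psi> l (x $ l)) \<le> c x" if x: "x \<in> vec_power \<Omega>" "\<And>l. good l (x $ l)" for x
  proof (rule field_le_epsilon)
    fix e :: real assume e: "0 < e"
    \<comment> \<open>One share of \<open>e\<close> is lost in each coordinate and one more through
      the continuity of \<open>c\<close>.\<close>
    define e' where "e' = e / (real CARD('k) + 1)"
    have e': "0 < e'" "(real CARD('k) + 1) * e' = e" using e by (simp_all add: e'_def add_nonneg_pos)
    obtain W where W: "open W" "x \<in> W" "\<And>y. y \<in> vec_power \<Omega> \<Longrightarrow> y \<in> W \<Longrightarrow> c y < c x + e'"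
    proof -
      have "\<exists>W. open W \<and> x \<in> W \<and> (\<forall>y\<in>vec_power \<Omega>. y \<in> W \<longrightarrow> c y \<in> {..<c x + e'})"
        using c(1)[unfolded continuous_on_topological, rule_format, OF x(1), of "{..<c x + e'}"] e'(1) by simp
      then show ?thesis using that by blast
    qed
    have "\<exists>A. (\<forall>l. open (A l) \<and> x $ l \<in> A l) \<and> (\<forall>y. (\<forall>l. y $ l \<in> A l) \<longrightarrow> y \<in> W)"
      by (rule W(1)[THEN open_vec_def[THEN iffD1], THEN bspec, OF W(2)])
    then obtain A where "\<forall>l. open (A l) \<and> x $ l \<in> A l" "\<forall>y. (\<forall>l. y $ l \<in> A l) \<longrightarrow> y \<in> W"
      by (elim exE conjE)
    then have A: "\<And>l. open (A l)" "\<And>l. x $ l \<in> A l" "\<And>y. (\<And>l. y $ l \<in> A l) \<Longrightarrow> y \<in> W"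
      by simp_all
    define Z where "Z l = {z \<in> space (\<mu> l). z \<in> A l \<and> \<psi> l (x $ l) - e' < \<psi> l z}" for l
    have Z: "Z l \<in> sets (\<mu> l)" "0 < emeasure (\<mu> l) (Z l)" for l
      using x(2)[of l] A(1,2)[of l] e'(1) unfolding good_def Z_def by auto
    have "emeasure (Pi\<^sub>M UNIV \<mu>) (Pi\<^sub>E UNIV Z) = (\<Prod>l\<in>UNIV. emeasure (\<mu> l) (Z l))"
      using Z(1) by (intro P.emeasure_PiM) auto
    also have "\<dots> \<noteq> 0" using Z(2) by (simp add: zero_less_iff_neq_zero)
    finally have pos: "emeasure (Pi\<^sub>M UNIV \<mu>) (Pi\<^sub>E UNIV Z) \<noteq> 0" .
    \<comment> \<open>The box has positive product measure, so the almost-everywhere constraint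
      holds at one of its points. That point need not be \<open>x\<close>; it is close to
      \<open>x\<close>, and each \<open>\<psi> l\<close> is at most \<open>e'\<close> smaller
      there.\<close>
    have "\<exists>y\<in>Pi\<^sub>E UNIV Z. (\<Sum>l\<in>UNIV. \<psi> l (y l)) \<le> c (vec_lambda y)"
    proof (rule ccontr)
      assume neg: "\<not> ?thesis"
      have N: "AE y in Pi\<^sub>M UNIV \<mu>. y \<notin> Pi\<^sub>E UNIV Z"
        using AE by (rule AE_mp) (use neg in \<open>auto intro!: AE_I2\<close>)
      have S: "Pi\<^sub>E UNIV Z \<in> sets (Pi\<^sub>M UNIV \<mu>)" using Z(1) by (intro sets_PiM_I_finite) auto
      have "emeasure (Pi\<^sub>M UNIV \<mu>) (Pi\<^sub>E UNIV Z) = 0"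
        by (rule null_setsD1[OF AE_iff_null_sets[OF S, THEN iffD2, OF N]])
      with pos show False by simp
    qed
    then obtain y where y: "\<And>l. y l \<in> Z l" "(\<Sum>l\<in>UNIV. \<psi> l (y l)) \<le> c (vec_lambda y)" by auto
    have "vec_lambda y \<in> W" using y(1) by (intro A(3)) (auto simp: Z_def)
    moreover have "vec_lambda y \<in> vec_power \<Omega>" using y(1) by (auto simp: vec_power_def Z_def sp)
    ultimately have "c (vec_lambda y) < c x + e'" by (rule W(3)[rotated])
    have "(\<Sum>l\<in>UNIV. \<psi> l (x $ l)) \<le> (\<Sum>l\<in>UNIV. \<psi> l (y l) + e')"
      using y(1) by (intro sum_mono) (auto simp: Z_def less_imp_le diff_less_eq)
    also have "\<dots> = (\<Sum>l\<in>UNIV. \<psi> l (y l)) + real CARD('k) * e'" by (simp add: sum.distrib)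
    also have "\<dots> \<le> c x + e' + real CARD('k) * e'" using y(2) \<open>c (vec_lambda y) < c x + e'\<close> by simp
    also have "\<dots> = c x + e" using e'(2) by (simp add: algebra_simps)
    finally show "(\<Sum>l\<in>UNIV. \<psi> l (x $ l)) \<le> c x + e" .
  qed
  have mn: "(\<lambda>x. x $ l) \<in> \<gamma> \<rightarrow>\<^sub>M borel_on \<Omega>" for l
    using measurable_vec_nth_borel_on measurable_cong_sets[OF prob_measuresD(2)[OF \<gamma>] refl] by blast
  have \<psi>m: "\<psi> l \<in> borel_measurable (borel_on \<Omega>)" for l
    using measurable_cong_sets[OF st refl] \<psi> by blast
  have i: "integrable \<gamma> (\<lambda>x. \<psi> l (x $ l))" for l
    using \<psi>[of l] unfolding marg[of l, symmetric] by (rule integrable_distr[OF mn])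
  have "(\<Sum>l\<in>UNIV. \<integral>x. \<psi> l x \<partial>\<mu> l) = (\<Sum>l\<in>UNIV. \<integral>x. \<psi> l (x $ l) \<partial>\<gamma>)"
    using integral_distr[OF mn \<psi>m] by (simp add: marg)
  also have "\<dots> = (\<integral>x. (\<Sum>l\<in>UNIV. \<psi> l (x $ l)) \<partial>\<gamma>)"
    by (rule Bochner_Integration.integral_sum[symmetric]) (rule i)
  also have "\<dots> \<le> (\<integral>x. c x \<partial>\<gamma>)"
  proof (rule integral_mono_AE)
    \<comment> \<open>Exceptional sets in one coordinate are \<open>\<mu> l\<close>-null and pull
      back to null sets of the coupling through its marginals, even if the coupling is singular to
      the product measure.\<close>
    have "AE x in \<gamma>. good l (x $ l)" for l
      using AEg[of l] unfolding marg[of l, symmetric] by (rule AE_distrD[OF mn])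
    then have "AE x in \<gamma>. \<forall>l. good l (x $ l)" by (simp add: AE_all_countable)
    then show "AE x in \<gamma>. (\<Sum>l\<in>UNIV. \<psi> l (x $ l)) \<le> c x"
      by (rule AE_mp) (auto intro!: AE_I2 le simp: prob_measuresD(3)[OF \<gamma>])
  qed (use i c in auto)
  finally show ?thesis .
qed

lemma vec_power_compact:
  fixes \<Omega> :: "'a::euclidean_space set"
  assumes "compact \<Omega>"
  shows "compact (vec_power \<Omega> :: ('a ^ 'k::finite) set)"
proof -
  have "closed (vec_power \<Omega> :: ('a ^ 'k) set)"
  proof -
    have "vec_power \<Omega> = (\<Inter>l. (\<lambda>x::'a ^ 'k. x $ l) -` \<Omega>)" by (auto simp: vec_power_def)
    moreover have "closed ((\<lambda>x::'a ^ 'k. x $ l) -` \<Omega>)" for l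
      by (intro closed_vimage compact_imp_closed assms continuous_intros)
    ultimately show ?thesis by auto
  qed
  moreover have "bounded (vec_power \<Omega> :: ('a ^ 'k) set)"
  proof -
    obtain C where C: "\<And>x. x \<in> \<Omega> \<Longrightarrow> norm x \<le> C"
      using compact_imp_bounded[OF assms] unfolding bounded_iff by blast
    have "norm x \<le> (\<Sum>l\<in>(UNIV::'k set). C)" if "x \<in> vec_power \<Omega>" for x :: "'a ^ 'k"
    proof -
      have "norm x \<le> (\<Sum>l\<in>UNIV. norm (x $ l))"
        unfolding norm_vec_def by (rule L2_set_le_sum) simp
      also have "\<dots> \<le> (\<Sum>l\<in>(UNIV::'k set). C)" using that C by (intro sum_mono) (simp add: vec_power_def)
      finally show ?thesis .
    qed
    then show ?thesis unfolding bounded_iff by blast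
  qed
  ultimately show ?thesis by (simp add: compact_eq_bounded_closed)
qed

lemma vec_power_convex:
  "convex \<Omega> \<Longrightarrow> convex (vec_power \<Omega> :: ('a::real_vector ^ 'k) set)"
  by (auto simp: convex_def vec_power_def)

lemma C1_on_continuous: "C1_on S f \<Longrightarrow> continuous_on S f"
  unfolding C1_on_def gderiv_def
  by (intro continuous_at_imp_continuous_on ballI) (blast intro: has_derivative_continuous)

lemma weak_duality:
  fixes \<Omega> :: "(real ^ 'd) set" and \<mu> :: "'k::finite \<Rightarrow> (real ^ 'd) measure"
  assumes \<Omega>: "compact \<Omega>" and \<mu>: "\<And>l. \<mu> l \<in> prob_measures \<Omega>" and L: "continuous_on UNIV L"
    and adm: "(\<pi>, m) \<in> admissible \<Omega> p \<mu>" and dual: "(\<phi>, \<psi>) \<in> dual_feasible \<Omega> L \<mu>"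
  shows "ereal ((\<Sum>l\<in>UNIV. \<integral>x. \<psi> l x \<partial>\<mu> l) - (\<integral>x. \<phi> (0, x) \<partial>p)) \<le> dynamical_cost L \<pi> m"
proof -
  note X = vec_power_compact[OF \<Omega>]
  from adm obtain r where adm: "\<pi> \<in> prob_curves (vec_power \<Omega>)" "m \<in> momentum_curves (vec_power \<Omega>)"
    "\<And>t. t \<in> {0..1} \<Longrightarrow> abs_continuous (m t) (\<pi> t)" "1 < r"
    "(\<integral>\<^sup>+t\<in>{0..1}. (\<integral>\<^sup>+x. ennreal (norm (vector_density (m t) (\<pi> t) x) powr r) \<partial>\<pi> t) \<partial>lborel) < \<infinity>"
    "continuity_equation (vec_power \<Omega>) \<pi> m" "\<pi> 0 = p"
    "\<And>l. distr (\<pi> 1) (borel_on \<Omega>) (\<lambda>x. x $ l) = \<mu> l"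
    unfolding admissible_def by auto
  from dual have dual: "C1_on ({0..1} \<times> vec_power \<Omega>) \<phi>" "\<And>l. integrable (\<mu> l) (\<psi> l)"
    "\<And>t x. t \<in> {0..1} \<Longrightarrow> x \<in> vec_power \<Omega> \<Longrightarrow> ereal (time_deriv \<phi> t x) + legendre L (space_grad \<phi> t x) \<le> 0"
    "AE x in Pi\<^sub>M UNIV \<mu>. (\<Sum>l\<in>UNIV. \<psi> l (x l)) \<le> \<phi> (1, vec_lambda x)"
    unfolding dual_feasible_def by auto
  have P1: "\<pi> 1 \<in> prob_measures (vec_power \<Omega>)" by (rule prob_curvesD(1)[OF adm(1)]) simp
  have c: "continuous_on (vec_power \<Omega>) (\<lambda>x. \<phi> (1, x))"
    by (rule continuous_on_compose2[OF C1_on_continuous[OF dual(1)]]) (auto intro!: continuous_intros)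
  have "(\<Sum>l\<in>UNIV. \<integral>x. \<psi> l x \<partial>\<mu> l) \<le> (\<integral>x. \<phi> (1, x) \<partial>\<pi> 1)"
    by (rule coupling_integral_le[OF \<Omega> \<mu> P1 adm(8) dual(2) c integrable_continuous_prob[OF P1 X c] dual(4)])
  then have "ereal ((\<Sum>l\<in>UNIV. \<integral>x. \<psi> l x \<partial>\<mu> l) - (\<integral>x. \<phi> (0, x) \<partial>p))
      \<le> ereal ((\<integral>x. \<phi> (1, x) \<partial>\<pi> 1) - (\<integral>x. \<phi> (0, x) \<partial>\<pi> 0))" by (simp add: adm(7))
  also have "\<dots> \<le> dynamical_cost L \<pi> m"
    by (rule dynamical_weak_duality[OF X adm(1-6) L dual(1,3)])
  finally show ?thesis .
qed

section \<open>Static Kantorovich duality\<close>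

text \<open>The source carries the product \<sigma>-algebra, the target the Borel sets of the vector
  space. Writing the vector as a finite sum of continuous axis embeddings of its coordinates avoids
  a comparison of the two.\<close>

lemma measurable_vec_lambda_PiM:
  fixes \<Omega> :: "(real ^ 'd) set" and \<mu> :: "'k::finite \<Rightarrow> (real ^ 'd) measure"
  assumes \<mu>: "\<And>l. \<mu> l \<in> prob_measures \<Omega>"
  shows "vec_lambda \<in> Pi\<^sub>M UNIV \<mu> \<rightarrow>\<^sub>M borel_on (vec_power \<Omega>)"
proof (rule measurable_restrict_space2)
  show "vec_lambda \<in> space (Pi\<^sub>M UNIV \<mu>) \<rightarrow> vec_power \<Omega>"
    using prob_measuresD(3)[OF \<mu>] by (auto simp: space_PiM vec_power_def)
  have id: "(\<lambda>x. x) \<in> borel_measurable (\<mu> l)" for l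
    by (rule borel_measurable_continuous_prob[OF \<mu>]) (rule continuous_on_id)
  have c: "(\<lambda>y. y l) \<in> borel_measurable (Pi\<^sub>M UNIV \<mu>)" for l
    using measurable_compose[OF measurable_component_singleton[of l UNIV \<mu>] id] by simp
  have ax: "continuous_on UNIV (axis l :: real ^ 'd \<Rightarrow> real ^ 'd ^ 'k)" for l
  proof -
    have "linear (axis l :: real ^ 'd \<Rightarrow> real ^ 'd ^ 'k)"
      by (rule linearI) (simp_all add: axis_def vec_eq_iff)
    then show ?thesis by (intro linear_continuous_on) (simp add: linear_conv_bounded_linear)
  qed
  have "(\<lambda>y. \<Sum>l\<in>UNIV. axis l (y l) :: real ^ 'd ^ 'k) \<in> borel_measurable (Pi\<^sub>M UNIV \<mu>)"
    by (intro borel_measurable_sum measurable_compose[OF c borel_measurable_continuous_onI[OF ax]])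
  moreover have "(\<Sum>l\<in>UNIV. axis l (y l)) = (vec_lambda y :: real ^ 'd ^ 'k)" for y
    by (simp add: vec_eq_iff axis_def)
  ultimately show "vec_lambda \<in> borel_measurable (Pi\<^sub>M UNIV \<mu>)" by simp
qed

lemma dist_vec_le_sum: "dist x y \<le> (\<Sum>l\<in>UNIV. dist (x $ l) (y $ l))"
  for x y :: "'a::metric_space ^ 'k::finite"
  unfolding dist_vec_def by (rule L2_set_le_sum) simp

text \<open>The linear program obtained by replacing \<open>\<mu> l\<close> by the masses of the cells of a fine
  partition has an optimal plan; spreading its weights with the product measure inside each cell gives
  a coupling with the exact marginals \<open>\<mu> l\<close>.\<close>

lemma kantorovich_approximate_duality:
  fixes \<Omega> :: "(real ^ 'd) set" and \<mu> :: "'k::finite \<Rightarrow> (real ^ 'd) measure"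
    and c :: "real ^ 'd ^ 'k \<Rightarrow> real"
  assumes \<Omega>: "compact \<Omega>" and \<mu>: "\<And>l. \<mu> l \<in> prob_measures \<Omega>"
    and X: "compact (vec_power \<Omega> :: (real ^ 'd ^ 'k) set)"
    and c: "continuous_on (vec_power \<Omega>) c" and e: "0 < e"
    and dual: "\<And>\<psi>. (\<And>l. integrable (\<mu> l) (\<psi> l)) \<Longrightarrow>
      (\<And>x. x \<in> vec_power \<Omega> \<Longrightarrow> (\<Sum>l\<in>UNIV. \<psi> l (x $ l)) \<le> c x) \<Longrightarrow>
      (\<Sum>l\<in>UNIV. \<integral>x. \<psi> l x \<partial>\<mu> l) \<le> V"
  obtains m where "m \<in> prob_measures (vec_power \<Omega>)"
    "\<And>l. distr m (borel_on \<Omega>) (\<lambda>x. x $ l) = \<mu> l" "(\<integral>x. c x \<partial>m) \<le> V + e"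
proof -
  have sp: "space (\<mu> l) = \<Omega>" and st: "sets (\<mu> l) = sets (borel_on \<Omega>)" and pr: "prob_space (\<mu> l)" for l
    using prob_measuresD[OF \<mu>] by auto
  let ?P = "Pi\<^sub>M UNIV \<mu>"
  interpret P: product_prob_space \<mu> UNIV by (rule product_prob_spaceI) (rule pr)
  obtain d where d: "0 < d"
    "\<And>x y. x \<in> vec_power \<Omega> \<Longrightarrow> y \<in> vec_power \<Omega> \<Longrightarrow> dist x y < d \<Longrightarrow> dist (c x) (c y) < e / 2"
  proof -
    have "uniformly_continuous_on (vec_power \<Omega>) c" by (rule compact_uniformly_continuous[OF c X])
    then show ?thesis using that e unfolding uniformly_continuous_on_def
      by (metis dist_commute half_gt_zero)
  qed
  define k where "k = real CARD('k)"
  have k: "0 < k" by (simp add: k_def)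
  \<comment> \<open>The distance of two vectors is at most the sum of \<open>k\<close> coordinate
    distances, so coordinate cells of mesh \<open>d / k\<close> keep it below
    \<open>d\<close>.\<close>
  then have "0 < d / k" using d(1) by simp
  from compact_small_partition[OF \<Omega> this] obtain idx :: "real ^ 'd \<Rightarrow> nat" and N ctr where
    idx: "idx \<in> borel_on \<Omega> \<rightarrow>\<^sub>M count_space UNIV" "\<And>x. x \<in> \<Omega> \<Longrightarrow> idx x < N"
    and ctr: "\<And>n. n < N \<Longrightarrow> ctr n \<in> \<Omega>" "\<And>x. x \<in> \<Omega> \<Longrightarrow> dist x (ctr (idx x)) < d / k" by blast
  define I where "I = Pi\<^sub>E (UNIV :: 'k set) (\<lambda>_. {..<N})"
  define J where "J = (UNIV :: 'k set) \<times> {..<N}"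
  have fin: "finite I" "finite J" by (auto simp: I_def J_def finite_PiE)
  define E where "E l n = {y \<in> space (\<mu> l). idx y = n}" for l n
  have E[measurable]: "E l n \<in> sets (\<mu> l)" for l n
  proof -
    have "idx \<in> \<mu> l \<rightarrow>\<^sub>M count_space UNIV" using idx(1) measurable_cong_sets[OF st refl] by blast
    then show ?thesis unfolding E_def by measurable
  qed
  define a where "a l n = measure (\<mu> l) (E l n)" for l n
  \<comment> \<open>Cell weights of the independent coupling, which serve as the feasible point that
    the linear program needs.\<close>
  define w where "w i = (\<Prod>l\<in>UNIV. a l (i l))" for i
  have a0: "0 \<le> a l n" for l n by (simp add: a_def)
  have split: "(\<Sum>n<N. measure (\<mu> l) (E l n \<inter> B)) = measure (\<mu> l) B" if B: "B \<in> sets (\<mu> l)" for l B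
  proof -
    have "measure (\<mu> l) (\<Union>n\<in>{..<N}. E l n \<inter> B) = (\<Sum>n<N. measure (\<mu> l) (E l n \<inter> B))"
      using B E by (intro P.M.finite_measure_finite_Union) (auto simp: disjoint_family_on_def E_def)
    moreover have "(\<Union>n\<in>{..<N}. E l n \<inter> B) = B"
      using sets.sets_into_space[OF B] idx(2) by (auto simp: E_def sp)
    ultimately show ?thesis by simp
  qed
  have a1: "(\<Sum>n<N. a l n) = 1" for l
  proof -
    have "E l n \<inter> space (\<mu> l) = E l n" for n by (auto simp: E_def)
    then show ?thesis using split[of "space (\<mu> l)" l] by (simp add: a_def P.M.prob_space)
  qed
  \<comment> \<open>Incidence of the multi-index \<open>i\<close> with a pair of a coordinate and a
    cell number; the constraint for \<open>j = (l, n)\<close> says that the \<open>l\<close>-th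
    marginal of the plan gives cell \<open>n\<close> the mass \<open>a l n\<close>.\<close>
  define A where "A i j = (if i (fst j) = snd j then 1 else 0 :: real)" for i :: "'k \<Rightarrow> nat" and j :: "'k \<times> nat"
  have sumJ: "(\<Sum>j\<in>J. f j * A i j) = (\<Sum>l\<in>UNIV. f (l, i l))" if "i \<in> I" for f :: "'k \<times> nat \<Rightarrow> real" and i
  proof -
    have "(\<Sum>j\<in>J. f j * A i j) = (\<Sum>l\<in>UNIV. \<Sum>n<N. f (l, n) * A i (l, n))"
      unfolding J_def by (rule sum.cartesian_product')
    also have "\<dots> = (\<Sum>l\<in>UNIV. f (l, i l))"
    proof (intro sum.cong refl)
      fix l
      have "(\<Sum>n<N. f (l, n) * A i (l, n)) = (\<Sum>n<N. if n = i l then f (l, n) else 0)"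
        by (intro sum.cong refl) (auto simp: A_def)
      also have "\<dots> = f (l, i l)" using that by (auto simp: I_def PiE_iff)
      finally show "(\<Sum>n<N. f (l, n) * A i (l, n)) = f (l, i l)" .
    qed
    finally show ?thesis .
  qed
  have w_sum: "(\<Sum>i\<in>I. w i * (\<Prod>l\<in>UNIV. f l (i l))) = (\<Prod>l\<in>UNIV. \<Sum>n<N. a l n * f l n)"
    for f :: "'k \<Rightarrow> nat \<Rightarrow> real"
    unfolding w_def I_def by (subst prod_sum_PiE) (auto simp: prod.distrib)
  \<comment> \<open>Lowering the centre value by \<open>e / 2\<close> puts \<open>C\<close> below
    \<open>c\<close> on the whole cell, so that discrete potentials remain feasible for
    \<open>c\<close>; the price is the gap \<open>e\<close> in the upper estimate.\<close>
  define C where "C i = c (\<chi> l. ctr (i l)) - e / 2" for i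
  have near: "C (\<lambda>l. idx (x $ l)) \<le> c x" "c x \<le> C (\<lambda>l. idx (x $ l)) + e"
    "(\<lambda>l. idx (x $ l)) \<in> I" if x: "x \<in> vec_power \<Omega>" for x
  proof -
    have xl: "x $ l \<in> \<Omega>" for l using x by (simp add: vec_power_def)
    let ?y = "\<chi> l. ctr (idx (x $ l))"
    have "dist x ?y \<le> (\<Sum>l\<in>UNIV. dist (x $ l) (ctr (idx (x $ l))))"
      using dist_vec_le_sum[of x ?y] by simp
    also have "\<dots> < (\<Sum>l\<in>(UNIV::'k set). d / k)" by (intro sum_strict_mono ctr(2) xl) auto
    also have "\<dots> = d" using k by (simp add: k_def)
    finally have "dist (c x) (c ?y) < e / 2"
      using x ctr(1) idx(2) xl by (intro d(2)) (auto simp: vec_power_def)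
    then show "C (\<lambda>l. idx (x $ l)) \<le> c x" "c x \<le> C (\<lambda>l. idx (x $ l)) + e"
      unfolding C_def dist_real_def by linarith+
    show "(\<lambda>l. idx (x $ l)) \<in> I" using idx(2) xl by (auto simp: I_def)
  qed
  have w0: "0 \<le> w i" for i unfolding w_def by (intro prod_nonneg ballI a0)
  have w1: "sum w I = 1" using w_sum[of "\<lambda>_ _. 1"] by (simp add: a1)
  have wA: "(\<Sum>i\<in>I. w i * A i j) = a (fst j) (snd j)" if "j \<in> J" for j
  proof -
    from that obtain l0 n0 where j: "j = (l0, n0)" "n0 < N" by (auto simp: J_def)
    define f where "f l n = (if l = l0 then (if n = n0 then 1 else 0) else 1 :: real)" for l n
    have "(\<Sum>i\<in>I. w i * A i j) = (\<Sum>i\<in>I. w i * (\<Prod>l\<in>UNIV. f l (i l)))"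
      by (intro sum.cong refl arg_cong2[where f="(*)"]) (simp add: A_def j f_def prod.delta)
    also have "\<dots> = (\<Prod>l\<in>UNIV. if l = l0 then a l0 n0 else 1)"
      unfolding w_sum[of f]
    proof (intro prod.cong refl)
      fix l
      have "(\<Sum>n<N. a l n * (if n = n0 then 1 else 0)) = (\<Sum>n<N. if n = n0 then a l n else 0)"
        by (intro sum.cong) auto
      then show "(\<Sum>n<N. a l n * f l n) = (if l = l0 then a l0 n0 else 1)"
        using j(2) by (cases "l = l0") (simp_all add: a1 f_def)
    qed
    also have "\<dots> = a (fst j) (snd j)" by (simp add: j)
    finally show ?thesis .
  qed
  have lp_dual: "(\<Sum>j\<in>J. u j * a (fst j) (snd j)) + k0 \<le> V"
    if u: "\<And>i. i \<in> I \<Longrightarrow> (\<Sum>j\<in>J. u j * A i j) + k0 \<le> C i" for u k0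
  proof -
    \<comment> \<open>Discrete potentials become functions constant on cells, the free constant
      \<open>k0\<close> being shared equally by the \<open>k\<close> coordinates.\<close>
    define \<psi> where "\<psi> l y = u (l, idx y) + k0 / k" for l y
    have \<psi>_eq: "\<psi> l y = (\<Sum>n<N. u (l, n) * indicat_real (E l n) y) + k0 / k" if "y \<in> space (\<mu> l)" for l y
    proof -
      have "(\<Sum>n<N. u (l, n) * indicat_real (E l n) y) = (\<Sum>n<N. if n = idx y then u (l, n) else 0)"
        using that by (intro sum.cong refl) (auto simp: E_def)
      also have "\<dots> = u (l, idx y)" using that idx(2) by (simp add: sp)
      finally show ?thesis by (simp add: \<psi>_def)
    qed
    have int: "integrable (\<mu> l) (\<lambda>y. (\<Sum>n<N. u (l, n) * indicat_real (E l n) y) + k0 / k)" for l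
    proof -
      show ?thesis using E by (intro Bochner_Integration.integrable_add Bochner_Integration.integrable_sum integrable_mult_right P.M.integrable_const
        integrable_real_indicator) (auto simp: less_top[symmetric])
    qed
    have "(\<Sum>l\<in>UNIV. \<integral>x. \<psi> l x \<partial>\<mu> l) \<le> V"
    proof (rule dual)
      show "integrable (\<mu> l) (\<psi> l)" for l
        using int by (subst Bochner_Integration.integrable_cong[OF refl \<psi>_eq]) auto
      fix x :: "real ^ 'd ^ 'k" assume x: "x \<in> vec_power \<Omega>"
      have "(\<Sum>l\<in>UNIV. \<psi> l (x $ l)) = (\<Sum>l\<in>UNIV. u (l, idx (x $ l))) + k0"
        using k by (simp add: \<psi>_def sum.distrib k_def)
      also have "\<dots> \<le> C (\<lambda>l. idx (x $ l))"
        using u[OF near(3)[OF x]] sumJ[OF near(3)[OF x]] by simp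
      finally show "(\<Sum>l\<in>UNIV. \<psi> l (x $ l)) \<le> c x" using near(1)[OF x] by linarith
    qed
    also have "(\<Sum>l\<in>UNIV. \<integral>x. \<psi> l x \<partial>\<mu> l) = (\<Sum>l\<in>UNIV. (\<Sum>n<N. u (l, n) * a l n) + k0 / k)"
    proof (intro sum.cong refl)
      fix l
      have i: "integrable (\<mu> l) (\<lambda>y. u (l, n) * indicat_real (E l n) y)" for n
        using E by (intro integrable_mult_right integrable_real_indicator) (auto simp: less_top[symmetric])
      have "(\<integral>x. \<psi> l x \<partial>\<mu> l) = (\<integral>y. (\<Sum>n<N. u (l, n) * indicat_real (E l n) y) + k0 / k \<partial>\<mu> l)"
        by (intro lebesgue_integral_cong \<psi>_eq)
      also have "\<dots> = (\<integral>y. (\<Sum>n<N. u (l, n) * indicat_real (E l n) y) \<partial>\<mu> l) + k0 / k"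
        by (subst Bochner_Integration.integral_add[OF Bochner_Integration.integrable_sum[OF i] P.M.integrable_const])
          (simp add: P.M.prob_space)
      also have "(\<integral>y. (\<Sum>n<N. u (l, n) * indicat_real (E l n) y) \<partial>\<mu> l) = (\<Sum>n<N. u (l, n) * a l n)"
        unfolding Bochner_Integration.integral_sum[OF i] using sets.sets_into_space[OF E]
        by (intro sum.cong refl) (simp add: a_def Int_absorb2)
      finally show "(\<integral>x. \<psi> l x \<partial>\<mu> l) = (\<Sum>n<N. u (l, n) * a l n) + k0 / k" .
    qed
    also have "\<dots> = (\<Sum>l\<in>UNIV. \<Sum>n<N. u (l, n) * a l n) + k0"
      using k by (simp add: sum.distrib k_def)
    also have "(\<Sum>l\<in>UNIV. \<Sum>n<N. u (l, n) * a l n) = (\<Sum>j\<in>J. u j * a (fst j) (snd j))"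
      unfolding J_def by (subst sum.cartesian_product') simp
    finally show ?thesis .
  qed
  have "\<exists>m. (\<forall>i\<in>I. 0 \<le> m i) \<and> sum m I = 1 \<and>
    (\<forall>j\<in>J. (\<Sum>i\<in>I. m i * A i j) = a (fst j) (snd j)) \<and> (\<Sum>i\<in>I. m i * C i) \<le> V"
    by (rule finite_lp_duality[OF fin w0 w1 wA lp_dual]) assumption+
  then obtain m where m: "\<And>i. i \<in> I \<Longrightarrow> 0 \<le> m i" "sum m I = 1"
    "\<And>j. j \<in> J \<Longrightarrow> (\<Sum>i\<in>I. m i * A i j) = a (fst j) (snd j)" "(\<Sum>i\<in>I. m i * C i) \<le> V"
    by blast
  have marg: "(\<Sum>i\<in>I. m i * h (i l)) = (\<Sum>n<N. h n * a l n)" for h :: "nat \<Rightarrow> real" and l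
  proof -
    have "(\<Sum>n<N. h n * a l n) = (\<Sum>n<N. \<Sum>i\<in>I. m i * (if i l = n then h n else 0))"
    proof (intro sum.cong refl)
      fix n assume "n \<in> {..<N}"
      then have "a l n = (\<Sum>i\<in>I. m i * A i (l, n))" using m(3)[of "(l, n)"] by (simp add: J_def)
      then show "h n * a l n = (\<Sum>i\<in>I. m i * (if i l = n then h n else 0))"
        by (simp add: sum_distrib_left A_def if_distrib mult_ac cong: if_cong)
    qed
    also have "\<dots> = (\<Sum>i\<in>I. \<Sum>n<N. m i * (if i l = n then h n else 0))" by (rule sum.swap)
    also have "\<dots> = (\<Sum>i\<in>I. m i * h (i l))"
    proof (intro sum.cong refl)
      fix i assume "i \<in> I"
      then have "i l < N" by (auto simp: I_def PiE_iff)
      have "(\<Sum>n<N. m i * (if i l = n then h n else 0)) = (\<Sum>n<N. if n = i l then m i * h n else 0)"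
        by (intro sum.cong) auto
      then show "(\<Sum>n<N. m i * (if i l = n then h n else 0)) = m i * h (i l)" using \<open>i l < N\<close> by simp
    qed
    finally show ?thesis by simp
  qed
  \<comment> \<open>A cell of zero product mass has a side of zero mass, and the marginal constraint
    forces the plan to vanish there. This makes the quotient \<open>m i / w i\<close> harmless when
    \<open>w i = 0\<close>.\<close>
  have zero: "m i = 0" if i: "i \<in> I" and z: "w i = 0" for i
  proof -
    obtain l where l: "a l (i l) = 0" using z by (auto simp: w_def)
    have "m i * 1 \<le> (\<Sum>i'\<in>I. m i' * (if i' l = i l then 1 else 0))"
      using member_le_sum[of i I "\<lambda>i'. m i' * (if i' l = i l then 1 else 0)"] fin m(1) i by simp
    also have "\<dots> = (\<Sum>n<N. (if n = i l then 1 else 0) * a l n)" by (rule marg)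
    also have "\<dots> = 0" using l by (intro sum.neutral) auto
    finally show ?thesis using m(1)[OF i] by simp
  qed
  define cell where "cell i = Pi\<^sub>E UNIV (\<lambda>l. E l (i l))" for i
  have cell[measurable]: "cell i \<in> sets ?P" for i unfolding cell_def using E by (intro sets_PiM_I_finite) auto
  define g where "g i = m i / w i" for i
  have g0: "0 \<le> g i" if "i \<in> I" for i
    unfolding g_def w_def by (intro divide_nonneg_nonneg m(1) that prod_nonneg ballI a0)
  \<comment> \<open>Given its cell, a point is distributed by the normalised product measure; the
    cell \<open>i\<close> itself has probability \<open>m i\<close>.\<close>
  define Q where "Q = density ?P (\<lambda>y. \<Sum>i\<in>I. ennreal (g i) * indicator (cell i) y)"
  have sQ: "sets Q = sets ?P" "space Q = space ?P" by (simp_all add: Q_def)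
  have emQ: "emeasure Q S = (\<Sum>i\<in>I. ennreal (g i * measure ?P (cell i \<inter> S)))" if [measurable]: "S \<in> sets ?P" for S
  proof -
    have "emeasure Q S = (\<integral>\<^sup>+y. (\<Sum>i\<in>I. ennreal (g i) * indicator (cell i) y) * indicator S y \<partial>?P)"
      unfolding Q_def by (intro emeasure_density) measurable
    also have "\<dots> = (\<integral>\<^sup>+y. (\<Sum>i\<in>I. ennreal (g i) * indicator (cell i \<inter> S) y) \<partial>?P)"
      by (intro nn_integral_cong) (simp add: sum_distrib_right indicator_inter_arith mult.assoc)
    also have "\<dots> = (\<Sum>i\<in>I. ennreal (g i) * emeasure ?P (cell i \<inter> S))"
      by (subst nn_integral_sum) (auto intro!: sum.cong nn_integral_cmult_indicator)
    also have "\<dots> = (\<Sum>i\<in>I. ennreal (g i * measure ?P (cell i \<inter> S)))"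
      by (intro sum.cong refl) (simp add: P.emeasure_eq_measure ennreal_mult g0)
    finally show ?thesis .
  qed
  have mP: "measure ?P (Pi\<^sub>E UNIV B) = (\<Prod>l\<in>UNIV. measure (\<mu> l) (B l))"
    if "\<And>l. B l \<in> sets (\<mu> l)" for B
  proof -
    have "emeasure ?P (Pi\<^sub>E UNIV B) = (\<Prod>l\<in>UNIV. emeasure (\<mu> l) (B l))"
      using that by (intro P.emeasure_PiM) auto
    also have "\<dots> = ennreal (\<Prod>l\<in>UNIV. measure (\<mu> l) (B l))"
      by (subst prod_ennreal[symmetric]) (auto simp: finite_measure.emeasure_eq_measure[OF prob_space.finite_measure[OF pr]])
    finally show ?thesis by (simp add: measure_def prod_nonneg)
  qed
  \<comment> \<open>Inside a cell the \<open>l\<close>-th coordinate follows \<open>\<mu> l\<close>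
    conditioned on \<open>E l (i l)\<close>. The plan weights of all cells with
    \<open>i l = n\<close> add up to \<open>a l n\<close>, which undoes the conditioning.\<close>
  have Qmarg: "emeasure Q {y \<in> space ?P. y l \<in> B} = emeasure (\<mu> l) B" if B[measurable]: "B \<in> sets (\<mu> l)" for l B
  proof -
    have S: "{y \<in> space ?P. y l \<in> B} \<in> sets ?P" by measurable
    define b where "b n = measure (\<mu> l) (E l n \<inter> B)" for n
    have b0: "b n = 0" if "a l n = 0" for n
    proof -
      have "b n \<le> a l n" unfolding a_def b_def by (intro P.M.finite_measure_mono) (use E in auto)
      then show ?thesis using that by (simp add: b_def measure_le_0_iff)
    qed
    have summand: "g i * measure ?P (cell i \<inter> {y \<in> space ?P. y l \<in> B}) = m i * (b (i l) / a l (i l))" if i: "i \<in> I" for i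
    proof (cases "w i = 0")
      case True
      then show ?thesis using zero[OF i] by (simp add: g_def)
    next
      case False
      let ?r = "\<Prod>l'\<in>UNIV - {l}. a l' (i l')"
      have w: "w i = a l (i l) * ?r" unfolding w_def by (rule prod.remove) auto
      have "cell i \<inter> {y \<in> space ?P. y l \<in> B} = Pi\<^sub>E UNIV (\<lambda>l'. if l' = l then E l (i l) \<inter> B else E l' (i l'))"
        by (auto simp: cell_def PiE_iff space_PiM E_def split: if_splits)
      then have "measure ?P (cell i \<inter> {y \<in> space ?P. y l \<in> B})
          = (\<Prod>l'\<in>UNIV. measure (\<mu> l') (if l' = l then E l (i l) \<inter> B else E l' (i l')))"
        using E B by (simp only:) (rule mP, auto)
      also have "\<dots> = b (i l) * (\<Prod>l'\<in>UNIV - {l}. measure (\<mu> l') (if l' = l then E l (i l) \<inter> B else E l' (i l')))"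
        by (subst prod.remove[of UNIV l]) (auto simp: b_def)
      also have "(\<Prod>l'\<in>UNIV - {l}. measure (\<mu> l') (if l' = l then E l (i l) \<inter> B else E l' (i l'))) = ?r"
        by (intro prod.cong) (auto simp: a_def)
      finally show ?thesis using False w by (simp add: g_def)
    qed
    have "emeasure Q {y \<in> space ?P. y l \<in> B} = (\<Sum>i\<in>I. ennreal (m i * (b (i l) / a l (i l))))"
      unfolding emQ[OF S] using summand by (intro sum.cong) auto
    also have "\<dots> = ennreal (\<Sum>i\<in>I. m i * (b (i l) / a l (i l)))"
      by (intro sum_ennreal mult_nonneg_nonneg divide_nonneg_nonneg m(1) a0) (simp_all add: b_def)
    also have "(\<Sum>i\<in>I. m i * (b (i l) / a l (i l))) = (\<Sum>n<N. b n / a l n * a l n)"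
      by (rule marg)
    also have "\<dots> = (\<Sum>n<N. b n)" using b0 by (intro sum.cong) auto
    also have "\<dots> = measure (\<mu> l) B" unfolding b_def by (rule split[OF B])
    also have "ennreal (measure (\<mu> l) B) = emeasure (\<mu> l) B"
      using finite_measure.emeasure_eq_measure[OF prob_space.finite_measure[OF pr]] by simp
    finally show ?thesis .
  qed
  have Q: "prob_space Q"
  proof
    fix l0 :: 'k
    have "{y \<in> space ?P. y l0 \<in> space (\<mu> l0)} = space Q" by (auto simp: sQ space_PiM)
    then show "emeasure Q (space Q) = 1"
      using Qmarg[of "space (\<mu> l0)" l0] prob_space.emeasure_space_1[OF pr[of l0]] by simp
  qed
  interpret Q: prob_space Q by (rule Q)
  define G where "G = distr Q (borel_on (vec_power \<Omega>)) (vec_lambda :: _ \<Rightarrow> real ^ 'd ^ 'k)"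
  have vl: "vec_lambda \<in> Q \<rightarrow>\<^sub>M borel_on (vec_power \<Omega>)"
    using measurable_vec_lambda_PiM[of \<mu> \<Omega>, OF \<mu>] measurable_cong_sets[OF sQ(1) refl] by blast
  have G: "G \<in> prob_measures (vec_power \<Omega>)"
    unfolding G_def by (intro prob_measuresI Q.prob_space_distr vl) simp
  have vn: "(\<lambda>x. x $ l) \<in> borel_on (vec_power \<Omega>) \<rightarrow>\<^sub>M borel_on \<Omega>" for l :: 'k
    by (rule measurable_vec_nth_borel_on)
  have "distr G (borel_on \<Omega>) (\<lambda>x. x $ l) = \<mu> l" for l
  proof (rule measure_eqI)
    show "sets (distr G (borel_on \<Omega>) (\<lambda>x. x $ l)) = sets (\<mu> l)" by (simp add: st)
    fix B assume "B \<in> sets (distr G (borel_on \<Omega>) (\<lambda>x. x $ l))"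
    then have B: "B \<in> sets (borel_on \<Omega>)" by simp
    have "distr G (borel_on \<Omega>) (\<lambda>x. x $ l) = distr Q (borel_on \<Omega>) (\<lambda>y. y l)"
      unfolding G_def by (subst distr_distr[OF vn vl]) (simp add: o_def)
    moreover have "(\<lambda>y. y l) \<in> Q \<rightarrow>\<^sub>M borel_on \<Omega>"
      using measurable_compose[OF vl vn, of l] by simp
    ultimately have "emeasure (distr G (borel_on \<Omega>) (\<lambda>x. x $ l)) B = emeasure Q ((\<lambda>y. y l) -` B \<inter> space Q)"
      using B by (simp add: emeasure_distr)
    also have "(\<lambda>y. y l) -` B \<inter> space Q = {y \<in> space ?P. y l \<in> B}" by (auto simp: sQ)
    also have "emeasure Q \<dots> = emeasure (\<mu> l) B" using B by (intro Qmarg) (simp add: st)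
    finally show "emeasure (distr G (borel_on \<Omega>) (\<lambda>x. x $ l)) B = emeasure (\<mu> l) B" .
  qed
  moreover have "(\<integral>x. c x \<partial>G) \<le> V + e"
  proof -
    have cm: "c \<in> borel_measurable (borel_on (vec_power \<Omega>))"
      by (rule borel_measurable_continuous_on_restrict[OF c])
    have "(\<integral>x. c x \<partial>G) = (\<integral>y. c (vec_lambda y) \<partial>Q)"
      unfolding G_def by (rule integral_distr[OF vl cm])
    also have "\<dots> \<le> (\<integral>y. (\<Sum>i\<in>I. C i * indicat_real (cell i) y) + e \<partial>Q)"
    proof (rule integral_mono)
      show "integrable Q (\<lambda>y. c (vec_lambda y))"
        using integrable_continuous_prob[OF G X c] unfolding G_def by (rule integrable_distr[OF vl])
      show "integrable Q (\<lambda>y. (\<Sum>i\<in>I. C i * indicat_real (cell i) y) + e)"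
        using cell by (intro Bochner_Integration.integrable_add Bochner_Integration.integrable_sum
            integrable_mult_right integrable_real_indicator Q.integrable_const) (auto simp: sQ Q.emeasure_eq_measure)
      fix y assume "y \<in> space Q"
      then have y: "y l \<in> \<Omega>" for l by (auto simp: sQ space_PiM sp)
      then have x: "vec_lambda y \<in> vec_power \<Omega>" by (simp add: vec_power_def)
      have ind: "indicat_real (cell i) y = (if i = (\<lambda>l. idx (y l)) then 1 else 0)" for i
        using y by (auto simp: cell_def E_def sp indicator_def fun_eq_iff PiE_iff) metis
      have "(\<Sum>i\<in>I. C i * indicat_real (cell i) y) = (\<Sum>i\<in>I. if i = (\<lambda>l. idx (y l)) then C i else 0)"
        by (intro sum.cong refl) (simp add: ind)
      also have "\<dots> = C (\<lambda>l. idx (y l))"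
        using near(3)[OF x] fin by simp
      finally have "(\<Sum>i\<in>I. C i * indicat_real (cell i) y) = C (\<lambda>l. idx (y l))" .
      then show "c (vec_lambda y) \<le> (\<Sum>i\<in>I. C i * indicat_real (cell i) y) + e"
        using near(2)[OF x] by simp
    qed
    also have "\<dots> = (\<Sum>i\<in>I. C i * measure Q (cell i)) + e"
    proof -
      have i: "integrable Q (\<lambda>y. C i * indicat_real (cell i) y)" for i
        using cell by (intro integrable_mult_right integrable_real_indicator) (auto simp: sQ Q.emeasure_eq_measure)
      have "cell i \<inter> space Q = cell i" for i using sets.sets_into_space[OF cell[of i]] by (auto simp: sQ)
      then show ?thesis using i by (simp add: Q.prob_space)
    qed
    also have "(\<Sum>i\<in>I. C i * measure Q (cell i)) = (\<Sum>i\<in>I. m i * C i)"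
    proof (intro sum.cong refl)
      fix i assume i: "i \<in> I"
      have disj: "cell i' \<inter> cell i = {}" if "i' \<noteq> i" for i'
        using that by (fastforce simp: cell_def E_def PiE_iff fun_eq_iff)
      have "measure ?P (cell i) = w i" unfolding cell_def w_def a_def by (rule mP) (rule E)
      moreover have "emeasure Q (cell i) = (\<Sum>i'\<in>I. if i' = i then ennreal (g i * measure ?P (cell i)) else 0)"
        unfolding emQ[OF cell] by (intro sum.cong refl) (auto simp: disj)
      ultimately have "emeasure Q (cell i) = ennreal (g i * w i)" using i fin by simp
      then have "measure Q (cell i) = g i * w i"
        by (simp add: measure_def g0 i w_def prod_nonneg a0)
      also have "\<dots> = m i" using zero[OF i] by (cases "w i = 0") (auto simp: g_def)
      finally show "C i * measure Q (cell i) = m i * C i" by simp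
    qed
    finally show ?thesis using m(4) by linarith
  qed
  ultimately show thesis using that G by blast
qed

section \<open>Straight-line interpolation\<close>

text \<open>Reduces to the one-dimensional tangent inequality on the line through \<open>v\<close>
  and \<open>w\<close>.\<close>

lemma convex_GDERIV_above_tangent:
  fixes L :: "'a::real_inner \<Rightarrow> real"
  assumes L: "convex_on UNIV L" and D: "GDERIV L v :> D"
  shows "L v + (w - v) \<bullet> D \<le> L w"
proof -
  define h where "h s = L (v + s *\<^sub>R (w - v))" for s
  have "convex_on UNIV h"
  proof (rule convex_onI)
    fix t x y :: real assume "0 < t" "t < 1"
    have "v + ((1 - t) *\<^sub>R x + t *\<^sub>R y) *\<^sub>R (w - v)
        = (1 - t) *\<^sub>R (v + x *\<^sub>R (w - v)) + t *\<^sub>R (v + y *\<^sub>R (w - v))"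
      by (simp add: algebra_simps)
    then show "h ((1 - t) *\<^sub>R x + t *\<^sub>R y) \<le> (1 - t) * h x + t * h y"
      unfolding h_def using convex_onD[OF L, of t] \<open>0 < t\<close> \<open>t < 1\<close> by simp
  qed simp
  moreover have "(h has_field_derivative ((w - v) \<bullet> D)) (at 0)"
  proof -
    have D': "(L has_derivative (\<lambda>h. h \<bullet> D)) (at (v + 0 *\<^sub>R (w - v)))" using D by (simp add: gderiv_def)
    have "(h has_derivative (\<lambda>s. (s *\<^sub>R (w - v)) \<bullet> D)) (at 0)"
      unfolding h_def
      by (rule has_derivative_eq_rhs[OF has_derivative_compose[where f="\<lambda>s. v + s *\<^sub>R (w - v)", OF _ D']])
        (auto intro!: derivative_eq_intros)
    then show ?thesis by (simp add: has_field_derivative_def mult_commute_abs)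
  qed
  ultimately have "((w - v) \<bullet> D) * (1 - 0) \<le> h 1 - h 0"
    by (intro convex_on_imp_above_tangent[where A=UNIV]) auto
  then show ?thesis by (simp add: h_def)
qed

text \<open>\<open>vw\<close> says that \<open>v\<close> composed with \<open>T\<close> is the
  conditional expectation of \<open>w\<close> given \<open>T\<close>. Testing by indicators is
  extended to bounded functions \<open>g\<close> through simple functions.\<close>

lemma integral_inner_transfer:
  fixes g v :: "'a \<Rightarrow> 'b::euclidean_space" and w :: "'c \<Rightarrow> 'b"
  assumes T[measurable]: "T \<in> N \<rightarrow>\<^sub>M M" and M: "M = distr N M T"
    and v: "integrable M v" and w: "integrable N w"
    and vw: "\<And>A. A \<in> sets M \<Longrightarrow> set_lebesgue_integral M A v = (\<integral>y. indicat_real A (T y) *\<^sub>R w y \<partial>N)"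
    and g[measurable]: "g \<in> borel_measurable M" and bd: "AE x in M. norm (g x) \<le> C"
  shows "(\<integral>x. g x \<bullet> v x \<partial>M) = (\<integral>y. g (T y) \<bullet> w y \<partial>N)"
proof -
  have [measurable]: "v \<in> borel_measurable M" "w \<in> borel_measurable N" using v w by auto
  \<comment> \<open>The approximants are dominated by twice the norm of \<open>g\<close>, which is
    the origin of the factor \<open>2\<close> in the majorants below.\<close>
  obtain F where F: "\<And>i. simple_function M (F i)" "\<And>x. x \<in> space M \<Longrightarrow> (\<lambda>i. F i x) \<longlonglongrightarrow> g x"
    "\<And>i x. x \<in> space M \<Longrightarrow> dist (F i x) 0 \<le> 2 * dist (g x) 0"
    using borel_measurable_implies_sequence_metric[OF g, of 0] by blast
  have [measurable]: "F i \<in> borel_measurable M" for i using F(1) by (rule borel_measurable_simple_function)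
  have bound: "norm (F i x \<bullet> b) \<le> 2 * C * norm b" if "x \<in> space M" "norm (g x) \<le> C" for i x b
    using F(3)[OF that(1), of i] that(2) by (simp add: abs_inner_le)
  have Tsp: "T y \<in> space M" if "y \<in> space N" for y using measurable_space[OF T that] .
  have bd': "AE y in N. norm (g (T y)) \<le> C" using bd by (subst (asm) M) (rule AE_distrD[OF T])
  have eq: "(\<integral>x. F i x \<bullet> v x \<partial>M) = (\<integral>y. F i (T y) \<bullet> w y \<partial>N)" for i
  proof -
    define S where "S = F i ` space M"
    have S: "finite S" unfolding S_def using F(1) by (rule simple_functionD)
    define A where "A s = F i -` {s} \<inter> space M" for s
    have A[measurable]: "A s \<in> sets M" for s unfolding A_def using F(1) by (rule simple_functionD)
    have dec: "(\<Sum>s\<in>S. s \<bullet> (indicat_real (A s) x *\<^sub>R u)) = F i x \<bullet> u" if x: "x \<in> space M" for x u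
    proof -
      have "(\<Sum>s\<in>S. s \<bullet> (indicat_real (A s) x *\<^sub>R u)) = (\<Sum>s\<in>S. if s = F i x then s \<bullet> u else 0)"
        by (intro sum.cong refl) (use x in \<open>auto simp: A_def\<close>)
      then show ?thesis using S x by (simp add: S_def)
    qed
    have i1: "integrable M (\<lambda>x. indicat_real (A s) x *\<^sub>R v x)" for s
      by (rule integrable_mult_indicator[OF A v])
    have i2: "integrable N (\<lambda>y. indicat_real (A s) (T y) *\<^sub>R w y)" for s
      by (rule Bochner_Integration.integrable_bound[OF w]) (auto split: split_indicator)
    have "(\<integral>x. F i x \<bullet> v x \<partial>M) = (\<integral>x. (\<Sum>s\<in>S. s \<bullet> (indicat_real (A s) x *\<^sub>R v x)) \<partial>M)"
      by (intro lebesgue_integral_cong dec[symmetric])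
    also have "\<dots> = (\<Sum>s\<in>S. s \<bullet> (\<integral>x. indicat_real (A s) x *\<^sub>R v x \<partial>M))"
      by (subst Bochner_Integration.integral_sum) (rule integrable_inner_right[OF i1], simp only: integral_inner_right[OF i1])
    also have "\<dots> = (\<Sum>s\<in>S. s \<bullet> (\<integral>y. indicat_real (A s) (T y) *\<^sub>R w y \<partial>N))"
      using vw[OF A] by (simp add: set_lebesgue_integral_def)
    also have "\<dots> = (\<integral>y. (\<Sum>s\<in>S. s \<bullet> (indicat_real (A s) (T y) *\<^sub>R w y)) \<partial>N)"
      by (subst Bochner_Integration.integral_sum) (rule integrable_inner_right[OF i2], simp only: integral_inner_right[OF i2])
    also have "\<dots> = (\<integral>y. F i (T y) \<bullet> w y \<partial>N)"
      by (intro lebesgue_integral_cong dec Tsp)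
    finally show ?thesis .
  qed
  have "(\<lambda>i. \<integral>x. F i x \<bullet> v x \<partial>M) \<longlonglongrightarrow> (\<integral>x. g x \<bullet> v x \<partial>M)"
  proof (rule integral_dominated_convergence[where w="\<lambda>x. 2 * C * norm (v x)"])
    show "AE x in M. norm (F i x \<bullet> v x) \<le> 2 * C * norm (v x)" for i
      using bd by (rule AE_mp) (use bound in \<open>auto intro!: AE_I2\<close>)
  qed (use v F(2) in \<open>auto intro!: AE_I2 tendsto_inner\<close>)
  moreover have "(\<lambda>i. \<integral>y. F i (T y) \<bullet> w y \<partial>N) \<longlonglongrightarrow> (\<integral>y. g (T y) \<bullet> w y \<partial>N)"
  proof (rule integral_dominated_convergence[where w="\<lambda>y. 2 * C * norm (w y)"])
    show "AE y in N. norm (F i (T y) \<bullet> w y) \<le> 2 * C * norm (w y)" for i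
      using bd' by (rule AE_mp) (use bound Tsp in \<open>auto intro!: AE_I2\<close>)
  qed (use w F(2) Tsp in \<open>auto intro!: AE_I2 tendsto_inner\<close>)
  ultimately show ?thesis unfolding eq by (rule LIMSEQ_unique)
qed

text \<open>Conditional expectations stay in any closed half-space that contains the values of
  \<open>w\<close>. On the violating set \<open>A\<close> the integral of
  \<open>v x \<bullet> u - R\<close> is at most \<open>0\<close> although the integrand is positive
  there, so \<open>A\<close> is null.\<close>

lemma AE_inner_le_of_integral:
  fixes v :: "'a \<Rightarrow> 'b::euclidean_space" and w :: "'c \<Rightarrow> 'b"
  assumes T[measurable]: "T \<in> N \<rightarrow>\<^sub>M M" and M: "M = distr N M T" and N: "prob_space N"
    and v: "integrable M v" and w: "integrable N w"
    and vw: "\<And>A. A \<in> sets M \<Longrightarrow> set_lebesgue_integral M A v = (\<integral>y. indicat_real A (T y) *\<^sub>R w y \<partial>N)"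
    and bd: "\<And>y. y \<in> space N \<Longrightarrow> w y \<bullet> u \<le> R"
  shows "AE x in M. v x \<bullet> u \<le> R"
proof -
  interpret N: prob_space N by fact
  have [measurable]: "v \<in> borel_measurable M" "w \<in> borel_measurable N" using v w by auto
  have "prob_space M" using N.prob_space_distr[OF T] M by simp
  then interpret M: prob_space M .
  define A where "A = {x \<in> space M. R < v x \<bullet> u}"
  have A[measurable]: "A \<in> sets M" unfolding A_def by measurable
  have i1: "integrable M (\<lambda>x. (indicat_real A x *\<^sub>R u) \<bullet> v x)"
    by (rule integrable_inner_bounded[OF v, of _ "norm u"]) (auto split: split_indicator)
  have i2: "integrable N (\<lambda>y. (indicat_real A (T y) *\<^sub>R u) \<bullet> w y)"
    by (rule integrable_inner_bounded[OF w, of _ "norm u"]) (auto split: split_indicator)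
  have i3: "integrable M (indicat_real A)" by (simp add: M.emeasure_eq_measure)
  have i4: "integrable N (\<lambda>y. indicat_real A (T y))"
    by (rule N.integrable_const_bound[of _ 1]) (auto split: split_indicator)
  have eq: "indicat_real A x * (v x \<bullet> u - R) = (indicat_real A x *\<^sub>R u) \<bullet> v x - indicat_real A x * R" for x
    by (simp add: algebra_simps inner_commute)
  have "(\<integral>x. (indicat_real A x *\<^sub>R u) \<bullet> v x \<partial>M) = (\<integral>y. (indicat_real A (T y) *\<^sub>R u) \<bullet> w y \<partial>N)"
    by (rule integral_inner_transfer[OF T M v w vw, where C="norm u"]) (auto split: split_indicator)
  also have "\<dots> \<le> (\<integral>y. indicat_real A (T y) * R \<partial>N)"
    using bd by (intro integral_mono i2 integrable_mult_left i4)
      (auto simp: inner_commute split: split_indicator)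
  also have "\<dots> = (\<integral>x. indicat_real A x * R \<partial>M)" by (subst M, subst integral_distr) auto
  finally have le: "(\<integral>x. indicat_real A x * (v x \<bullet> u - R) \<partial>M) \<le> 0"
    unfolding eq Bochner_Integration.integral_diff[OF i1 integrable_mult_left[OF i3]] by simp
  have i: "integrable M (\<lambda>x. indicat_real A x * (v x \<bullet> u - R))"
    unfolding eq by (intro Bochner_Integration.integrable_diff i1 integrable_mult_left i3)
  have nn: "AE x in M. 0 \<le> indicat_real A x * (v x \<bullet> u - R)"
    by (auto simp: A_def split: split_indicator)
  have "(\<integral>x. indicat_real A x * (v x \<bullet> u - R) \<partial>M) = 0"
    using le integral_nonneg_AE[OF nn] by simp
  then have "AE x in M. indicat_real A x * (v x \<bullet> u - R) = 0"
    using integral_nonneg_eq_0_iff_AE[OF i nn] by simp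
  then show ?thesis by (rule AE_mp) (auto simp: A_def split: split_indicator intro!: AE_I2)
qed

lemma (in pair_prob_space) distr_pair_snd: "distr (M1 \<Otimes>\<^sub>M M2) M2 snd = M2"
proof (rule measure_eqI)
  fix A assume "A \<in> sets (distr (M1 \<Otimes>\<^sub>M M2) M2 snd)"
  then have A[measurable]: "A \<in> sets M2" by simp
  have "snd -` A \<inter> space (M1 \<Otimes>\<^sub>M M2) = space M1 \<times> A"
    using sets.sets_into_space[OF A] by (auto simp: space_pair_measure)
  then show "emeasure (distr (M1 \<Otimes>\<^sub>M M2) M2 snd) A = emeasure M2 A"
    by (simp add: emeasure_distr M2.emeasure_pair_measure_Times M1.emeasure_space_1)
qed simp

section \<open>The curve obtained by moving mass along segments\<close>

locale linear_interpolation =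
  fixes X :: "'a::euclidean_space set" and p q :: "'a measure"
  assumes compact: "compact X" and convex: "convex X"
    and p: "p \<in> prob_measures X" and q: "q \<in> prob_measures X"
begin

sublocale pq: pair_prob_space p q
  using prob_measuresD(1)[OF p] prob_measuresD(1)[OF q]
  by (simp add: pair_prob_space_def pair_sigma_finite_def prob_space_imp_sigma_finite)

abbreviation PQ :: "('a \<times> 'a) measure" where
  "PQ \<equiv> p \<Otimes>\<^sub>M q"

definition pt :: "real \<Rightarrow> 'a \<times> 'a \<Rightarrow> 'a" where
  "pt t y = (1 - t) *\<^sub>R fst y + t *\<^sub>R snd y"

definition vel :: "'a \<times> 'a \<Rightarrow> 'a" where
  "vel y = snd y - fst y"

definition curve :: "real \<Rightarrow> 'a measure" where
  "curve t = distr PQ (borel_on X) (pt t)"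

text \<open>The image under \<open>pt t\<close> of the vector measure with density
  \<open>vel\<close>. Segments that meet at time \<open>t\<close> contribute the mean of their
  velocities, so the velocity field is the conditional expectation of \<open>vel\<close> given
  \<open>pt t\<close>, not an explicit function.\<close>

definition momentum :: "real \<Rightarrow> 'a set \<Rightarrow> 'a" where
  "momentum t A = (\<integral>y. indicat_real A (pt t y) *\<^sub>R vel y \<partial>PQ)"

lemma space_pq: "space PQ = X \<times> X"
  by (simp add: space_pair_measure prob_measuresD(3)[OF p] prob_measuresD(3)[OF q])

lemma pt_in: "t \<in> {0..1} \<Longrightarrow> y \<in> X \<times> X \<Longrightarrow> pt t y \<in> X"
  unfolding pt_def using convex by (auto intro!: convexD)

lemma measurable_fst_snd:
  "fst \<in> borel_measurable PQ" "snd \<in> borel_measurable PQ"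
proof -
  have "(\<lambda>x. x) \<in> borel_measurable p" "(\<lambda>x. x) \<in> borel_measurable q"
    using borel_measurable_continuous_prob[OF p continuous_on_id]
      borel_measurable_continuous_prob[OF q continuous_on_id] by auto
  from measurable_compose[OF measurable_fst[of p q] this(1)] measurable_compose[OF measurable_snd[of p q] this(2)]
  show "fst \<in> borel_measurable PQ" "snd \<in> borel_measurable PQ" by simp_all
qed

lemma measurable_vel[measurable]: "vel \<in> borel_measurable PQ"
  unfolding vel_def[abs_def] by (intro borel_measurable_diff measurable_fst_snd)

lemma measurable_pt:
  assumes "t \<in> {0..1}"
  shows "pt t \<in> PQ \<rightarrow>\<^sub>M borel_on X"
proof (rule measurable_restrict_space2)
  show "pt t \<in> space PQ \<rightarrow> X" using pt_in[OF assms] by (auto simp: space_pq)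
  show "pt t \<in> borel_measurable PQ"
    unfolding pt_def[abs_def]
    by (intro borel_measurable_add borel_measurable_scaleR borel_measurable_const measurable_fst_snd)
qed

text \<open>Joint measurability in time and endpoints, on which the Fubini arguments over
  \<open>unit_lborel\<close> and \<open>PQ\<close> rest.\<close>

lemma measurable_time_pt:
  "(\<lambda>z. (fst z, pt (fst z) (snd z))) \<in> unit_lborel \<Otimes>\<^sub>M PQ \<rightarrow>\<^sub>M borel_on ({0..1} \<times> X)"
proof (rule measurable_restrict_space2)
  show "(\<lambda>z. (fst z, pt (fst z) (snd z))) \<in> space (unit_lborel \<Otimes>\<^sub>M PQ) \<rightarrow> {0..1} \<times> X"
    using pt_in by (auto simp: space_pair_measure[of unit_lborel] space_pq space_unit_lborel)
  have "(\<lambda>t. t) \<in> borel_measurable unit_lborel"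
    by (rule borel_measurable_unit_lborel) (rule continuous_on_id)
  from measurable_compose[OF measurable_fst[of unit_lborel PQ] this]
  have t: "fst \<in> borel_measurable (unit_lborel \<Otimes>\<^sub>M PQ)" by simp
  have "(\<lambda>z. pt (fst z) (snd z)) \<in> borel_measurable (unit_lborel \<Otimes>\<^sub>M PQ)"
    unfolding pt_def
    by (intro borel_measurable_add borel_measurable_scaleR borel_measurable_diff borel_measurable_const t
        measurable_compose[OF measurable_snd measurable_fst_snd(1)]
        measurable_compose[OF measurable_snd measurable_fst_snd(2)])
  with t show "(\<lambda>z. (fst z, pt (fst z) (snd z))) \<in> borel_measurable (unit_lborel \<Otimes>\<^sub>M PQ)"
    by (intro borel_measurable_Pair)
qed

lemma curve_prob: "t \<in> {0..1} \<Longrightarrow> curve t \<in> prob_measures X"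
  unfolding curve_def by (intro prob_measuresI pq.P.prob_space_distr measurable_pt) auto

lemma sets_curve: "sets (curve t) = sets (borel_on X)" and space_curve: "space (curve t) = X"
  by (simp_all add: curve_def space_restrict_space)

lemma vel_bounded:
  obtains R where "0 \<le> R" "\<And>y. y \<in> X \<times> X \<Longrightarrow> norm (vel y) \<le> R"
proof -
  have "continuous_on (X \<times> X) vel" unfolding vel_def[abs_def] by (intro continuous_intros)
  from continuous_on_compact_bound[OF compact_Times[OF compact compact] this] show thesis
    using that by blast
qed

lemma integrable_vel: "integrable PQ vel"
proof -
  obtain R where "\<And>y. y \<in> X \<times> X \<Longrightarrow> norm (vel y) \<le> R" using vel_bounded by blast
  then show ?thesis
    by (intro pq.P.integrable_const_bound[of _ R]) (auto simp: space_pq intro!: AE_I2)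
qed

text \<open>Continuity into a generated topology is checked on the generating sets, where it amounts
  to continuity in \<open>t\<close> of the integral of \<open>f (pt t y)\<close>, a case of
  dominated convergence.\<close>

lemma curve_in_prob_curves: "curve \<in> prob_curves X"
  unfolding prob_curves_def weak_topology_on_def
proof (rule CollectI, rule continuous_on_generated_topo)
  let ?S = "{{\<mu> \<in> prob_measures X. (\<integral>x. f x \<partial>\<mu>) \<in> U} | (f :: 'a \<Rightarrow> real) U.
        continuous_on X f \<and> bounded (f ` X) \<and> open U}"
  \<comment> \<open>The zero test function with \<open>U = UNIV\<close> shows that the generating
    sets cover all of \<open>prob_measures X\<close>.\<close>
  have "{\<mu> \<in> prob_measures X. (\<integral>x. (\<lambda>_. 0 :: real) x \<partial>\<mu>) \<in> UNIV} \<in> ?S"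
    by (intro CollectI exI[of _ "\<lambda>_. 0"] exI[of _ UNIV]) (auto simp: bounded_iff)
  then have "prob_measures X \<subseteq> \<Union> ?S" by auto
  then show "curve ` topspace (top_of_set {0..1}) \<subseteq> \<Union> ?S" using curve_prob by auto
  fix S assume "S \<in> ?S"
  then obtain f :: "'a \<Rightarrow> real" and U where S: "S = {\<mu> \<in> prob_measures X. (\<integral>x. f x \<partial>\<mu>) \<in> U}"
    and f: "continuous_on X f" "bounded (f ` X)" "open U" by blast
  have fm: "f \<in> borel_measurable (borel_on X)" by (rule borel_measurable_continuous_on_restrict[OF f(1)])
  obtain C where C: "\<And>x. x \<in> X \<Longrightarrow> norm (f x) \<le> C" using f(2) by (auto simp: bounded_iff)
  have "continuous_on {0..1} (\<lambda>t. \<integral>y. f (pt t y) \<partial>PQ)"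
  proof (rule continuous_on_sequentiallyI)
    fix u :: "nat \<Rightarrow> real" and t assume u: "\<forall>n. u n \<in> {0..1}" "t \<in> {0..1}" "u \<longlonglongrightarrow> t"
    show "(\<lambda>n. \<integral>y. f (pt (u n) y) \<partial>PQ) \<longlonglongrightarrow> (\<integral>y. f (pt t y) \<partial>PQ)"
    proof (rule integral_dominated_convergence[where w="\<lambda>_. C"])
      show "(\<lambda>y. f (pt t y)) \<in> borel_measurable PQ"
        by (rule measurable_compose[OF measurable_pt[OF u(2)] fm])
      show "(\<lambda>y. f (pt (u n) y)) \<in> borel_measurable PQ" for n
        by (rule measurable_compose[OF measurable_pt fm]) (use u in auto)
      show "AE y in PQ. norm (f (pt (u n) y)) \<le> C" for n
        using u by (intro AE_I2 C pt_in) (auto simp: space_pq)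
      show "AE y in PQ. (\<lambda>n. f (pt (u n) y)) \<longlonglongrightarrow> f (pt t y)"
      proof (rule AE_I2)
        fix y assume "y \<in> space PQ"
        then have y: "y \<in> X \<times> X" by (simp add: space_pq)
        have "(\<lambda>n. pt (u n) y) \<longlonglongrightarrow> pt t y" unfolding pt_def by (intro tendsto_intros u)
        then show "(\<lambda>n. f (pt (u n) y)) \<longlonglongrightarrow> f (pt t y)"
          using u y pt_in by (intro continuous_on_tendsto_compose[OF f(1)] always_eventually) auto
      qed
    qed simp
  qed
  moreover have "(\<integral>x. f x \<partial>curve t) = (\<integral>y. f (pt t y) \<partial>PQ)" if "t \<in> {0..1}" for t
    unfolding curve_def by (rule integral_distr[OF measurable_pt[OF that] fm])
  ultimately have "continuous_on {0..1} (\<lambda>t. \<integral>x. f x \<partial>curve t)"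
    by (metis (no_types, lifting) continuous_on_eq)
  then have "openin (top_of_set {0..1}) ({0..1} \<inter> (\<lambda>t. \<integral>x. f x \<partial>curve t) -` U)"
    using f(3) by (simp add: continuous_openin_preimage_eq)
  also have "{0..1} \<inter> (\<lambda>t. \<integral>x. f x \<partial>curve t) -` U = curve -` S \<inter> topspace (top_of_set {0..1})"
    unfolding S using curve_prob by auto
  finally show "openin (top_of_set {0..1}) (curve -` S \<inter> topspace (top_of_set {0..1}))" .
qed

lemma momentum_vector_measure:
  assumes t: "t \<in> {0..1}"
  shows "vector_measure (borel_on X) (momentum t)"
  unfolding vector_measure_def
proof (intro allI impI)
  fix A :: "nat \<Rightarrow> 'a set" assume A: "range A \<subseteq> sets (borel_on X)" "disjoint_family A"
  note measurable_pt[OF t, measurable]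
  have Ai[measurable]: "A i \<in> sets (borel_on X)" for i using A(1) by auto
  have i: "integrable PQ (\<lambda>y. indicat_real B (pt t y) *\<^sub>R vel y)"
    if [measurable]: "B \<in> sets (borel_on X)" for B
    by (rule Bochner_Integration.integrable_bound[OF integrable_vel]) (auto split: split_indicator)
  have UA[measurable]: "(\<Union>i. A i) \<in> sets (borel_on X)" using Ai by (intro sets.countable_UN) auto
  have s: "(\<lambda>i. indicat_real (A i) x) sums indicator (\<Union>i. A i) x" for x
    using A(2) by (intro indicator_sums) (auto simp: disjoint_family_on_def)
  have "(\<lambda>n. \<integral>y. (\<Sum>i<n. indicat_real (A i) (pt t y)) *\<^sub>R vel y \<partial>PQ) \<longlonglongrightarrow> momentum t (\<Union>i. A i)"
    unfolding momentum_def
  proof (rule integral_dominated_convergence[where w="\<lambda>y. norm (vel y)"])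
    show "AE y in PQ. (\<lambda>n. (\<Sum>i<n. indicat_real (A i) (pt t y)) *\<^sub>R vel y) \<longlonglongrightarrow> indicat_real (\<Union>i. A i) (pt t y) *\<^sub>R vel y"
      by (intro AE_I2 tendsto_intros s[unfolded sums_def])
    show "AE y in PQ. norm ((\<Sum>i<n. indicat_real (A i) (pt t y)) *\<^sub>R vel y) \<le> norm (vel y)" for n
    proof (rule AE_I2)
      fix y
      have "(\<Sum>i<n. indicat_real (A i) (pt t y)) \<le> indicator (\<Union>i. A i) (pt t y)"
        using sum_le_suminf[OF sums_summable[OF s[of "pt t y"]], of "{..<n}"] s[of "pt t y"]
        by (simp add: sums_iff)
      also have "\<dots> \<le> (1 :: real)" by (simp split: split_indicator)
      finally show "norm ((\<Sum>i<n. indicat_real (A i) (pt t y)) *\<^sub>R vel y) \<le> norm (vel y)"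
        by (simp add: sum_nonneg mult_left_le_one_le)
    qed
    show "(\<lambda>y. indicat_real (\<Union>i. A i) (pt t y) *\<^sub>R vel y) \<in> borel_measurable PQ"
      by (rule borel_measurable_integrable[OF i[OF UA]])
    show "(\<lambda>y. (\<Sum>i<n. indicat_real (A i) (pt t y)) *\<^sub>R vel y) \<in> borel_measurable PQ" for n
      by measurable
    show "integrable PQ (\<lambda>y. norm (vel y))" using integrable_vel by (rule integrable_norm)
  qed
  moreover have "(\<integral>y. (\<Sum>i<n. indicat_real (A i) (pt t y)) *\<^sub>R vel y \<partial>PQ) = (\<Sum>i<n. momentum t (A i))" for n
    unfolding momentum_def scaleR_sum_left by (intro Bochner_Integration.integral_sum i Ai)
  ultimately show "(\<lambda>i. momentum t (A i)) sums momentum t (\<Union>i. A i)" by (simp add: sums_def)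
qed

lemma momentum_in_momentum_curves: "momentum \<in> momentum_curves X"
  unfolding momentum_curves_def
proof (intro CollectI conjI ballI)
  show "vector_measure (borel_on X) (momentum t)" if "t \<in> {0..1}" for t
    by (rule momentum_vector_measure[OF that])
  fix A assume A[measurable]: "A \<in> sets (borel_on X)"
  interpret U: prob_space unit_lborel by (rule prob_space_unit_lborel)
  obtain R where R: "0 \<le> R" "\<And>y. y \<in> X \<times> X \<Longrightarrow> norm (vel y) \<le> R" using vel_bounded by blast
  have A2: "{0..1::real} \<times> A \<in> sets (borel_on ({0..1} \<times> X))"
  proof -
    obtain B where B: "B \<in> sets borel" "A = X \<inter> B" using A by (auto simp: sets_restrict_space)
    have "{0..1} \<times> B \<in> sets (borel :: (real \<times> 'a) measure)"
      unfolding borel_prod[symmetric] using B(1) by (intro pair_measureI) auto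
    moreover have "{0..1::real} \<times> A = ({0..1} \<times> X) \<inter> ({0..1} \<times> B)" by (auto simp: B)
    ultimately show ?thesis unfolding sets_restrict_space by (intro image_eqI)
  qed
  \<comment> \<open>Membership of \<open>pt t y\<close> in \<open>A\<close> is rewritten as
    membership of \<open>(t, pt t y)\<close> in a space-time set, so that joint measurability of the
    pair applies.\<close>
  have "(\<lambda>(t, y). indicat_real ({0..1} \<times> A) (t, pt t y) *\<^sub>R vel y)
      \<in> borel_measurable (unit_lborel \<Otimes>\<^sub>M PQ)"
    unfolding case_prod_unfold using A2 by (intro borel_measurable_scaleR measurable_compose[OF measurable_snd measurable_vel]
        measurable_compose[OF measurable_time_pt] borel_measurable_indicator)
  from pq.P.borel_measurable_lebesgue_integral[OF this]
  have "(\<lambda>t. \<integral>y. indicat_real ({0..1} \<times> A) (t, pt t y) *\<^sub>R vel y \<partial>PQ) \<in> borel_measurable unit_lborel" .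
  then have m: "(\<lambda>t. momentum t A) \<in> borel_measurable unit_lborel"
    by (subst measurable_cong[where g="\<lambda>t. \<integral>y. indicat_real ({0..1} \<times> A) (t, pt t y) *\<^sub>R vel y \<partial>PQ"])
      (auto simp: momentum_def space_unit_lborel indicator_times)
  have "integrable unit_lborel (\<lambda>t. momentum t A)"
  proof (rule U.integrable_const_bound[of _ R])
    show "AE t in unit_lborel. norm (momentum t A) \<le> R"
    proof (rule AE_I2)
      fix t assume "t \<in> space unit_lborel"
      have "norm (momentum t A) \<le> (\<integral>y. R \<partial>PQ)" unfolding momentum_def
      proof (rule order_trans[OF integral_norm_bound integral_mono'])
        fix y assume "y \<in> space PQ"
        then show "norm (indicat_real A (pt t y) *\<^sub>R vel y) \<le> R"
          using R by (auto simp: space_pq split: split_indicator)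
      qed (use R in auto)
      then show "norm (momentum t A) \<le> R" by (simp add: pq.P.prob_space)
    qed
  qed (rule m)
  then show "set_integrable lborel {0..1} (\<lambda>t. momentum t A)"
    unfolding set_integrable_def by (subst (asm) integrable_restrict_space) auto
qed

lemma momentum_abs_continuous:
  assumes t: "t \<in> {0..1}"
  shows "abs_continuous (momentum t) (curve t)"
  unfolding abs_continuous_def
proof
  fix A assume "A \<in> null_sets (curve t)"
  then have "AE x in curve t. x \<notin> A" by (rule AE_not_in)
  then have "AE y in PQ. pt t y \<notin> A"
    unfolding curve_def by (rule AE_distrD[OF measurable_pt[OF t]])
  then show "momentum t A = 0" unfolding momentum_def
    by (intro integral_eq_zero_AE) (rule AE_mp, auto intro!: AE_I2)
qed

abbreviation velocity :: "real \<Rightarrow> 'a \<Rightarrow> 'a" where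
  "velocity t \<equiv> vector_density (momentum t) (curve t)"

lemma velocity_density:
  assumes t: "t \<in> {0..1}"
  shows "integrable (curve t) (velocity t)"
    and "A \<in> sets (curve t) \<Longrightarrow> momentum t A = set_lebesgue_integral (curve t) A (velocity t)"
proof -
  interpret prob_space "curve t" by (rule prob_measuresD(1)[OF curve_prob[OF t]])
  have "vector_measure (curve t) (momentum t)"
    using momentum_vector_measure[OF t] by (simp add: vector_measure_def sets_curve)
  from vector_density_integrable[OF this momentum_abs_continuous[OF t]]
  show "integrable (curve t) (velocity t)"
    and "A \<in> sets (curve t) \<Longrightarrow> momentum t A = set_lebesgue_integral (curve t) A (velocity t)" by auto
qed

lemma measurable_pt_curve: "t \<in> {0..1} \<Longrightarrow> pt t \<in> PQ \<rightarrow>\<^sub>M curve t"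
  using measurable_pt measurable_cong_sets[OF refl sets_curve] by blast

lemma curve_eq_distr: "curve t = distr PQ (curve t) (pt t)"
  using distr_cong[OF refl sets_curve, of PQ "pt t" "pt t" t] by (simp add: curve_def)

lemma velocity_pushforward:
  assumes t: "t \<in> {0..1}" and A: "A \<in> sets (curve t)"
  shows "set_lebesgue_integral (curve t) A (velocity t)
    = (\<integral>y. indicat_real A (pt t y) *\<^sub>R vel y \<partial>PQ)"
  using velocity_density(2)[OF t A] by (simp add: momentum_def)

lemma integral_inner_velocity:
  assumes t: "t \<in> {0..1}" and g: "g \<in> borel_measurable (borel_on X)"
    and bd: "AE x in curve t. norm (g x) \<le> C"
  shows "(\<integral>x. g x \<bullet> velocity t x \<partial>curve t) = (\<integral>y. g (pt t y) \<bullet> vel y \<partial>PQ)"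
proof (rule integral_inner_transfer[OF measurable_pt_curve[OF t] curve_eq_distr velocity_density(1)[OF t]
      integrable_vel velocity_pushforward[OF t] _ bd])
  show "g \<in> borel_measurable (curve t)"
    using g measurable_cong_sets[OF sets_curve refl] by blast
qed

text \<open>The values of \<open>vel\<close> lie in the half-spaces
  \<open>{z. z \<bullet> u \<le> R}\<close> for all unit vectors \<open>u\<close>, and averaging
  preserves this. Taking \<open>u = b\<close> and \<open>u = - b\<close> for basis vectors involves
  finitely many null sets and yields a bound uniform in \<open>t\<close>.\<close>

lemma velocity_bounded:
  obtains K where "0 \<le> K" "\<And>t. t \<in> {0..1} \<Longrightarrow> AE x in curve t. norm (velocity t x) \<le> K"
proof -
  obtain R where R: "0 \<le> R" "\<And>y. y \<in> X \<times> X \<Longrightarrow> norm (vel y) \<le> R" using vel_bounded by blast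
  have "AE x in curve t. norm (velocity t x) \<le> (\<Sum>b\<in>(Basis::'a set). R)" if t: "t \<in> {0..1}" for t
  proof -
    have le: "AE x in curve t. velocity t x \<bullet> u \<le> R" if "norm u = 1" for u
    proof (rule AE_inner_le_of_integral[OF measurable_pt_curve[OF t] curve_eq_distr pq.P.prob_space_axioms velocity_density(1)[OF t]
          integrable_vel velocity_pushforward[OF t]])
      fix y assume "y \<in> space PQ"
      then have "norm (vel y) \<le> R" using R by (simp add: space_pq)
      then show "vel y \<bullet> u \<le> R" using norm_cauchy_schwarz[of "vel y" u] that by simp
    qed
    have "AE x in curve t. \<forall>b\<in>Basis. velocity t x \<bullet> b \<le> R \<and> velocity t x \<bullet> (- b) \<le> R"
      by (intro AE_finite_allI finite_Basis AE_conjI le) simp_all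
    then show ?thesis
    proof (rule AE_mp, intro AE_I2 impI)
      fix x assume b: "\<forall>b\<in>Basis. velocity t x \<bullet> b \<le> R \<and> velocity t x \<bullet> (- b) \<le> R"
      have "norm (velocity t x) \<le> (\<Sum>b\<in>Basis. \<bar>velocity t x \<bullet> b\<bar>)" by (rule norm_le_l1)
      also have "\<dots> \<le> (\<Sum>b\<in>(Basis::'a set). R)" using b by (intro sum_mono) (auto simp: abs_le_iff)
      finally show "norm (velocity t x) \<le> (\<Sum>b\<in>(Basis::'a set). R)" .
    qed
  qed
  moreover have "0 \<le> (\<Sum>b\<in>(Basis::'a set). R)" using R(1) by (intro sum_nonneg) simp
  ultimately show thesis using that by blast
qed

text \<open>Jensen's inequality for the conditional expectation of \<open>vel\<close> given \<open>pt t\<close>, obtained by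
  integrating the tangent inequality of \<open>L\<close> at the velocity.\<close>

lemma velocity_jensen:
  assumes t: "t \<in> {0..1}" and L: "C1_on UNIV L" "convex_on UNIV L"
  shows "integrable (curve t) (\<lambda>x. L (velocity t x))"
    and "(\<integral>x. L (velocity t x) \<partial>curve t) \<le> (\<integral>y. L (vel y) \<partial>PQ)"
proof -
  interpret prob_space "curve t" by (rule prob_measuresD(1)[OF curve_prob[OF t]])
  obtain D where D: "continuous_on UNIV D" "\<And>x. GDERIV L x :> D x"
    using L(1) unfolding C1_on_def by (metis UNIV_I top.extremum_unique)
  have cL: "continuous_on UNIV L" by (rule C1_on_continuous[OF L(1)])
  have Lm: "L \<in> borel_measurable borel" and Dm: "D \<in> borel_measurable borel"
    using cL D(1) by (auto intro: borel_measurable_continuous_onI)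
  obtain K where K: "0 \<le> K" "AE x in curve t. norm (velocity t x) \<le> K" using velocity_bounded t by metis
  obtain R where R: "\<And>y. y \<in> X \<times> X \<Longrightarrow> norm (vel y) \<le> R" using vel_bounded by blast
  define v where "v = velocity t"
  have vi: "integrable (curve t) v" unfolding v_def by (rule velocity_density(1)[OF t])
  then have vc: "v \<in> borel_measurable (curve t)" by auto
  have vK: "AE x in curve t. norm (v x) \<le> K" using K(2) by (simp add: v_def)
  from vc have vm: "v \<in> borel_measurable (borel_on X)" using measurable_cong_sets[OF sets_curve refl] by blast
  \<comment> \<open>Continuity bounds \<open>L\<close> and \<open>D\<close> on balls that contain
    the velocities; all integrability below rests on this.\<close>
  obtain CL where CL: "\<And>x. x \<in> cball 0 K \<Longrightarrow> norm (L x) \<le> CL"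
    using continuous_on_compact_bound[OF compact_cball continuous_on_subset[OF cL subset_UNIV]] by blast
  obtain CR where CR: "\<And>x. x \<in> cball 0 R \<Longrightarrow> norm (L x) \<le> CR"
    using continuous_on_compact_bound[OF compact_cball continuous_on_subset[OF cL subset_UNIV]] by blast
  obtain CD where CD: "\<And>x. x \<in> cball 0 K \<Longrightarrow> norm (D x) \<le> CD"
    using continuous_on_compact_bound[OF compact_cball continuous_on_subset[OF D(1) subset_UNIV]] by blast
  have iLv: "integrable (curve t) (\<lambda>x. L (v x))"
  proof (rule integrable_const_bound)
    show "AE x in curve t. norm (L (v x)) \<le> CL"
      using vK by (rule AE_mp) (use CL in \<open>auto intro!: AE_I2\<close>)
  qed (rule measurable_compose[OF vc Lm])
  then show "integrable (curve t) (\<lambda>x. L (velocity t x))" by (simp only: v_def)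
  have Dvm: "(\<lambda>x. D (v x)) \<in> borel_measurable (borel_on X)" by (rule measurable_compose[OF vm Dm])
  have Dvc: "(\<lambda>x. D (v x)) \<in> borel_measurable (curve t)" by (rule measurable_compose[OF vc Dm])
  have Dbd: "AE x in curve t. norm (D (v x)) \<le> CD"
    using vK by (rule AE_mp) (use CD in \<open>auto intro!: AE_I2\<close>)
  have ptm: "pt t \<in> PQ \<rightarrow>\<^sub>M borel_on X" by (rule measurable_pt[OF t])
  have i1: "integrable PQ (\<lambda>y. L (v (pt t y)))"
    using iLv unfolding curve_def by (rule integrable_distr[OF ptm])
  have i2: "integrable PQ (\<lambda>y. D (v (pt t y)) \<bullet> v (pt t y))"
    using integrable_inner_bounded[OF vi Dvc Dbd] unfolding curve_def
    by (rule integrable_distr[OF ptm])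
  have i3: "integrable PQ (\<lambda>y. D (v (pt t y)) \<bullet> vel y)"
  proof (rule integrable_inner_bounded[OF integrable_vel measurable_compose[OF ptm Dvm]])
    show "AE y in PQ. norm (D (v (pt t y))) \<le> CD"
      using Dbd unfolding curve_def by (rule AE_distrD[OF ptm])
  qed
  have i4: "integrable PQ (\<lambda>y. L (vel y))"
    by (rule pq.P.integrable_const_bound[of _ CR])
      (use CR R measurable_compose[OF measurable_vel Lm] in \<open>auto intro!: AE_I2 simp: space_pq\<close>)
  have "(\<integral>x. L (v x) \<partial>curve t) = (\<integral>y. L (v (pt t y)) \<partial>PQ)"
    unfolding curve_def by (rule integral_distr[OF ptm measurable_compose[OF vm Lm]])
  also have "\<dots> \<le> (\<integral>y. L (vel y) - (D (v (pt t y)) \<bullet> vel y - D (v (pt t y)) \<bullet> v (pt t y)) \<partial>PQ)"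
  proof (intro integral_mono i1 Bochner_Integration.integrable_diff i2 i3 i4)
    fix y
    show "L (v (pt t y)) \<le> L (vel y) - (D (v (pt t y)) \<bullet> vel y - D (v (pt t y)) \<bullet> v (pt t y))"
      using convex_GDERIV_above_tangent[OF L(2) D(2), of "v (pt t y)" "vel y"]
      by (simp add: inner_diff_left inner_commute[of "D (v (pt t y))"])
  qed
  also have "\<dots> = (\<integral>y. L (vel y) \<partial>PQ) - ((\<integral>y. D (v (pt t y)) \<bullet> vel y \<partial>PQ)
      - (\<integral>y. D (v (pt t y)) \<bullet> v (pt t y) \<partial>PQ))"
    using i2 i3 i4 by simp
  also have "(\<integral>y. D (v (pt t y)) \<bullet> v (pt t y) \<partial>PQ) = (\<integral>x. D (v x) \<bullet> v x \<partial>curve t)"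
    unfolding curve_def by (rule integral_distr[OF ptm, symmetric]) (intro borel_measurable_inner Dvm vm)
  \<comment> \<open>\<open>D (v x)\<close> is a function of position, so against it the averaged
    velocity \<open>v\<close> and the individual velocity \<open>vel\<close> have the same integral;
    the first-order terms cancel.\<close>
  also have "\<dots> = (\<integral>y. D (v (pt t y)) \<bullet> vel y \<partial>PQ)"
    using integral_inner_velocity[OF t Dvm Dbd] by (simp only: v_def)
  finally show "(\<integral>x. L (velocity t x) \<partial>curve t) \<le> (\<integral>y. L (vel y) \<partial>PQ)" by (simp add: v_def)
qed

text \<open>The velocity is bounded uniformly in time, so every exponent would do; \<open>2\<close>
  later serves as the witness for \<open>r\<close>.\<close>

lemma velocity_moment:
  "(\<integral>\<^sup>+t\<in>{0..1}. (\<integral>\<^sup>+x. ennreal (norm (velocity t x) powr 2) \<partial>curve t) \<partial>lborel) < \<infinity>"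
proof -
  interpret U: prob_space unit_lborel by (rule prob_space_unit_lborel)
  obtain K where K: "0 \<le> K" "\<And>t. t \<in> {0..1} \<Longrightarrow> AE x in curve t. norm (velocity t x) \<le> K"
    using velocity_bounded by blast
  have "(\<integral>\<^sup>+t. (\<integral>\<^sup>+x. ennreal (norm (velocity t x) powr 2) \<partial>curve t) \<partial>unit_lborel)
      \<le> (\<integral>\<^sup>+t. ennreal (K powr 2) \<partial>unit_lborel)"
  proof (rule nn_integral_mono)
    fix t assume "t \<in> space unit_lborel"
    then have t: "t \<in> {0..1}" by (simp add: space_unit_lborel)
    interpret prob_space "curve t" by (rule prob_measuresD(1)[OF curve_prob[OF t]])
    have "(\<integral>\<^sup>+x. ennreal (norm (velocity t x) powr 2) \<partial>curve t) \<le> (\<integral>\<^sup>+x. ennreal (K powr 2) \<partial>curve t)"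
    proof (rule nn_integral_mono_AE)
      show "AE x in curve t. ennreal (norm (velocity t x) powr 2) \<le> ennreal (K powr 2)"
        using K(2)[OF t] by (rule AE_mp, intro AE_I2 impI ennreal_leI powr_mono2) simp_all
    qed
    then show "(\<integral>\<^sup>+x. ennreal (norm (velocity t x) powr 2) \<partial>curve t) \<le> ennreal (K powr 2)"
      by (simp add: emeasure_space_1)
  qed
  also have "\<dots> < \<infinity>" by (simp add: U.emeasure_space_1[unfolded space_unit_lborel] space_unit_lborel less_top[symmetric])
  finally show ?thesis by (simp add: nn_integral_unit_lborel)
qed

text \<open>On a single segment the equation is the fundamental theorem of calculus for
  \<open>\<eta> (s, pt s y)\<close>, whose derivative is \<open>Dt + Dx \<bullet> vel\<close> along
  the segment. Averaging over \<open>PQ\<close> and exchanging the order of integration gives the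
  weak equation; the averaged velocity may be replaced by \<open>vel\<close> since at fixed time
  \<open>Dx\<close> depends on position only.\<close>

lemma interpolation_continuity_equation: "continuity_equation X curve momentum"
  unfolding continuity_equation_def
proof (intro allI impI)
  fix \<eta> :: "real \<times> 'a \<Rightarrow> real" assume \<eta>: "C1_on ({0..1} \<times> X) \<eta>"
  interpret U: prob_space unit_lborel by (rule prob_space_unit_lborel)
  interpret UP: pair_prob_space unit_lborel PQ
    by (simp add: pair_prob_space_def pair_sigma_finite_def prob_space_imp_sigma_finite
        U.prob_space_axioms pq.P.prob_space_axioms)
  define Dt where "Dt y = time_deriv \<eta> (fst y) (snd y)" for y
  define Dx where "Dx y = space_grad \<eta> (fst y) (snd y)" for y
  have D: "continuous_on ({0..1} \<times> X) Dt" "continuous_on ({0..1} \<times> X) Dx"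
    unfolding Dt_def Dx_def by (rule C1_on_space_time[OF \<eta>])+
  have der: "(\<eta> has_derivative (\<lambda>h. fst h * Dt (t, x) + snd h \<bullet> Dx (t, x))) (at (t, x))"
    if "t \<in> {0..1}" "x \<in> X" for t x
    using C1_on_space_time(3)[OF \<eta> that] by (simp add: Dt_def Dx_def)
  have c\<eta>: "continuous_on ({0..1} \<times> X) \<eta>" by (rule C1_on_continuous[OF \<eta>])
  have K: "compact ({0..1::real} \<times> X)" by (intro compact_Times compact compact_Icc)
  obtain Ct where Ct: "\<And>z. z \<in> {0..1} \<times> X \<Longrightarrow> norm (Dt z) \<le> Ct"
    using continuous_on_compact_bound[OF K D(1)] by blast
  obtain Cx where Cx: "0 \<le> Cx" "\<And>z. z \<in> {0..1} \<times> X \<Longrightarrow> norm (Dx z) \<le> Cx"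
    using continuous_on_compact_bound[OF K D(2)] by blast
  obtain R where R: "0 \<le> R" "\<And>y. y \<in> X \<times> X \<Longrightarrow> norm (vel y) \<le> R" using vel_bounded by blast
  have in_X: "fst z \<in> {0..1}" "snd z \<in> X \<times> X" "(fst z, pt (fst z) (snd z)) \<in> {0..1} \<times> X"
    if "z \<in> space (unit_lborel \<Otimes>\<^sub>M PQ)" for z
    using that pt_in[of "fst z" "snd z"]
    by (auto simp: space_pair_measure[of unit_lborel] space_pq space_unit_lborel)
  let ?T = "\<lambda>z. (fst z, pt (fst z) (snd z))"
  have mt: "(\<lambda>z. Dt (?T z)) \<in> borel_measurable (unit_lborel \<Otimes>\<^sub>M PQ)"
    by (rule measurable_compose[OF measurable_time_pt borel_measurable_continuous_on_restrict[OF D(1)]])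
  have mx: "(\<lambda>z. Dx (?T z) \<bullet> vel (snd z)) \<in> borel_measurable (unit_lborel \<Otimes>\<^sub>M PQ)"
    by (intro borel_measurable_inner
        measurable_compose[OF measurable_time_pt borel_measurable_continuous_on_restrict[OF D(2)]]
        measurable_compose[OF measurable_snd measurable_vel])
  have it: "integrable (unit_lborel \<Otimes>\<^sub>M PQ) (\<lambda>z. Dt (?T z))"
    by (rule UP.P.integrable_const_bound[OF _ mt, of Ct]) (intro AE_I2 Ct in_X(3))
  have ix: "integrable (unit_lborel \<Otimes>\<^sub>M PQ) (\<lambda>z. Dx (?T z) \<bullet> vel (snd z))"
  proof (rule UP.P.integrable_const_bound[OF _ mx, of "Cx * R"], rule AE_I2)
    fix z assume z: "z \<in> space (unit_lborel \<Otimes>\<^sub>M PQ)"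
    show "norm (Dx (?T z) \<bullet> vel (snd z)) \<le> Cx * R"
      using order_trans[OF abs_inner_le[OF Cx(2)[OF in_X(3)[OF z]]] mult_left_mono[OF R(2)[OF in_X(2)[OF z]] Cx(1)]]
      by simp
  qed
  have it': "integrable unit_lborel (\<lambda>t. \<integral>y. Dt (t, pt t y) \<partial>PQ)"
    using UP.integrable_fst'[OF it] by simp
  have ix': "integrable unit_lborel (\<lambda>t. \<integral>y. Dx (t, pt t y) \<bullet> vel y \<partial>PQ)"
    using UP.integrable_fst'[OF ix] by simp
  have "(\<integral>t. (\<integral>x. time_deriv \<eta> t x \<partial>curve t) \<partial>unit_lborel)
      = (\<integral>t. (\<integral>y. Dt (t, pt t y) \<partial>PQ) \<partial>unit_lborel)"
  proof (intro lebesgue_integral_cong)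
    fix t assume "t \<in> space unit_lborel"
    then have t: "t \<in> {0..1}" by (simp add: space_unit_lborel)
    have "continuous_on X (\<lambda>x. Dt (t, x))"
      by (rule continuous_on_compose2[OF D(1)]) (use t in \<open>auto intro!: continuous_intros\<close>)
    from integral_distr[OF measurable_pt[OF t] borel_measurable_continuous_on_restrict[OF this]]
    show "(\<integral>x. time_deriv \<eta> t x \<partial>curve t) = (\<integral>y. Dt (t, pt t y) \<partial>PQ)"
      by (simp add: curve_def Dt_def)
  qed
  moreover have "(\<integral>t. vector_integral (borel_on X) (momentum t) (space_grad \<eta> t) \<partial>unit_lborel)
      = (\<integral>t. (\<integral>y. Dx (t, pt t y) \<bullet> vel y \<partial>PQ) \<partial>unit_lborel)"
  proof (intro lebesgue_integral_cong)
    fix t assume "t \<in> space unit_lborel"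
    then have t: "t \<in> {0..1}" by (simp add: space_unit_lborel)
    have eq: "space_grad \<eta> t = (\<lambda>x. Dx (t, x))" by (simp add: Dx_def fun_eq_iff)
    have c: "continuous_on X (\<lambda>x. Dx (t, x))"
      by (rule continuous_on_compose2[OF D(2)]) (use t in \<open>auto intro!: continuous_intros\<close>)
    have b: "norm (Dx (t, x)) \<le> Cx" if "x \<in> X" for x using Cx(2)[of "(t, x)"] t that by simp
    have "vector_integral (borel_on X) (momentum t) (\<lambda>x. Dx (t, x)) = (\<integral>x. Dx (t, x) \<bullet> velocity t x \<partial>curve t)"
      using b by (intro vector_integral_eq[where C=Cx] velocity_density[OF t] sets_curve[symmetric]
        borel_measurable_continuous_prob[OF curve_prob[OF t] c]) (auto simp: space_curve)
    also have "\<dots> = (\<integral>y. Dx (t, pt t y) \<bullet> vel y \<partial>PQ)"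
      using b by (intro integral_inner_velocity[OF t borel_measurable_continuous_on_restrict[OF c], of Cx] AE_I2)
        (simp add: space_curve)
    finally show "vector_integral (borel_on X) (momentum t) (space_grad \<eta> t)
      = (\<integral>y. Dx (t, pt t y) \<bullet> vel y \<partial>PQ)" unfolding eq .
  qed
  moreover have "(\<integral>t. (\<integral>y. Dt (t, pt t y) \<partial>PQ) \<partial>unit_lborel)
      + (\<integral>t. (\<integral>y. Dx (t, pt t y) \<bullet> vel y \<partial>PQ) \<partial>unit_lborel)
      = (\<integral>z. Dt (?T z) + Dx (?T z) \<bullet> vel (snd z) \<partial>(unit_lborel \<Otimes>\<^sub>M PQ))"
    using UP.integral_fst'[OF it] UP.integral_fst'[OF ix] it ix by simp
  \<comment> \<open>Fubini: the time integral becomes the inner one, taken along a fixed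
    segment.\<close>
  moreover have "\<dots> = (\<integral>y. (\<integral>t. Dt (t, pt t y) + Dx (t, pt t y) \<bullet> vel y \<partial>unit_lborel) \<partial>PQ)"
    using UP.integral_snd[of "\<lambda>t y. Dt (t, pt t y) + Dx (t, pt t y) \<bullet> vel y"]
      Bochner_Integration.integrable_add[OF it ix] by (simp add: case_prod_unfold)
  moreover have "\<dots> = (\<integral>y. \<eta> (1, snd y) - \<eta> (0, fst y) \<partial>PQ)"
  proof (intro lebesgue_integral_cong)
    fix y assume "y \<in> space PQ"
    then have y: "y \<in> X \<times> X" by (simp add: space_pq)
    have ptd: "((\<lambda>s. (s, pt s y)) has_derivative (\<lambda>s. (s, s *\<^sub>R vel y))) (at t)" for t
      unfolding pt_def vel_def
      by (auto intro!: derivative_eq_intros simp: algebra_simps)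
    have vd: "((\<lambda>s. \<eta> (s, pt s y)) has_vector_derivative (Dt (t, pt t y) + Dx (t, pt t y) \<bullet> vel y)) (at t within {0..1})"
      if "0 \<le> t" "t \<le> 1" for t
    proof -
      have "((\<lambda>s. \<eta> (s, pt s y)) has_derivative (\<lambda>s. s * Dt (t, pt t y) + (s *\<^sub>R vel y) \<bullet> Dx (t, pt t y))) (at t)"
        using has_derivative_compose[OF ptd der[of t "pt t y"]] that pt_in[OF _ y] by simp
      then have "((\<lambda>s. \<eta> (s, pt s y)) has_derivative (\<lambda>s. s *\<^sub>R (Dt (t, pt t y) + Dx (t, pt t y) \<bullet> vel y))) (at t)"
        by (simp add: algebra_simps inner_commute)
      then show ?thesis unfolding has_vector_derivative_def by (rule has_derivative_at_withinI)
    qed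
    have cpt: "continuous_on {0..1} (\<lambda>t. (t, pt t y))" unfolding pt_def by (intro continuous_intros)
    have "continuous_on {0..1} (\<lambda>t. Dt (t, pt t y) + Dx (t, pt t y) \<bullet> vel y)"
      using y pt_in by (intro continuous_intros continuous_on_compose2[OF D(1) cpt] continuous_on_compose2[OF D(2) cpt]) auto
    from integral_FTC_Icc[OF zero_le_one vd this]
    show "(\<integral>t. Dt (t, pt t y) + Dx (t, pt t y) \<bullet> vel y \<partial>unit_lborel) = \<eta> (1, snd y) - \<eta> (0, fst y)"
      by (simp add: integral_restrict_space pt_def)
  qed
  moreover have "\<dots> = (\<integral>x. \<eta> (1, x) \<partial>curve 1) - (\<integral>x. \<eta> (0, x) \<partial>curve 0)"
  proof -
    have c: "continuous_on X (\<lambda>x. \<eta> (t, x))" if "t \<in> {0..1}" for t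
      by (rule continuous_on_compose2[OF c\<eta>]) (use that in \<open>auto intro!: continuous_intros\<close>)
    have e: "(\<integral>x. \<eta> (t, x) \<partial>curve t) = (\<integral>y. \<eta> (t, pt t y) \<partial>PQ)"
      and i: "integrable PQ (\<lambda>y. \<eta> (t, pt t y))" if t: "t \<in> {0..1}" for t
    proof -
      show "(\<integral>x. \<eta> (t, x) \<partial>curve t) = (\<integral>y. \<eta> (t, pt t y) \<partial>PQ)"
        unfolding curve_def
        by (rule integral_distr[OF measurable_pt[OF t] borel_measurable_continuous_on_restrict[OF c[OF t]]])
      show "integrable PQ (\<lambda>y. \<eta> (t, pt t y))"
        using integrable_continuous_prob[OF curve_prob[OF t] compact c[OF t]] unfolding curve_def
        by (rule integrable_distr[OF measurable_pt[OF t]])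
    qed
    show ?thesis using e[of 1] e[of 0] i[of 1] i[of 0] by (simp add: pt_def)
  qed
  ultimately show "(LINT t:{0..1}|lborel. (\<integral>x. time_deriv \<eta> t x \<partial>curve t))
        + (LINT t:{0..1}|lborel. vector_integral (borel_on X) (momentum t) (space_grad \<eta> t))
        = (\<integral>x. \<eta> (1, x) \<partial>curve 1) - (\<integral>x. \<eta> (0, x) \<partial>curve 0)"
    unfolding integral_unit_lborel by simp
qed

lemma curve_0: "curve 0 = p" and curve_1: "curve 1 = q"
proof -
  have "curve 0 = distr PQ p fst" unfolding curve_def
    by (intro distr_cong) (simp_all add: pt_def prob_measuresD(2)[OF p])
  then show "curve 0 = p" by (simp add: pq.M2.distr_pair_fst)
  have "curve 1 = distr PQ q snd" unfolding curve_def
    by (intro distr_cong) (simp_all add: pt_def prob_measuresD(2)[OF q])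
  then show "curve 1 = q" by (simp add: pq.distr_pair_snd)
qed

text \<open>At each time Jensen bounds \<open>P t - N t\<close> by \<open>I\<close>. Neither
  \<open>P\<close> nor \<open>N\<close> is known to be measurable in \<open>t\<close>, so the bound
  is integrated in the form \<open>P t + ennreal (- I) \<le> N t + ennreal I\<close>; the bounded
  velocity keeps the negative part finite for the final subtraction.\<close>

lemma interpolation_cost:
  assumes L: "C1_on UNIV L" "convex_on UNIV L"
  shows "dynamical_cost L curve momentum \<le> ereal (\<integral>y. L (vel y) \<partial>PQ)"
proof -
  interpret U: prob_space unit_lborel by (rule prob_space_unit_lborel)
  define I where "I = (\<integral>y. L (vel y) \<partial>PQ)"
  have cL: "continuous_on UNIV L" by (rule C1_on_continuous[OF L(1)])
  obtain K where K: "0 \<le> K" "\<And>t. t \<in> {0..1} \<Longrightarrow> AE x in curve t. norm (velocity t x) \<le> K"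
    using velocity_bounded by blast
  obtain CL where CL: "\<And>x. x \<in> cball 0 K \<Longrightarrow> norm (L x) \<le> CL"
    using continuous_on_compact_bound[OF compact_cball continuous_on_subset[OF cL subset_UNIV]] by blast
  define P N where "P t = (\<integral>\<^sup>+x. ennreal (L (velocity t x)) \<partial>curve t)"
    and "N t = (\<integral>\<^sup>+x. ennreal (- L (velocity t x)) \<partial>curve t)" for t
  have N: "N t \<le> ennreal CL" if t: "t \<in> {0..1}" for t
  proof -
    interpret prob_space "curve t" by (rule prob_measuresD(1)[OF curve_prob[OF t]])
    have "N t \<le> (\<integral>\<^sup>+x. ennreal CL \<partial>curve t)" unfolding N_def
    proof (rule nn_integral_mono_AE)
      show "AE x in curve t. ennreal (- L (velocity t x)) \<le> ennreal CL"
        using K(2)[OF t] by (rule AE_mp, intro AE_I2 impI ennreal_leI) (use CL in \<open>force simp: abs_le_iff\<close>)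
    qed
    then show ?thesis by (simp add: emeasure_space_1)
  qed
  have PN: "P t + ennreal (- I) \<le> N t + ennreal I" if t: "t \<in> {0..1}" for t
  proof -
    note j = velocity_jensen[OF t L]
    have fin: "P t < \<top>" "N t < \<top>" using j(1) by (auto simp: P_def N_def real_integrable_def less_top)
    have "enn2real (P t) - enn2real (N t) \<le> I"
      using j(2) unfolding real_lebesgue_integral_def[OF j(1)] P_def N_def I_def .
    then have "ennreal (enn2real (P t)) + ennreal (- I) \<le> ennreal (enn2real (N t)) + ennreal I"
      by (cases "0 \<le> I") (auto simp: ennreal_neg ennreal_plus[symmetric] simp del: ennreal_plus)
    then show ?thesis using fin by simp
  qed
  define n where "n = (\<integral>\<^sup>+t. N t \<partial>unit_lborel)"
  define r where "r = (\<integral>\<^sup>+t. P t \<partial>unit_lborel)"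
  have "n \<le> (\<integral>\<^sup>+t. ennreal CL \<partial>unit_lborel)" unfolding n_def
    by (intro nn_integral_mono N) (simp add: space_unit_lborel)
  also have "\<dots> < \<infinity>" by (simp add: U.emeasure_space_1[unfolded space_unit_lborel] space_unit_lborel less_top[symmetric])
  finally have n: "n < \<infinity>" .
  have "r + ennreal (- I) = (\<integral>\<^sup>+t. P t + ennreal (- I) \<partial>unit_lborel)" unfolding r_def
    by (subst nn_integral_add_measurable) (simp_all add: U.emeasure_space_1[unfolded space_unit_lborel] space_unit_lborel)
  also have "\<dots> \<le> (\<integral>\<^sup>+t. N t + ennreal I \<partial>unit_lborel)"
    by (intro nn_integral_mono PN) (simp add: space_unit_lborel)
  also have "\<dots> = n + ennreal I" unfolding n_def
    by (subst nn_integral_add_measurable) (simp_all add: U.emeasure_space_1[unfolded space_unit_lborel] space_unit_lborel)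
  finally have le: "r + ennreal (- I) \<le> n + ennreal I" .
  have "enn2ereal r - enn2ereal n \<le> ereal I"
  proof -
    obtain n' where n': "n = ennreal n'" "0 \<le> n'" using n by (cases n) auto
    have "r \<noteq> \<top>" using le n' by (auto simp: top_unique)
    then obtain r' where r': "r = ennreal r'" "0 \<le> r'" by (cases r) auto
    have "r' - n' \<le> I"
      using le n' r' by (cases "0 \<le> I") (auto simp: ennreal_neg ennreal_plus[symmetric] simp del: ennreal_plus)
    then show ?thesis by (simp add: n' r' enn2ereal_ennreal)
  qed
  then show ?thesis
    by (simp add: dynamical_cost_def n_def r_def P_def N_def I_def nn_integral_unit_lborel)
qed

text \<open>Fubini with \<open>z\<close> as the inner variable: for each fixed endpoint
  \<open>x\<close> invariance holds for almost every \<open>z\<close>, with an exceptional set that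
  may depend on \<open>x\<close>.\<close>

lemma integral_vel_translation_invariant:
  assumes L: "continuous_on UNIV L" and inv: "translation_invariant X p L"
  shows "(\<integral>y. L (vel y) \<partial>PQ) = (\<integral>x. L x \<partial>q)"
proof -
  obtain R where R: "\<And>y. y \<in> X \<times> X \<Longrightarrow> norm (vel y) \<le> R" using vel_bounded by blast
  obtain C where C: "\<And>x. x \<in> cball 0 R \<Longrightarrow> norm (L x) \<le> C"
    using continuous_on_compact_bound[OF compact_cball continuous_on_subset[OF L subset_UNIV]] by blast
  have "integrable PQ (\<lambda>y. L (vel y))"
    by (rule pq.P.integrable_const_bound[of _ C])
      (use C R measurable_compose[OF measurable_vel borel_measurable_continuous_onI[OF L]]
        in \<open>auto intro!: AE_I2 simp: space_pq\<close>)
  then have "(\<integral>y. L (vel y) \<partial>PQ) = (\<integral>x. (\<integral>z. L (x - z) \<partial>p) \<partial>q)"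
    using pq.integral_snd[of "\<lambda>z x. L (x - z)"] by (simp add: vel_def case_prod_unfold)
  also have "\<dots> = (\<integral>x. L x \<partial>q)"
  proof (intro lebesgue_integral_cong)
    fix x assume "x \<in> space q"
    then have "AE z in p. L (x - z) = L x"
      using inv by (simp add: translation_invariant_def prob_measuresD(3)[OF q])
    moreover have "(\<lambda>z. L (x - z)) \<in> borel_measurable p"
      by (intro borel_measurable_continuous_prob[OF p] continuous_on_compose2[OF L] continuous_intros) auto
    ultimately have "(\<integral>z. L (x - z) \<partial>p) = (\<integral>z. L x \<partial>p)" by (intro integral_cong_AE) auto
    then show "(\<integral>z. L (x - z) \<partial>p) = L x" by (simp add: pq.M1.prob_space)
  qed
  finally show ?thesis .
qed

end

section \<open>Strong duality\<close>

lemma interpolation_admissible: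
  fixes \<Omega> :: "(real ^ 'd) set" and p \<gamma> :: "(real ^ 'd ^ 'k::finite) measure"
  assumes \<Omega>: "compact \<Omega>" "convex \<Omega>" and p: "p \<in> prob_measures (vec_power \<Omega>)"
    and \<gamma>: "\<gamma> \<in> prob_measures (vec_power \<Omega>)" "\<And>l. distr \<gamma> (borel_on \<Omega>) (\<lambda>x. x $ l) = \<mu> l"
    and L: "C1_on UNIV L" "convex_on UNIV L" "translation_invariant (vec_power \<Omega>) p L"
  obtains \<pi> m where "(\<pi>, m) \<in> admissible \<Omega> p \<mu>" "dynamical_cost L \<pi> m \<le> ereal (\<integral>x. L x \<partial>\<gamma>)"
proof -
  interpret linear_interpolation "vec_power \<Omega>" p \<gamma>
    by unfold_locales (use vec_power_compact vec_power_convex \<Omega> p \<gamma>(1) in auto)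
  have "(curve, momentum) \<in> admissible \<Omega> p \<mu>"
    unfolding admissible_def
    using curve_in_prob_curves momentum_in_momentum_curves momentum_abs_continuous velocity_moment
      interpolation_continuity_equation curve_0 curve_1 \<gamma>(2)
    by (auto intro!: exI[of _ 2])
  moreover have "dynamical_cost L curve momentum \<le> ereal (\<integral>x. L x \<partial>\<gamma>)"
    using interpolation_cost[OF L(1,2)]
      integral_vel_translation_invariant[OF C1_on_continuous[OF L(1)] L(3)] by simp
  ultimately show thesis by (rule that)
qed

text \<open>The function is the perspective of \<open>L\<close>, shifted in time by \<open>e\<close>
  and raised by a constant. With \<open>y = x / (t + e)\<close>, its time derivative
  \<open>L y - y \<bullet> D y\<close> is minus the Legendre transform at \<open>D y\<close> when
  \<open>L\<close> is convex, which is the Hamilton-Jacobi equation.\<close>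

lemma self_similar_GDERIV:
  fixes L :: "'a::real_inner \<Rightarrow> real"
  assumes D: "\<And>y. GDERIV L y :> D y" and s: "0 < t + e"
  shows "GDERIV (\<lambda>z. (fst z + e) * L (inverse (fst z + e) *\<^sub>R snd z) + c) (t, x) :>
    (L (inverse (t + e) *\<^sub>R x) - (inverse (t + e) *\<^sub>R x) \<bullet> D (inverse (t + e) *\<^sub>R x),
      D (inverse (t + e) *\<^sub>R x))"
proof -
  define y where "y = inverse (t + e) *\<^sub>R x"
  have inner: "((\<lambda>z. inverse (fst z + e) *\<^sub>R snd z) has_derivative
      (\<lambda>h. inverse (t + e) *\<^sub>R snd h - (fst h * (inverse (t + e))\<^sup>2) *\<^sub>R x)) (at (t, x))"
    using s by (auto intro!: derivative_eq_intros simp: power2_eq_square)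
  have L': "(L has_derivative (\<lambda>h. h \<bullet> D y)) (at (inverse (fst (t, x) + e) *\<^sub>R snd (t, x)))"
    using D[of y] by (simp add: gderiv_def y_def)
  have outer: "((\<lambda>z. L (inverse (fst z + e) *\<^sub>R snd z)) has_derivative
      (\<lambda>h. (inverse (t + e) *\<^sub>R snd h - (fst h * (inverse (t + e))\<^sup>2) *\<^sub>R x) \<bullet> D y)) (at (t, x))"
    by (rule has_derivative_compose[OF inner L'])
  have "((\<lambda>z. (fst z + e) * L (inverse (fst z + e) *\<^sub>R snd z) + c) has_derivative
      (\<lambda>h. (t + e) * ((inverse (t + e) *\<^sub>R snd h - (fst h * (inverse (t + e))\<^sup>2) *\<^sub>R x) \<bullet> D y)
        + fst h * L y)) (at (t, x))"
    by (rule has_derivative_eq_rhs) (auto intro!: derivative_eq_intros outer simp: y_def)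
  moreover have "(t + e) * ((inverse (t + e) *\<^sub>R snd h - (fst h * (inverse (t + e))\<^sup>2) *\<^sub>R x) \<bullet> D y)
      + fst h * L y = h \<bullet> (L y - y \<bullet> D y, D y)" for h
  proof -
    have "(t + e) * ((inverse (t + e) *\<^sub>R snd h - (fst h * (inverse (t + e))\<^sup>2) *\<^sub>R x) \<bullet> D y)
      = ((t + e) * inverse (t + e)) * (snd h \<bullet> D y)
        - fst h * ((t + e) * inverse (t + e)) * (inverse (t + e) * (x \<bullet> D y))"
      by (simp add: inner_diff_left power2_eq_square algebra_simps)
    also have "\<dots> = snd h \<bullet> D y - fst h * (y \<bullet> D y)" using s by (simp add: y_def)
    finally show ?thesis by (simp add: inner_prod_def algebra_simps)
  qed
  ultimately show ?thesis by (simp add: gderiv_def y_def)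
qed

text \<open>The rescaled function \<open>(t, x) \<mapsto> (t + e) * L (x / (t + e))\<close> solves the Hamilton--Jacobi
  equation. By the growth assumption its initial value has vanishing mean as \<open>e \<rightarrow> 0\<close>, while its final
  value exceeds \<open>L - e * M\<close>.\<close>

lemma static_le_dual:
  fixes \<Omega> :: "(real ^ 'd) set" and \<mu> :: "'k::finite \<Rightarrow> (real ^ 'd) measure"
    and L :: "real ^ 'd ^ 'k \<Rightarrow> real"
  assumes \<Omega>: "compact \<Omega>" and \<mu>: "\<And>l. \<mu> l \<in> prob_measures \<Omega>" and p: "p \<in> prob_measures (vec_power \<Omega>)"
    and L: "C1_on UNIV L" "convex_on UNIV L"
    and growth: "((\<lambda>\<beta>. (1 / \<beta>) * (\<integral>x. L (\<beta> *\<^sub>R x) \<partial>p)) \<longlongrightarrow> 0) at_top"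
    and V: "\<And>\<phi> \<psi>. (\<phi>, \<psi>) \<in> dual_feasible \<Omega> L \<mu> \<Longrightarrow>
      (\<Sum>l\<in>UNIV. \<integral>x. \<psi> l x \<partial>\<mu> l) - (\<integral>x. \<phi> (0, x) \<partial>p) \<le> V"
    and \<psi>: "\<And>l. integrable (\<mu> l) (\<psi> l)"
      "\<And>x. x \<in> vec_power \<Omega> \<Longrightarrow> (\<Sum>l\<in>UNIV. \<psi> l (x $ l)) \<le> L x"
  shows "(\<Sum>l\<in>UNIV. \<integral>x. \<psi> l x \<partial>\<mu> l) \<le> V"
proof -
  note X = vec_power_compact[OF \<Omega>]
  obtain D where D: "continuous_on UNIV D" "\<And>x. GDERIV L x :> D x"
    using L(1) unfolding C1_on_def by (metis UNIV_I top.extremum_unique)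
  have cL: "continuous_on UNIV L" by (rule C1_on_continuous[OF L(1)])
  interpret p: prob_space p by (rule prob_measuresD(1)[OF p])
  \<comment> \<open>By convexity this expression is the value of \<open>legendre L\<close> at
    \<open>D x\<close>; to first order in \<open>e\<close> it measures the drop from
    \<open>L x\<close> to \<open>(1 + e) * L (x / (1 + e))\<close>.\<close>
  have "continuous_on (vec_power \<Omega>) (\<lambda>x. x \<bullet> D x - L x)"
    by (intro continuous_intros continuous_on_subset[OF D(1)] continuous_on_subset[OF cL]) auto
  from continuous_on_compact_bound[OF X this] obtain M where
    M: "0 \<le> M" "\<And>x. x \<in> vec_power \<Omega> \<Longrightarrow> norm (x \<bullet> D x - L x) \<le> M" by blast
  have le: "(\<Sum>l\<in>UNIV. \<integral>x. \<psi> l x \<partial>\<mu> l) - ((1 / \<beta>) * (\<integral>x. L (\<beta> *\<^sub>R x) \<partial>p) + (1 / \<beta>) * M) \<le> V"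
    if \<beta>: "0 < \<beta>" for \<beta>
  proof -
    \<comment> \<open>The shift is tied to the growth parameter, so that
      \<open>e * L (x / e)\<close> becomes
      \<open>(1 / \<beta>) * L (\<beta> *\<^sub>R x)\<close>.\<close>
    define e where "e = 1 / \<beta>"
    have e: "0 < e" using \<beta> by (simp add: e_def)
    define \<phi> where "\<phi> z = (fst z + e) * L (inverse (fst z + e) *\<^sub>R snd z) + e * M" for z :: "real \<times> (real ^ 'd ^ 'k)"
    define y where "y t x = inverse (t + e) *\<^sub>R x" for t and x :: "real ^ 'd ^ 'k"
    have der: "GDERIV \<phi> (t, x) :> (L (y t x) - y t x \<bullet> D (y t x), D (y t x))" if "- e < t" for t x
      unfolding \<phi>_def y_def by (rule self_similar_GDERIV[OF D(2)]) (use that in simp)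
    have C1: "C1_on ({0..1} \<times> vec_power \<Omega>) \<phi>"
      unfolding C1_on_def
    proof (intro exI conjI ballI)
      let ?U = "{- e<..} \<times> (UNIV :: (real ^ 'd ^ 'k) set)"
      let ?D = "\<lambda>z. (L (y (fst z) (snd z)) - y (fst z) (snd z) \<bullet> D (y (fst z) (snd z)), D (y (fst z) (snd z)))"
      show "open ?U" by (intro open_Times) auto
      show "{0..1} \<times> vec_power \<Omega> \<subseteq> ?U" using e by auto
      have y: "continuous_on ?U (\<lambda>z. y (fst z) (snd z))"
        unfolding y_def by (intro continuous_intros) auto
      show "continuous_on ?U ?D"
        by (intro continuous_intros y continuous_on_compose2[OF cL y] continuous_on_compose2[OF D(1) y]) auto
      show "GDERIV \<phi> z :> ?D z" if "z \<in> ?U" for z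
        using der[of "fst z" "snd z"] that by auto
    qed
    have hj: "ereal (time_deriv \<phi> t x) + legendre L (space_grad \<phi> t x) \<le> 0" if "t \<in> {0..1}" for t x
    proof -
      have "- e < t" using that e by auto
      note d = GDERIV_space_time[OF der[OF this, of x], unfolded fst_conv snd_conv]
      \<comment> \<open>Tangent inequality: the supremum defining the transform at
        \<open>D (y t x)\<close> is attained at \<open>y t x\<close>.\<close>
      have "legendre L (D (y t x)) \<le> ereal (y t x \<bullet> D (y t x) - L (y t x))"
        unfolding legendre_def
      proof (rule SUP_least)
        fix w
        show "ereal (w \<bullet> D (y t x) - L w) \<le> ereal (y t x \<bullet> D (y t x) - L (y t x))"
          using convex_GDERIV_above_tangent[OF L(2) D(2), of "y t x" w] by (simp add: inner_diff_left)
      qed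
      then have "ereal (time_deriv \<phi> t x) + legendre L (space_grad \<phi> t x)
          \<le> ereal (L (y t x) - y t x \<bullet> D (y t x)) + ereal (y t x \<bullet> D (y t x) - L (y t x))"
        unfolding d by (rule add_left_mono)
      then show ?thesis by (simp add: zero_ereal_def)
    qed
    have final: "L x \<le> \<phi> (1, x)" if x: "x \<in> vec_power \<Omega>" for x
    proof -
      \<comment> \<open>The tangent at \<open>x\<close> is evaluated at \<open>y 1 x\<close>, where
        \<open>(1 + e) *\<^sub>R (y 1 x - x) = - e *\<^sub>R x\<close>. The loss is at most
        \<open>e * (x \<bullet> D x - L x)\<close>, which the added constant \<open>e * M\<close>
        compensates; a constant does not affect the Hamilton-Jacobi inequality.\<close>
      have "L x + (y 1 x - x) \<bullet> D x \<le> L (y 1 x)"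
        by (rule convex_GDERIV_above_tangent[OF L(2) D(2)])
      then have 1: "(1 + e) * (L x + (y 1 x - x) \<bullet> D x) \<le> (1 + e) * L (y 1 x)"
        using e by (intro mult_left_mono) auto
      have "(1 + e) *\<^sub>R (y 1 x - x) = ((1 + e) * inverse (1 + e)) *\<^sub>R x - (1 + e) *\<^sub>R x"
        by (simp add: y_def scaleR_diff_right)
      also have "\<dots> = (- e) *\<^sub>R x" using e by (simp add: scaleR_left_distrib)
      finally have "((1 + e) *\<^sub>R (y 1 x - x)) \<bullet> D x = ((- e) *\<^sub>R x) \<bullet> D x" by (rule arg_cong)
      then have 2: "(1 + e) * ((y 1 x - x) \<bullet> D x) = (- e) * (x \<bullet> D x)"
        unfolding inner_scaleR_left .
      have 3: "e * (x \<bullet> D x - L x) \<le> e * M" using M(2)[OF x] e by (intro mult_left_mono) auto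
      have "\<phi> (1, x) = (1 + e) * L (y 1 x) + e * M" by (simp add: \<phi>_def y_def)
      moreover have "(1 + e) * (L x + (y 1 x - x) \<bullet> D x) = L x + e * L x - e * (x \<bullet> D x)"
        unfolding distrib_left 2 by (simp add: algebra_simps)
      moreover have "e * (x \<bullet> D x - L x) = e * (x \<bullet> D x) - e * L x" by (rule right_diff_distrib)
      ultimately show ?thesis using 1 3 by linarith
    qed
    have "(\<phi>, \<psi>) \<in> dual_feasible \<Omega> L \<mu>"
      unfolding dual_feasible_def
    proof (intro CollectI case_prodI conjI allI ballI AE_I2)
      fix x assume "x \<in> space (Pi\<^sub>M UNIV \<mu>)"
      then have "vec_lambda x \<in> vec_power \<Omega>"
        using prob_measuresD(3)[OF \<mu>] by (auto simp: space_PiM vec_power_def)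
      with \<psi>(2)[OF this] final[OF this]
      show "(\<Sum>l\<in>UNIV. \<psi> l (x l)) \<le> \<phi> (1, vec_lambda x)" by simp
    qed (use C1 \<psi>(1) hj in auto)
    from V[OF this] have "(\<Sum>l\<in>UNIV. \<integral>x. \<psi> l x \<partial>\<mu> l) - (\<integral>x. \<phi> (0, x) \<partial>p) \<le> V" .
    moreover have "(\<integral>x. \<phi> (0, x) \<partial>p) = e * (\<integral>x. L (\<beta> *\<^sub>R x) \<partial>p) + e * M"
    proof -
      have "integrable p (\<lambda>x. L (\<beta> *\<^sub>R x))"
        by (intro integrable_continuous_prob[OF p X] continuous_on_compose2[OF cL] continuous_intros) auto
      moreover have "inverse e = \<beta>" by (simp add: e_def)
      ultimately show ?thesis by (simp add: \<phi>_def p.prob_space)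
    qed
    ultimately show ?thesis by (simp add: e_def)
  qed
  have lim: "((\<lambda>\<beta>. (\<Sum>l\<in>UNIV. \<integral>x. \<psi> l x \<partial>\<mu> l) - ((1 / \<beta>) * (\<integral>x. L (\<beta> *\<^sub>R x) \<partial>p) + (1 / \<beta>) * M))
      \<longlongrightarrow> (\<Sum>l\<in>UNIV. \<integral>x. \<psi> l x \<partial>\<mu> l) - (0 + 0 * M)) at_top"
  proof (intro tendsto_intros growth)
    show "((\<lambda>\<beta>::real. 1 / \<beta>) \<longlongrightarrow> 0) at_top"
      using tendsto_inverse_0_at_top[OF filterlim_ident] by (simp add: inverse_eq_divide)
  qed
  have "eventually (\<lambda>\<beta>. (\<Sum>l\<in>UNIV. \<integral>x. \<psi> l x \<partial>\<mu> l) - ((1 / \<beta>) * (\<integral>x. L (\<beta> *\<^sub>R x) \<partial>p) + (1 / \<beta>) * M) \<le> V) at_top"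
    using eventually_gt_at_top[of 0] by eventually_elim (rule le)
  from tendsto_upperbound[OF lim this] show ?thesis by simp
qed

theorem theorem3p2:
  fixes \<Omega> :: "(real ^ 'd) set"
    and \<mu> :: "'k::finite \<Rightarrow> (real ^ 'd) measure"
    and p :: "(real ^ 'd ^ 'k) measure"
    and L :: "real ^ 'd ^ 'k \<Rightarrow> real"
  assumes "compact \<Omega>" and "convex \<Omega>"
    and "\<And>l. \<mu> l \<in> prob_measures \<Omega>"
    and "p \<in> prob_measures (vec_power \<Omega>)"
    and "C1_on UNIV L"
    and "((\<lambda>\<beta>. (1 / \<beta>) * (\<integral>x. L (\<beta> *\<^sub>R x) \<partial>p)) \<longlongrightarrow> 0) at_top"
    and "convex_on UNIV L"
    and "translation_invariant (vec_power \<Omega>) p L"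
  shows "(INF (\<pi>, m)\<in>admissible \<Omega> p \<mu>. dynamical_cost L \<pi> m)
       = (SUP (\<phi>, \<psi>)\<in>dual_feasible \<Omega> L \<mu>.
            ereal ((\<Sum>l\<in>UNIV. \<integral>x. \<psi> l x \<partial>\<mu> l) - (\<integral>x. \<phi> (0, x) \<partial>p)))"
    (is "?inf = ?sup")
proof (rule antisym)
  note L = assms(5,7)
  have cL: "continuous_on UNIV L" by (rule C1_on_continuous[OF assms(5)])
  show "?sup \<le> ?inf"
    by (intro SUP_least INF_greatest) (auto intro: weak_duality[OF assms(1,3) cL])
  show "?inf \<le> ?sup"
  proof (rule ereal_le_real)
    \<comment> \<open>Testing against real upper bounds \<open>V\<close> of the supremum covers the
      case of an infinite supremum and lets the static duality work with a real number.\<close>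
    fix V assume V: "?sup \<le> ereal V"
    have dual: "(\<Sum>l\<in>UNIV. \<integral>x. \<psi> l x \<partial>\<mu> l) - (\<integral>x. \<phi> (0, x) \<partial>p) \<le> V"
      if "(\<phi>, \<psi>) \<in> dual_feasible \<Omega> L \<mu>" for \<phi> \<psi>
    proof -
      have "ereal ((\<Sum>l\<in>UNIV. \<integral>x. \<psi> l x \<partial>\<mu> l) - (\<integral>x. \<phi> (0, x) \<partial>p)) \<le> ?sup"
        using that by (intro SUP_upper2[where i="(\<phi>, \<psi>)"]) auto
      with V show ?thesis using order_trans ereal_less_eq(3) by blast
    qed
    show "?inf \<le> ereal V"
    proof (rule ereal_le_epsilon2)
      \<comment> \<open>The static problem is solved only up to \<open>e\<close>, since the coupling
        comes from a discretisation.\<close>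
      fix e :: real assume e: "0 < e"
      have cX: "continuous_on (vec_power \<Omega>) L" using cL by (rule continuous_on_subset) simp
      have "\<exists>\<gamma>. \<gamma> \<in> prob_measures (vec_power \<Omega>) \<and>
        (\<forall>l. distr \<gamma> (borel_on \<Omega>) (\<lambda>x. x $ l) = \<mu> l) \<and> (\<integral>x. L x \<partial>\<gamma>) \<le> V + e"
      proof (rule kantorovich_approximate_duality[OF assms(1,3) vec_power_compact[OF assms(1)] cX e])
        fix \<psi> :: "'k \<Rightarrow> real ^ 'd \<Rightarrow> real"
        assume \<psi>: "\<And>l. integrable (\<mu> l) (\<psi> l)"
          "\<And>x. x \<in> vec_power \<Omega> \<Longrightarrow> (\<Sum>l\<in>UNIV. \<psi> l (x $ l)) \<le> L x"
        show "(\<Sum>l\<in>UNIV. \<integral>x. \<psi> l x \<partial>\<mu> l) \<le> V"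
          by (rule static_le_dual[OF assms(1,3,4) L assms(6)]) (fact dual, fact \<psi>(1), fact \<psi>(2))
      qed blast
      then obtain \<gamma> where \<gamma>: "\<gamma> \<in> prob_measures (vec_power \<Omega>)"
        "\<And>l. distr \<gamma> (borel_on \<Omega>) (\<lambda>x. x $ l) = \<mu> l" "(\<integral>x. L x \<partial>\<gamma>) \<le> V + e" by blast
      obtain \<pi> m where \<pi>: "(\<pi>, m) \<in> admissible \<Omega> p \<mu>" "dynamical_cost L \<pi> m \<le> ereal (\<integral>x. L x \<partial>\<gamma>)"
        using interpolation_admissible[OF assms(1,2,4) \<gamma>(1,2) L assms(8)] by blast
      have "?inf \<le> dynamical_cost L \<pi> m"
        by (rule INF_lower2[OF \<pi>(1)]) simp
      also have "\<dots> \<le> ereal (V + e)" using \<pi>(2) \<gamma>(3) order_trans ereal_less_eq(3) by blast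
      finally show "?inf \<le> ereal V + ereal e" by simp
    qed
  qed
qed

end
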